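(* Let $(R,\mathfrak{m})$ be a complete local ring of dimension $n$ and let $I,J$ be two ideals of $R$. Let $M$ be a finitely generated $R$-module and let $t=\mathrm{depth}(I,J,M)$. Then the following are equivalent: (1) the natural homomorphism $R\to\mathrm{Hom}_R(H^t_{I,J}(M),H^t_{I,J}(M))$ is an isomorphism; (2) the natural homomorphism $R\to\mathrm{Hom}_R(D(H^t_{I,J}(M)),D(H^t_{I,J}(M)))$ is an isomorphism; (3) the natural homomorphism $H^t_{I,J}(M)\otimes_R D(H^t_{I,J}(M))\to E$ is an isomorphism.
   Context: All rings are commutative Noetherian with non-zero identity. For a local ring $(R,\mathfrak{m})$ with residue field $k=R/\mathfrak{m}$, let $E=E_R(k)$ be the injective hull of $k$ and $D(-)=\mathrm{Hom}_R(-,E)$ the Matlis dual functor. For ideals $I,J$ of $R$ and an $R$-module $M$, the $(I,J)$-torsion part of $M$ is $\Gamma_{I,J}(M)=\{x\in M \mid I^n x\subseteq Jx \text{ for } n\gg 1\}$. The functor $\Gamma_{I,J}(-)$ is left exact, additive and covariant on the category of $R$-modules; its $i$-th right derived functor is denoted $H^i_{I,J}(-)$. The depth of $(I,J)$ on $M$ is $\mathrm{depth}(I,J,M)=\inf\{i\in\mathbb{N}_0 \mid H^i_{I,J}(M)\neq 0\}$ if this infimum exists, and $\infty$ otherwise; writing $\mathrm{depth}(I,J,M)=t$ with $H^t_{I,J}(M)$ means that $t$ is finite. For an $R$-module $X$, the natural homomorphism $R\to\mathrm{Hom}_R(X,X)$ sends $r$ to multiplication by $r$, and the natural homomorphism $X\otimes_R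 D(X)\to E$ is the evaluation map $x\otimes f\mapsto f(x)$. *)

theory Defs
  imports "HOL-Algebra.Module" "HOL-Algebra.QuotRing" "HOL-Algebra.Ideal_Product"
    "HOL-Algebra.Ring_Divisibility" "HOL-Library.Extended_Nat"
begin

section \<open>Rings\<close>

abbreviation ideal_power :: "('a, 'm) ring_scheme \<Rightarrow> 'a set \<Rightarrow> nat \<Rightarrow> 'a set"
  where "ideal_power R I n \<equiv> I [^]\<^bsub>ideals_set R\<^esub> n"

definition noetherian_local_ring :: "('a, 'm) ring_scheme \<Rightarrow> 'a set \<Rightarrow> bool"
  where "noetherian_local_ring R \<mm> \<longleftrightarrow>
    cring R \<and> noetherian_ring R \<and> maximalideal \<mm> R \<and> (\<forall>\<nn>. maximalideal \<nn> R \<longrightarrow> \<nn> = \<mm>)"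

text \<open>The canonical map from \<open>R\<close> to the inverse limit of the rings \<open>R / \<aa>\<^sup>n\<close> is bijective. An element
  of the limit is a sequence of cosets; the transition maps send a coset of \<open>\<aa>\<^sup>n\<^sup>+\<^sup>1\<close> to the coset
  of \<open>\<aa>\<^sup>n\<close> containing it.\<close>

definition adically_complete :: "('a, 'm) ring_scheme \<Rightarrow> 'a set \<Rightarrow> bool"
  where "adically_complete R \<aa> \<longleftrightarrow>
    bij_betw (\<lambda>r n. ideal_power R \<aa> n +>\<^bsub>R\<^esub> r) (carrier R)
      {s. (\<forall>n. s n \<in> carrier (R Quot (ideal_power R \<aa> n))) \<and> (\<forall>n. s (Suc n) \<subseteq> s n)}"

definition krull_dim :: "('a, 'm) ring_scheme \<Rightarrow> enat"
  where "krull_dim R =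
    Sup {enat l | l. \<exists>\<pp> :: nat \<Rightarrow> 'a set.
      (\<forall>i\<le>l. primeideal (\<pp> i) R) \<and> (\<forall>i<l. \<pp> i \<subset> \<pp> (Suc i))}"


section \<open>Modules\<close>

text \<open>The fields \<^const>\<open>monoid.mult\<close> and \<^const>\<open>one\<close> of a module record play no role in the locale
  \<^locale>\<open>module\<close>; they are left unspecified in the constructions below.\<close>

definition ring_as_module :: "('a, 'm) ring_scheme \<Rightarrow> ('a, 'a) module"
  where "ring_as_module R = \<lparr>carrier = carrier R, monoid.mult = monoid.mult R, one = \<one>\<^bsub>R\<^esub>,
    ring.zero = \<zero>\<^bsub>R\<^esub>, add = add R, smult = monoid.mult R\<rparr>"

definition quot_module :: "('a, 'b) module \<Rightarrow> 'b set \<Rightarrow> ('a, 'b set) module"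
  where "quot_module M N = \<lparr>carrier = a_rcosets\<^bsub>M\<^esub> N, monoid.mult = undefined, one = undefined,
    ring.zero = N, add = set_add M, smult = (\<lambda>r C. N <+>\<^bsub>M\<^esub> (\<lambda>x. r \<odot>\<^bsub>M\<^esub> x) ` C)\<rparr>"

definition mod_span :: "('a, 'm) ring_scheme \<Rightarrow> ('a, 'b) module \<Rightarrow> 'b set \<Rightarrow> 'b set"
  where "mod_span R M S = \<Inter> {N. submodule N R M \<and> S \<subseteq> N}"

definition fin_gen_module :: "('a, 'm) ring_scheme \<Rightarrow> ('a, 'b) module \<Rightarrow> bool"
  where "fin_gen_module R M \<longleftrightarrow> module R M \<and>
    (\<exists>S. finite S \<and> S \<subseteq> carrier M \<and> mod_span R M S = carrier M)"

text \<open>Homomorphisms are extensional, so that equality of functions is equality on the carrier.\<close>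

definition mod_hom ::
    "('a, 'm) ring_scheme \<Rightarrow> ('a, 'b) module \<Rightarrow> ('a, 'c) module \<Rightarrow> ('b \<Rightarrow> 'c) set"
  where "mod_hom R A B = {h \<in> carrier A \<rightarrow>\<^sub>E carrier B.
    (\<forall>x\<in>carrier A. \<forall>y\<in>carrier A. h (x \<oplus>\<^bsub>A\<^esub> y) = h x \<oplus>\<^bsub>B\<^esub> h y) \<and>
    (\<forall>r\<in>carrier R. \<forall>x\<in>carrier A. h (r \<odot>\<^bsub>A\<^esub> x) = r \<odot>\<^bsub>B\<^esub> h x)}"

definition mod_iso ::
    "('a, 'm) ring_scheme \<Rightarrow> ('a, 'b) module \<Rightarrow> ('a, 'c) module \<Rightarrow> ('b \<Rightarrow> 'c) set"
  where "mod_iso R A B = {h \<in> mod_hom R A B. bij_betw h (carrier A) (carrier B)}"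

definition hom_module ::
    "('a, 'm) ring_scheme \<Rightarrow> ('a, 'b) module \<Rightarrow> ('a, 'c) module \<Rightarrow> ('a, 'b \<Rightarrow> 'c) module"
  where "hom_module R A B = \<lparr>carrier = mod_hom R A B, monoid.mult = undefined, one = undefined,
    ring.zero = (\<lambda>x\<in>carrier A. \<zero>\<^bsub>B\<^esub>),
    add = (\<lambda>f g. \<lambda>x\<in>carrier A. f x \<oplus>\<^bsub>B\<^esub> g x),
    smult = (\<lambda>r f. \<lambda>x\<in>carrier A. r \<odot>\<^bsub>B\<^esub> f x)\<rparr>"

definition homothety :: "('a, 'm) ring_scheme \<Rightarrow> ('a, 'b) module \<Rightarrow> 'a \<Rightarrow> 'b \<Rightarrow> 'b"
  where "homothety R X = (\<lambda>r\<in>carrier R. \<lambda>x\<in>carrier X. r \<odot>\<^bsub>X\<^esub> x)"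


section \<open>Tensor products\<close>

definition free_module :: "('a, 'm) ring_scheme \<Rightarrow> 'b set \<Rightarrow> ('a, 'b \<Rightarrow> 'a) module"
  where "free_module R B = \<lparr>carrier = {c. (\<forall>b\<in>B. c b \<in> carrier R) \<and> (\<forall>b. b \<notin> B \<longrightarrow> c b = \<zero>\<^bsub>R\<^esub>) \<and>
      finite {b. c b \<noteq> \<zero>\<^bsub>R\<^esub>}}, monoid.mult = undefined, one = undefined,
    ring.zero = (\<lambda>b. \<zero>\<^bsub>R\<^esub>), add = (\<lambda>c d b. c b \<oplus>\<^bsub>R\<^esub> d b), smult = (\<lambda>r c b. r \<otimes>\<^bsub>R\<^esub> c b)\<rparr>"

definition free_basis :: "('a, 'm) ring_scheme \<Rightarrow> 'b \<Rightarrow> 'b \<Rightarrow> 'a"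
  where "free_basis R b = (\<lambda>b'. if b' = b then \<one>\<^bsub>R\<^esub> else \<zero>\<^bsub>R\<^esub>)"

abbreviation tensor_free ::
    "('a, 'm) ring_scheme \<Rightarrow> ('a, 'b) module \<Rightarrow> ('a, 'c) module \<Rightarrow> ('a, 'b \<times> 'c \<Rightarrow> 'a) module"
  where "tensor_free R X Y \<equiv> free_module R (carrier X \<times> carrier Y)"

definition tensor_relators ::
    "('a, 'm) ring_scheme \<Rightarrow> ('a, 'b) module \<Rightarrow> ('a, 'c) module \<Rightarrow> ('b \<times> 'c \<Rightarrow> 'a) set"
  where "tensor_relators R X Y = (let F = tensor_free R X Y; e = (\<lambda>x y. free_basis R (x, y)) in
    {e (x \<oplus>\<^bsub>X\<^esub> x') y \<ominus>\<^bsub>F\<^esub> (e x y \<oplus>\<^bsub>F\<^esub> e x' y) | x x' y.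
      x \<in> carrier X \<and> x' \<in> carrier X \<and> y \<in> carrier Y} \<union>
    {e x (y \<oplus>\<^bsub>Y\<^esub> y') \<ominus>\<^bsub>F\<^esub> (e x y \<oplus>\<^bsub>F\<^esub> e x y') | x y y'.
      x \<in> carrier X \<and> y \<in> carrier Y \<and> y' \<in> carrier Y} \<union>
    {e (r \<odot>\<^bsub>X\<^esub> x) y \<ominus>\<^bsub>F\<^esub> r \<odot>\<^bsub>F\<^esub> e x y | r x y.
      r \<in> carrier R \<and> x \<in> carrier X \<and> y \<in> carrier Y} \<union>
    {e x (r \<odot>\<^bsub>Y\<^esub> y) \<ominus>\<^bsub>F\<^esub> r \<odot>\<^bsub>F\<^esub> e x y | r x y.
      r \<in> carrier R \<and> x \<in> carrier X \<and> y \<in> carrier Y})"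

definition tensor_module :: "('a, 'm) ring_scheme \<Rightarrow> ('a, 'b) module \<Rightarrow> ('a, 'c) module
    \<Rightarrow> ('a, ('b \<times> 'c \<Rightarrow> 'a) set) module"
  where "tensor_module R X Y =
    quot_module (tensor_free R X Y) (mod_span R (tensor_free R X Y) (tensor_relators R X Y))"

text \<open>The map on \<open>X \<otimes> Y\<close> induced by a bilinear map \<open>\<beta>\<close>, i.e. \<open>x \<otimes> y \<mapsto> \<beta> x y\<close>. For bilinear \<open>\<beta>\<close>
  the linear extension of \<open>\<beta>\<close> to the free module is constant on each coset, and this constant is
  picked by \<^const>\<open>the_elem\<close>.\<close>

definition tensor_lift :: "('a, 'm) ring_scheme \<Rightarrow> ('a, 'b) module \<Rightarrow> ('a, 'c) module
    \<Rightarrow> ('a, 'd) module \<Rightarrow> ('b \<Rightarrow> 'c \<Rightarrow> 'd) \<Rightarrow> ('b \<times> 'c \<Rightarrow> 'a) set \<Rightarrow> 'd"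
  where "tensor_lift R X Y Z \<beta> = (\<lambda>C\<in>carrier (tensor_module R X Y).
    the_elem ((\<lambda>c. \<Oplus>\<^bsub>Z\<^esub>p\<in>{p. c p \<noteq> \<zero>\<^bsub>R\<^esub>}. c p \<odot>\<^bsub>Z\<^esub> \<beta> (fst p) (snd p)) ` C))"


section \<open>Injective modules and Matlis duality\<close>

text \<open>The definition cannot quantify over all types, so the test modules \<open>A\<close> and \<open>B\<close> are those whose
  elements have the type of the ring elements. This is no restriction: these include the ideals of
  \<open>R\<close> and \<open>R\<close> itself, so Baer's criterion gives the extension property for test modules of arbitrary
  types; see \<open>injective_module_extend\<close> below.\<close>

definition injective_module :: "('a, 'm) ring_scheme \<Rightarrow> ('a, 'b) module \<Rightarrow> bool"
  where "injective_module R Q \<longleftrightarrow> module R Q \<and>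
    (\<forall>(A :: ('a, 'a) module) (B :: ('a, 'a) module) f g.
      module R A \<longrightarrow> module R B \<longrightarrow> f \<in> mod_hom R A B \<longrightarrow> inj_on f (carrier A) \<longrightarrow>
      g \<in> mod_hom R A Q \<longrightarrow> (\<exists>h\<in>mod_hom R B Q. \<forall>x\<in>carrier A. h (f x) = g x))"

lemma baer_ideal_extend:
  fixes R :: "('a, 'm) ring_scheme" and Q :: "('a, 'q) module"
  assumes Q: "injective_module R Q" and L: "ideal L R"
    and cl: "\<And>l. l \<in> L \<Longrightarrow> g l \<in> carrier Q"
    and add: "\<And>l l'. l \<in> L \<Longrightarrow> l' \<in> L \<Longrightarrow> g (l \<oplus>\<^bsub>R\<^esub> l') = g l \<oplus>\<^bsub>Q\<^esub> g l'"
    and smult: "\<And>r l. r \<in> carrier R \<Longrightarrow> l \<in> L \<Longrightarrow> g (r \<otimes>\<^bsub>R\<^esub> l) = r \<odot>\<^bsub>Q\<^esub> g l"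
  shows "\<exists>q\<in>carrier Q. \<forall>l\<in>L. g l = l \<odot>\<^bsub>Q\<^esub> q"
proof -
  interpret Q: module R Q using Q unfolding injective_module_def by blast
  interpret L: ideal L R by fact
  let ?R = "ring_as_module R"
  let ?L = "?R\<lparr>carrier := L\<rparr>"
  have sel [simp]: "carrier ?R = carrier R" "add ?R = add R" "smult ?R = monoid.mult R"
    "ring.zero ?R = \<zero>\<^bsub>R\<^esub>"
    by (simp_all add: ring_as_module_def)
  have "abelian_group ?R"
    by (rule abelian_groupI)
      (auto simp: Q.R.a_ac intro: Q.R.l_neg)
  then have mR: "module R ?R"
    by (intro moduleI Q.R.is_cring)
      (auto simp: Q.R.l_distr Q.R.r_distr Q.R.m_assoc)
  have "submodule L R ?R"
  proof (rule module.submoduleI[OF mR])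
    fix a assume "a \<in> L"
    have "\<ominus>\<^bsub>?R\<^esub> a = \<ominus>\<^bsub>R\<^esub> a"
      by (simp add: a_inv_def m_inv_def)
    then show "\<ominus>\<^bsub>?R\<^esub> a \<in> L"
      using \<open>a \<in> L\<close> by simp
  qed (auto intro: L.I_l_closed L.a_closed L.a_Hcarr)
  then have mL: "module R ?L"
    using mR by (rule submodule.submodule_is_module)
  have "(\<lambda>l\<in>L. l) \<in> mod_hom R ?L ?R"
    by (auto simp: mod_hom_def L.a_closed L.I_l_closed intro: L.a_Hcarr)
  moreover have "inj_on (\<lambda>l\<in>L. l) (carrier ?L)"
    by (auto intro: inj_onI)
  moreover have "(\<lambda>l\<in>L. g l) \<in> mod_hom R ?L Q"
    by (auto simp: mod_hom_def L.a_closed L.I_l_closed cl add smult)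
  ultimately obtain h where h: "h \<in> mod_hom R ?R Q"
    and "\<forall>x\<in>carrier ?L. h ((\<lambda>l\<in>L. l) x) = (\<lambda>l\<in>L. g l) x"
    using Q[unfolded injective_module_def, THEN conjunct2, rule_format, OF mL mR] by blast
  then have hg: "\<forall>x\<in>L. h x = g x" by simp
  have "g l = l \<odot>\<^bsub>Q\<^esub> h \<one>\<^bsub>R\<^esub>" if "l \<in> L" for l
  proof -
    have "l \<in> carrier R" using that by (rule L.a_Hcarr)
    then have "h (l \<otimes>\<^bsub>R\<^esub> \<one>\<^bsub>R\<^esub>) = l \<odot>\<^bsub>Q\<^esub> h \<one>\<^bsub>R\<^esub>"
      using h Q.R.one_closed unfolding mod_hom_def sel by blast
    then show ?thesis using hg that \<open>l \<in> carrier R\<close> by simp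
  qed
  moreover have "h \<one>\<^bsub>R\<^esub> \<in> carrier Q"
    using h by (auto simp: mod_hom_def)
  ultimately show ?thesis by blast
qed

theorem injective_module_extend:
  fixes R :: "('a, 'm) ring_scheme" and A :: "('a, 'b) module" and B :: "('a, 'c) module"
    and Q :: "('a, 'q) module"
  assumes Q: "injective_module R Q" and A: "module R A" and B: "module R B"
    and f: "f \<in> mod_hom R A B" "inj_on f (carrier A)" and g: "g \<in> mod_hom R A Q"
  shows "\<exists>h\<in>mod_hom R B Q. \<forall>x\<in>carrier A. h (f x) = g x"
proof -
  interpret Q: module R Q using Q unfolding injective_module_def by blast
  interpret A: module R A by fact
  interpret B: module R B by fact
  have f_cl: "\<And>x. x \<in> carrier A \<Longrightarrow> f x \<in> carrier B"
    and f_add: "\<And>x y. x \<in> carrier A \<Longrightarrow> y \<in> carrier A \<Longrightarrow> f (x \<oplus>\<^bsub>A\<^esub> y) = f x \<oplus>\<^bsub>B\<^esub> f y"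
    and f_sm: "\<And>r x. r \<in> carrier R \<Longrightarrow> x \<in> carrier A \<Longrightarrow> f (r \<odot>\<^bsub>A\<^esub> x) = r \<odot>\<^bsub>B\<^esub> f x"
    using f(1) by (auto simp: mod_hom_def)
  have g_cl: "\<And>x. x \<in> carrier A \<Longrightarrow> g x \<in> carrier Q"
    and g_add: "\<And>x y. x \<in> carrier A \<Longrightarrow> y \<in> carrier A \<Longrightarrow> g (x \<oplus>\<^bsub>A\<^esub> y) = g x \<oplus>\<^bsub>Q\<^esub> g y"
    and g_sm: "\<And>r x. r \<in> carrier R \<Longrightarrow> x \<in> carrier A \<Longrightarrow> g (r \<odot>\<^bsub>A\<^esub> x) = r \<odot>\<^bsub>Q\<^esub> g x"
    using g by (auto simp: mod_hom_def)
  define G0 where "G0 = {(f x, g x) | x. x \<in> carrier A}"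
  define P where "P G \<longleftrightarrow> G0 \<subseteq> G \<and> G \<subseteq> carrier B \<times> carrier Q \<and>
    (\<forall>x y x' y'. (x, y) \<in> G \<longrightarrow> (x', y') \<in> G \<longrightarrow> (x \<oplus>\<^bsub>B\<^esub> x', y \<oplus>\<^bsub>Q\<^esub> y') \<in> G) \<and>
    (\<forall>r x y. r \<in> carrier R \<longrightarrow> (x, y) \<in> G \<longrightarrow> (r \<odot>\<^bsub>B\<^esub> x, r \<odot>\<^bsub>Q\<^esub> y) \<in> G) \<and>
    (\<forall>y. (\<zero>\<^bsub>B\<^esub>, y) \<in> G \<longrightarrow> y = \<zero>\<^bsub>Q\<^esub>)" for G
  have f0: "f \<zero>\<^bsub>A\<^esub> = \<zero>\<^bsub>B\<^esub>" and g0: "g \<zero>\<^bsub>A\<^esub> = \<zero>\<^bsub>Q\<^esub>"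
    using f_sm[of "\<zero>\<^bsub>R\<^esub>" "\<zero>\<^bsub>A\<^esub>"] g_sm[of "\<zero>\<^bsub>R\<^esub>" "\<zero>\<^bsub>A\<^esub>"] f_cl[of "\<zero>\<^bsub>A\<^esub>"] g_cl[of "\<zero>\<^bsub>A\<^esub>"] by simp_all
  have "P G0"
    unfolding P_def
  proof (intro conjI allI impI)
    fix x y x' y' assume "(x, y) \<in> G0" "(x', y') \<in> G0"
    then obtain a a' where "a \<in> carrier A" "a' \<in> carrier A" "x = f a" "y = g a" "x' = f a'" "y' = g a'"
      by (auto simp: G0_def)
    then show "(x \<oplus>\<^bsub>B\<^esub> x', y \<oplus>\<^bsub>Q\<^esub> y') \<in> G0"
      unfolding G0_def by (intro CollectI exI[of _ "a \<oplus>\<^bsub>A\<^esub> a'"]) (simp add: f_add g_add)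
  next
    fix r x y assume "r \<in> carrier R" "(x, y) \<in> G0"
    then obtain a where "a \<in> carrier A" "x = f a" "y = g a"
      by (auto simp: G0_def)
    then show "(r \<odot>\<^bsub>B\<^esub> x, r \<odot>\<^bsub>Q\<^esub> y) \<in> G0"
      using \<open>r \<in> carrier R\<close>
      unfolding G0_def by (intro CollectI exI[of _ "r \<odot>\<^bsub>A\<^esub> a"]) (simp add: f_sm g_sm)
  next
    fix y assume "(\<zero>\<^bsub>B\<^esub>, y) \<in> G0"
    then obtain a where a: "a \<in> carrier A" "f a = \<zero>\<^bsub>B\<^esub>" "y = g a"
      by (auto simp: G0_def)
    then have "a = \<zero>\<^bsub>A\<^esub>"
      using f(2) f0 by (metis A.M.zero_closed inj_onD)
    then show "y = \<zero>\<^bsub>Q\<^esub>" using a g0 by simp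
  qed (auto simp: G0_def f_cl g_cl)
  have "\<exists>G\<in>Collect P. \<forall>S\<in>Collect P. G \<subseteq> S \<longrightarrow> S = G"
  proof (rule subset_Zorn_nonempty)
    show "Collect P \<noteq> {}" using \<open>P G0\<close> by blast
  next
    fix C assume "C \<noteq> {}" and C: "subset.chain (Collect P) C"
    then have PC: "\<And>G. G \<in> C \<Longrightarrow> P G"
      by (auto simp: subset.chain_def)
    have lin: "\<And>G G'. G \<in> C \<Longrightarrow> G' \<in> C \<Longrightarrow> G \<subseteq> G' \<or> G' \<subseteq> G"
      using C by (auto simp: subset_chain_def)
    have "P (\<Union> C)"
      unfolding P_def
    proof (intro conjI allI impI)
      show "G0 \<subseteq> \<Union> C" using PC \<open>C \<noteq> {}\<close> unfolding P_def by blast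
      show "\<Union> C \<subseteq> carrier B \<times> carrier Q" using PC unfolding P_def by blast
    next
      fix x y x' y' assume "(x, y) \<in> \<Union> C" "(x', y') \<in> \<Union> C"
      then obtain G1 G2 where "G1 \<in> C" "(x, y) \<in> G1" "G2 \<in> C" "(x', y') \<in> G2"
        by blast
      then obtain G where "G \<in> C" "(x, y) \<in> G" "(x', y') \<in> G"
        using lin[of G1 G2] by blast
      then show "(x \<oplus>\<^bsub>B\<^esub> x', y \<oplus>\<^bsub>Q\<^esub> y') \<in> \<Union> C"
        using PC[OF \<open>G \<in> C\<close>] unfolding P_def by blast
    next
      fix r x y assume r: "r \<in> carrier R" and "(x, y) \<in> \<Union> C"
      then obtain G where "G \<in> C" "(x, y) \<in> G"
        by blast
      then show "(r \<odot>\<^bsub>B\<^esub> x, r \<odot>\<^bsub>Q\<^esub> y) \<in> \<Union> C"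
        using r PC[OF \<open>G \<in> C\<close>] unfolding P_def by blast
    next
      fix y assume "(\<zero>\<^bsub>B\<^esub>, y) \<in> \<Union> C"
      then obtain G where "G \<in> C" "(\<zero>\<^bsub>B\<^esub>, y) \<in> G"
        by blast
      then show "y = \<zero>\<^bsub>Q\<^esub>"
        using PC[OF \<open>G \<in> C\<close>] unfolding P_def by blast
    qed
    then show "\<Union> C \<in> Collect P" by simp
  qed
  then obtain G where "P G" and max: "\<And>S. P S \<Longrightarrow> G \<subseteq> S \<Longrightarrow> S = G"
    by blast
  have G0: "G0 \<subseteq> G" and G_cl: "\<And>x y. (x, y) \<in> G \<Longrightarrow> x \<in> carrier B \<and> y \<in> carrier Q"
    and G_add: "\<And>x y x' y'. (x, y) \<in> G \<Longrightarrow> (x', y') \<in> G \<Longrightarrow> (x \<oplus>\<^bsub>B\<^esub> x', y \<oplus>\<^bsub>Q\<^esub> y') \<in> G"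
    and G_sm: "\<And>r x y. r \<in> carrier R \<Longrightarrow> (x, y) \<in> G \<Longrightarrow> (r \<odot>\<^bsub>B\<^esub> x, r \<odot>\<^bsub>Q\<^esub> y) \<in> G"
    and G_0: "\<And>y. (\<zero>\<^bsub>B\<^esub>, y) \<in> G \<Longrightarrow> y = \<zero>\<^bsub>Q\<^esub>"
    using \<open>P G\<close> unfolding P_def by blast+
  have G_00: "(\<zero>\<^bsub>B\<^esub>, \<zero>\<^bsub>Q\<^esub>) \<in> G"
    using G0 f0 g0 unfolding G0_def by (metis (mono_tags, lifting) A.M.zero_closed mem_Collect_eq subsetD)
  have G_neg: "(\<ominus>\<^bsub>B\<^esub> x, \<ominus>\<^bsub>Q\<^esub> y) \<in> G" if "(x, y) \<in> G" for x y
    using G_sm[OF _ that, of "\<ominus>\<^bsub>R\<^esub> \<one>\<^bsub>R\<^esub>"] G_cl[OF that]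
    by (simp add: B.smult_l_minus Q.smult_l_minus)
  have G_uniq: "y = y'" if "(x, y) \<in> G" "(x, y') \<in> G" for x y y'
  proof -
    have "(x \<oplus>\<^bsub>B\<^esub> \<ominus>\<^bsub>B\<^esub> x, y \<oplus>\<^bsub>Q\<^esub> \<ominus>\<^bsub>Q\<^esub> y') \<in> G"
      using that by (intro G_add G_neg)
    then have "y \<oplus>\<^bsub>Q\<^esub> \<ominus>\<^bsub>Q\<^esub> y' = \<zero>\<^bsub>Q\<^esub>"
      using G_0 G_cl[OF that(1)] by (simp add: B.M.r_neg)
    then show ?thesis
      using G_cl[OF that(1)] G_cl[OF that(2)]
      by (metis Q.M.a_inv_closed Q.M.minus_equality Q.M.minus_minus)
  qed
  have dom: "\<exists>y. (b, y) \<in> G" if b: "b \<in> carrier B" for b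
  proof -
    define L where "L = {r \<in> carrier R. \<exists>y. (r \<odot>\<^bsub>B\<^esub> b, y) \<in> G}"
    define v where "v r = (THE y. (r \<odot>\<^bsub>B\<^esub> b, y) \<in> G)" for r
    have v_eq: "v r = y" if "(r \<odot>\<^bsub>B\<^esub> b, y) \<in> G" for r y
      using that G_uniq unfolding v_def by blast
    have v_mem: "(r \<odot>\<^bsub>B\<^esub> b, v r) \<in> G" if "r \<in> L" for r
      using that v_eq unfolding L_def by auto
    have add_mem: "(r \<oplus>\<^bsub>R\<^esub> s) \<odot>\<^bsub>B\<^esub> b = r \<odot>\<^bsub>B\<^esub> b \<oplus>\<^bsub>B\<^esub> s \<odot>\<^bsub>B\<^esub> b" if "r \<in> carrier R" "s \<in> carrier R" for r s
      using that b by (simp add: B.smult_l_distr)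
    have sm_mem: "(r \<otimes>\<^bsub>R\<^esub> s) \<odot>\<^bsub>B\<^esub> b = r \<odot>\<^bsub>B\<^esub> (s \<odot>\<^bsub>B\<^esub> b)" if "r \<in> carrier R" "s \<in> carrier R" for r s
      using that b by (simp add: B.smult_assoc1)
    have L_carr: "r \<in> carrier R" if "r \<in> L" for r
      using that by (simp add: L_def)
    have L_sm: "s \<otimes>\<^bsub>R\<^esub> r \<in> L" if "r \<in> L" "s \<in> carrier R" for r s
      using G_sm[OF that(2) v_mem[OF that(1)]] that unfolding L_def by (auto simp: sm_mem)
    have "ideal L R"
    proof (rule idealI)
      show "ring R" by (rule Q.R.ring_axioms)
      show "subgroup L (add_monoid R)"
      proof (rule subgroup.intro)
        show "L \<subseteq> carrier (add_monoid R)" by (auto simp: L_def)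
        show "\<one>\<^bsub>add_monoid R\<^esub> \<in> L" using G_00 b by (auto simp: L_def)
      next
        fix r s assume "r \<in> L" "s \<in> L"
        then show "r \<otimes>\<^bsub>add_monoid R\<^esub> s \<in> L"
          using G_add[OF v_mem v_mem] by (auto simp: L_def add_mem)
      next
        fix r assume "r \<in> L"
        then have "\<ominus>\<^bsub>R\<^esub> \<one>\<^bsub>R\<^esub> \<otimes>\<^bsub>R\<^esub> r \<in> L" by (intro L_sm) auto
        then show "inv\<^bsub>add_monoid R\<^esub> r \<in> L"
          using L_carr[OF \<open>r \<in> L\<close>] by (simp add: Q.R.l_minus flip: a_inv_def)
      qed
    next
      fix r s assume "r \<in> L" "s \<in> carrier R"
      then show "s \<otimes>\<^bsub>R\<^esub> r \<in> L" "r \<otimes>\<^bsub>R\<^esub> s \<in> L"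
        using L_sm L_carr by (simp_all add: Q.R.m_comm)
    qed
    moreover have "v r \<in> carrier Q" if "r \<in> L" for r
      using v_mem[OF that] G_cl by blast
    moreover have "v (r \<oplus>\<^bsub>R\<^esub> s) = v r \<oplus>\<^bsub>Q\<^esub> v s" if "r \<in> L" "s \<in> L" for r s
      using that G_add[OF v_mem v_mem] L_carr by (intro v_eq) (simp add: add_mem)
    moreover have "v (r \<otimes>\<^bsub>R\<^esub> s) = r \<odot>\<^bsub>Q\<^esub> v s" if "r \<in> carrier R" "s \<in> L" for r s
      using that G_sm[OF _ v_mem] L_carr by (intro v_eq) (simp add: sm_mem)
    ultimately obtain q where q: "q \<in> carrier Q" and vq: "\<And>r. r \<in> L \<Longrightarrow> v r = r \<odot>\<^bsub>Q\<^esub> q"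
      using baer_ideal_extend[OF Q, of L v] by blast
    define G' where "G' = {(x \<oplus>\<^bsub>B\<^esub> r \<odot>\<^bsub>B\<^esub> b, y \<oplus>\<^bsub>Q\<^esub> r \<odot>\<^bsub>Q\<^esub> q) | x y r. (x, y) \<in> G \<and> r \<in> carrier R}"
    have G'I: "(x \<oplus>\<^bsub>B\<^esub> r \<odot>\<^bsub>B\<^esub> b, y \<oplus>\<^bsub>Q\<^esub> r \<odot>\<^bsub>Q\<^esub> q) \<in> G'" if "(x, y) \<in> G" "r \<in> carrier R" for x y r
      using that unfolding G'_def by blast
    have "G \<subseteq> G'"
    proof (clarify)
      fix x y assume "(x, y) \<in> G"
      with G'I[OF this Q.R.zero_closed] show "(x, y) \<in> G'"
        using b q G_cl by simp
    qed
    have "P G'"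
      unfolding P_def
    proof (intro conjI allI impI)
      show "G0 \<subseteq> G'" using G0 \<open>G \<subseteq> G'\<close> by blast
      show "G' \<subseteq> carrier B \<times> carrier Q"
        using b q G_cl by (auto simp: G'_def)
    next
      fix x y x' y' assume "(x, y) \<in> G'" "(x', y') \<in> G'"
      then obtain u w r u' w' r' where u: "(u, w) \<in> G" "r \<in> carrier R" "(u', w') \<in> G" "r' \<in> carrier R"
        and xy: "x = u \<oplus>\<^bsub>B\<^esub> r \<odot>\<^bsub>B\<^esub> b" "y = w \<oplus>\<^bsub>Q\<^esub> r \<odot>\<^bsub>Q\<^esub> q"
          "x' = u' \<oplus>\<^bsub>B\<^esub> r' \<odot>\<^bsub>B\<^esub> b" "y' = w' \<oplus>\<^bsub>Q\<^esub> r' \<odot>\<^bsub>Q\<^esub> q"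
        unfolding G'_def by blast
      have "x \<oplus>\<^bsub>B\<^esub> x' = (u \<oplus>\<^bsub>B\<^esub> u') \<oplus>\<^bsub>B\<^esub> (r \<oplus>\<^bsub>R\<^esub> r') \<odot>\<^bsub>B\<^esub> b"
        using u b G_cl by (simp add: xy B.smult_l_distr B.M.a_ac)
      moreover have "y \<oplus>\<^bsub>Q\<^esub> y' = (w \<oplus>\<^bsub>Q\<^esub> w') \<oplus>\<^bsub>Q\<^esub> (r \<oplus>\<^bsub>R\<^esub> r') \<odot>\<^bsub>Q\<^esub> q"
        using u q G_cl by (simp add: xy Q.smult_l_distr Q.M.a_ac)
      ultimately show "(x \<oplus>\<^bsub>B\<^esub> x', y \<oplus>\<^bsub>Q\<^esub> y') \<in> G'"
        using G'I[OF G_add[OF u(1,3)], of "r \<oplus>\<^bsub>R\<^esub> r'"] u by simp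
    next
      fix s x y assume s: "s \<in> carrier R" and "(x, y) \<in> G'"
      then obtain u w r where u: "(u, w) \<in> G" "r \<in> carrier R"
        and xy: "x = u \<oplus>\<^bsub>B\<^esub> r \<odot>\<^bsub>B\<^esub> b" "y = w \<oplus>\<^bsub>Q\<^esub> r \<odot>\<^bsub>Q\<^esub> q"
        unfolding G'_def by blast
      have "s \<odot>\<^bsub>B\<^esub> x = s \<odot>\<^bsub>B\<^esub> u \<oplus>\<^bsub>B\<^esub> (s \<otimes>\<^bsub>R\<^esub> r) \<odot>\<^bsub>B\<^esub> b"
        using u s b G_cl by (simp add: xy B.smult_r_distr B.smult_assoc1)
      moreover have "s \<odot>\<^bsub>Q\<^esub> y = s \<odot>\<^bsub>Q\<^esub> w \<oplus>\<^bsub>Q\<^esub> (s \<otimes>\<^bsub>R\<^esub> r) \<odot>\<^bsub>Q\<^esub> q"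
        using u s q G_cl by (simp add: xy Q.smult_r_distr Q.smult_assoc1)
      ultimately show "(s \<odot>\<^bsub>B\<^esub> x, s \<odot>\<^bsub>Q\<^esub> y) \<in> G'"
        using G'I[OF G_sm[OF s u(1)], of "s \<otimes>\<^bsub>R\<^esub> r"] u s by simp
    next
      fix y assume "(\<zero>\<^bsub>B\<^esub>, y) \<in> G'"
      then obtain u w r where u: "(u, w) \<in> G" "r \<in> carrier R"
        and z: "\<zero>\<^bsub>B\<^esub> = u \<oplus>\<^bsub>B\<^esub> r \<odot>\<^bsub>B\<^esub> b" and y: "y = w \<oplus>\<^bsub>Q\<^esub> r \<odot>\<^bsub>Q\<^esub> q"
        unfolding G'_def by blast
      have cl: "u \<in> carrier B" "w \<in> carrier Q" "r \<odot>\<^bsub>B\<^esub> b \<in> carrier B" "r \<odot>\<^bsub>Q\<^esub> q \<in> carrier Q"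
        using u b q G_cl by auto
      have "r \<odot>\<^bsub>B\<^esub> b = \<ominus>\<^bsub>B\<^esub> u"
        using z cl by (metis B.M.a_comm B.M.minus_equality)
      then have "(r \<odot>\<^bsub>B\<^esub> b, \<ominus>\<^bsub>Q\<^esub> w) \<in> G"
        using G_neg[OF u(1)] by simp
      then have "r \<in> L" "v r = \<ominus>\<^bsub>Q\<^esub> w"
        using u v_eq by (auto simp: L_def)
      then have "r \<odot>\<^bsub>Q\<^esub> q = \<ominus>\<^bsub>Q\<^esub> w"
        using vq by metis
      then show "y = \<zero>\<^bsub>Q\<^esub>"
        using cl by (simp add: y Q.M.r_neg)
    qed
    then have "G' = G" using max \<open>G \<subseteq> G'\<close> by blast
    moreover have "(\<zero>\<^bsub>B\<^esub> \<oplus>\<^bsub>B\<^esub> \<one>\<^bsub>R\<^esub> \<odot>\<^bsub>B\<^esub> b, \<zero>\<^bsub>Q\<^esub> \<oplus>\<^bsub>Q\<^esub> \<one>\<^bsub>R\<^esub> \<odot>\<^bsub>Q\<^esub> q) \<in> G'"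
      by (rule G'I[OF G_00]) simp
    ultimately show ?thesis using b by auto
  qed
  define h where "h = (\<lambda>b\<in>carrier B. THE y. (b, y) \<in> G)"
  have h_eq: "h b = y" if "(b, y) \<in> G" for b y
    using that G_uniq G_cl[OF that] unfolding h_def by auto
  have h_mem: "(b, h b) \<in> G" if "b \<in> carrier B" for b
    using dom[OF that] h_eq by blast
  have "h \<in> carrier B \<rightarrow>\<^sub>E carrier Q"
    using h_mem G_cl by (intro PiE_I) (auto simp: h_def)
  moreover have "h (x \<oplus>\<^bsub>B\<^esub> y) = h x \<oplus>\<^bsub>Q\<^esub> h y" if "x \<in> carrier B" "y \<in> carrier B" for x y
    using that by (intro h_eq G_add h_mem)
  moreover have "h (r \<odot>\<^bsub>B\<^esub> x) = r \<odot>\<^bsub>Q\<^esub> h x" if "r \<in> carrier R" "x \<in> carrier B" for r x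
    using that by (intro h_eq G_sm h_mem)
  ultimately have "h \<in> mod_hom R B Q"
    unfolding mod_hom_def by blast
  moreover have "h (f x) = g x" if "x \<in> carrier A" for x
    using that G0 by (intro h_eq) (auto simp: G0_def)
  ultimately show ?thesis by blast
qed

definition injective_hull ::
    "('a, 'm) ring_scheme \<Rightarrow> ('a, 'b) module \<Rightarrow> ('a, 'e) module \<Rightarrow> ('b \<Rightarrow> 'e) \<Rightarrow> bool"
  where "injective_hull R K E \<iota> \<longleftrightarrow>
    module R K \<and> injective_module R E \<and> \<iota> \<in> mod_hom R K E \<and> inj_on \<iota> (carrier K) \<and>
    (\<forall>N. submodule N R E \<longrightarrow> N \<noteq> {\<zero>\<^bsub>E\<^esub>} \<longrightarrow> N \<inter> \<iota> ` carrier K \<noteq> {\<zero>\<^bsub>E\<^esub>})"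

definition residue_module :: "('a, 'm) ring_scheme \<Rightarrow> 'a set \<Rightarrow> ('a, 'a set) module"
  where "residue_module R \<mm> = quot_module (ring_as_module R) \<mm>"

text \<open>\<open>D(X) = Hom(X, E)\<close> and the evaluation map \<open>X \<otimes> D(X) \<rightarrow> E\<close>, \<open>x \<otimes> f \<mapsto> f x\<close>.\<close>

abbreviation (input) matlis_dual ::
    "('a, 'm) ring_scheme \<Rightarrow> ('a, 'e) module \<Rightarrow> ('a, 'b) module \<Rightarrow> ('a, 'b \<Rightarrow> 'e) module"
  where "matlis_dual R E X \<equiv> hom_module R X E"

definition matlis_eval ::
    "('a, 'm) ring_scheme \<Rightarrow> ('a, 'e) module \<Rightarrow> ('a, 'b) module \<Rightarrow> ('b \<times> ('b \<Rightarrow> 'e) \<Rightarrow> 'a) set \<Rightarrow> 'e"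
  where "matlis_eval R E X = tensor_lift R X (matlis_dual R E X) E (\<lambda>x f. f x)"


section \<open>Local cohomology with respect to a pair of ideals\<close>

definition ij_torsion ::
    "('a, 'm) ring_scheme \<Rightarrow> 'a set \<Rightarrow> 'a set \<Rightarrow> ('a, 'b) module \<Rightarrow> 'b set"
  where "ij_torsion R I J M = {x \<in> carrier M. \<exists>N. \<forall>n\<ge>N.
    (\<lambda>a. a \<odot>\<^bsub>M\<^esub> x) ` ideal_power R I n \<subseteq> (\<lambda>b. b \<odot>\<^bsub>M\<^esub> x) ` J}"

text \<open>\<open>0 \<rightarrow> M \<rightarrow> Q 0 \<rightarrow> Q 1 \<rightarrow> \<dots>\<close> is exact with augmentation \<open>\<epsilon>\<close> and differentials
  \<open>d i : Q i \<rightarrow> Q (Suc i)\<close>.\<close>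

definition injective_resolution :: "('a, 'm) ring_scheme \<Rightarrow> ('a, 'b) module
    \<Rightarrow> (nat \<Rightarrow> ('a, 'q) module) \<Rightarrow> ('b \<Rightarrow> 'q) \<Rightarrow> (nat \<Rightarrow> 'q \<Rightarrow> 'q) \<Rightarrow> bool"
  where "injective_resolution R M Q \<epsilon> d \<longleftrightarrow>
    module R M \<and> (\<forall>i. injective_module R (Q i)) \<and>
    \<epsilon> \<in> mod_hom R M (Q 0) \<and> (\<forall>i. d i \<in> mod_hom R (Q i) (Q (Suc i))) \<and>
    inj_on \<epsilon> (carrier M) \<and>
    \<epsilon> ` carrier M = {x \<in> carrier (Q 0). d 0 x = \<zero>\<^bsub>Q 1\<^esub>} \<and>
    (\<forall>i. d i ` carrier (Q i) = {x \<in> carrier (Q (Suc i)). d (Suc i) x = \<zero>\<^bsub>Q (Suc (Suc i))\<^esub>})"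

text \<open>Right derived functors are computed from an injective resolution \<open>(Q, d)\<close> of \<open>M\<close>: this is the
  \<open>i\<close>-th cohomology of the complex obtained by applying the \<open>(I,J)\<close>-torsion functor to \<open>Q\<close>. Up to
  isomorphism it depends only on \<open>M\<close>. On morphisms the torsion functor is restriction, so its
  differentials are those of \<open>Q\<close>.\<close>

definition ij_cocycles :: "('a, 'm) ring_scheme \<Rightarrow> 'a set \<Rightarrow> 'a set
    \<Rightarrow> (nat \<Rightarrow> ('a, 'q) module) \<Rightarrow> (nat \<Rightarrow> 'q \<Rightarrow> 'q) \<Rightarrow> nat \<Rightarrow> 'q set"
  where "ij_cocycles R I J Q d i = {x \<in> ij_torsion R I J (Q i). d i x = \<zero>\<^bsub>Q (Suc i)\<^esub>}"

definition ij_coboundaries :: "('a, 'm) ring_scheme \<Rightarrow> 'a set \<Rightarrow> 'a set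
    \<Rightarrow> (nat \<Rightarrow> ('a, 'q) module) \<Rightarrow> (nat \<Rightarrow> 'q \<Rightarrow> 'q) \<Rightarrow> nat \<Rightarrow> 'q set"
  where "ij_coboundaries R I J Q d i =
    (case i of 0 \<Rightarrow> {\<zero>\<^bsub>Q 0\<^esub>} | Suc j \<Rightarrow> d j ` ij_torsion R I J (Q j))"

definition local_cohomology :: "('a, 'm) ring_scheme \<Rightarrow> 'a set \<Rightarrow> 'a set
    \<Rightarrow> (nat \<Rightarrow> ('a, 'q) module) \<Rightarrow> (nat \<Rightarrow> 'q \<Rightarrow> 'q) \<Rightarrow> nat \<Rightarrow> ('a, 'q set) module"
  where "local_cohomology R I J Q d i =
    quot_module (Q i\<lparr>carrier := ij_cocycles R I J Q d i\<rparr>) (ij_coboundaries R I J Q d i)"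

definition ij_depth :: "('a, 'm) ring_scheme \<Rightarrow> 'a set \<Rightarrow> 'a set
    \<Rightarrow> (nat \<Rightarrow> ('a, 'q) module) \<Rightarrow> (nat \<Rightarrow> 'q \<Rightarrow> 'q) \<Rightarrow> enat"
  where "ij_depth R I J Q d = Inf {enat i | i.
    carrier (local_cohomology R I J Q d i) \<noteq> {\<zero>\<^bsub>local_cohomology R I J Q d i\<^esub>}}"

end

theory Submission
  imports Defs
begin

text \<open>Write \<open>D\<close> for the Matlis dual and \<open>H\<close> for the first nonvanishing local cohomology module. By
  adjointness, \<open>D\<close> carries the evaluation map \<open>H \<otimes> D(H) \<rightarrow> E\<close> to the homothety map
  \<open>Hom(E, E) = R \<rightarrow> Hom(D(H), D(H))\<close>, and \<open>D\<close> is faithful; so (2) and (3) are equivalent for every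
  module \<open>H\<close>. Moreover \<open>Hom(D(H), D(H)) = Hom(H, D(D(H)))\<close> contains \<open>Hom(H, H)\<close>, and (1) and (2) are
  equivalent as soon as every map \<open>H \<rightarrow> D(D(H))\<close> has its image in \<open>H\<close>. Let \<open>h\<close> be an element of \<open>H\<close> and \<open>a\<close> its
  annihilator. The image of \<open>h\<close> is killed by \<open>a\<close>, and the submodule of \<open>D(D(H))\<close> killed by \<open>a\<close> is
  \<open>D(D(0 :\<^sub>H a))\<close>. As \<open>R / a\<close> is \<open>(I,J)\<close>-torsion and \<open>t\<close> is the depth, \<open>(0 :\<^sub>H a) = Hom(R/a, H)\<close> is
  isomorphic to \<open>Ext\<^sup>t(R/a, M)\<close>; it is thus finitely generated and, \<open>R\<close> being complete, equal to its
  bidual.\<close>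

subsection \<open>Ideals in Noetherian rings\<close>

text \<open>The module \<open>H\<close> is in general neither finitely generated nor Artinian, so
  Matlis duality cannot be applied to it as a whole; reflexivity is used for one annihilator at a
  time. The link between \<open>(0 : a)\<close> in \<open>H\<close> and \<open>Ext\<close> rests on
  the fact that the torsion part of an injective module is injective: the torsion complex then
  splits up to degree \<open>t\<close>, and a class killed by \<open>a\<close> has a representative
  killed by \<open>a\<close>. The usual source of such injectivity is the Artin-Rees lemma; a
  maximal complement of an ideal takes its place here. Since a proof cannot range over modules of
  arbitrary types, \<open>Ext\<close> is never formed as a functor. Its modules appear as
  subquotients of the terms \<open>Q i\<close> of the one given resolution, and finiteness becomes a
  relation between subsets of \<open>Q i\<close>. It is proved by shifting degrees from
  \<open>R/b\<close> to \<open>b\<close> and by adding one generator of \<open>b\<close> at a time,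
  both of which stay inside that resolution. Completeness enters through the identity
  \<open>Hom(E, E) = R\<close>.\<close>

lemma (in module) submoduleI_closed:
  assumes "H \<subseteq> carrier M" "\<zero>\<^bsub>M\<^esub> \<in> H" "\<And>x y. x \<in> H \<Longrightarrow> y \<in> H \<Longrightarrow> x \<oplus>\<^bsub>M\<^esub> y \<in> H"
    and "\<And>r x. r \<in> carrier R \<Longrightarrow> x \<in> H \<Longrightarrow> r \<odot>\<^bsub>M\<^esub> x \<in> H"
  shows "submodule H R M"
proof (rule submoduleI)
  fix a assume "a \<in> H"
  then have "(\<ominus> \<one>) \<odot>\<^bsub>M\<^esub> a \<in> H" "a \<in> carrier M" using assms by auto
  then show "\<ominus>\<^bsub>M\<^esub> a \<in> H" by (simp add: smult_l_minus)
qed (use assms in auto)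

lemma (in module) submoduleD:
  assumes "submodule H R M"
  shows "x \<in> H \<Longrightarrow> x \<in> carrier M" "\<zero>\<^bsub>M\<^esub> \<in> H"
    "x \<in> H \<Longrightarrow> y \<in> H \<Longrightarrow> x \<oplus>\<^bsub>M\<^esub> y \<in> H" "x \<in> H \<Longrightarrow> y \<in> H \<Longrightarrow> x \<ominus>\<^bsub>M\<^esub> y \<in> H"
    "x \<in> H \<Longrightarrow> \<ominus>\<^bsub>M\<^esub> x \<in> H" "r \<in> carrier R \<Longrightarrow> x \<in> H \<Longrightarrow> r \<odot>\<^bsub>M\<^esub> x \<in> H"
proof -
  interpret submodule H R M by fact
  show "x \<in> H \<Longrightarrow> x \<in> carrier M" "\<zero>\<^bsub>M\<^esub> \<in> H"
    "x \<in> H \<Longrightarrow> y \<in> H \<Longrightarrow> x \<oplus>\<^bsub>M\<^esub> y \<in> H" "x \<in> H \<Longrightarrow> y \<in> H \<Longrightarrow> x \<ominus>\<^bsub>M\<^esub> y \<in> H"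
    "x \<in> H \<Longrightarrow> \<ominus>\<^bsub>M\<^esub> x \<in> H" "r \<in> carrier R \<Longrightarrow> x \<in> H \<Longrightarrow> r \<odot>\<^bsub>M\<^esub> x \<in> H"
    using submoduleE[OF assms] one_closed by (auto simp: a_minus_def)
qed

lemma (in cring) idealI_closed:
  assumes "L \<subseteq> carrier R" "\<zero> \<in> L" "\<And>x y. x \<in> L \<Longrightarrow> y \<in> L \<Longrightarrow> x \<oplus> y \<in> L"
    and "\<And>r x. r \<in> carrier R \<Longrightarrow> x \<in> L \<Longrightarrow> r \<otimes> x \<in> L"
  shows "ideal L R"
proof (rule idealI)
  show "ring R" by (rule ring_axioms)
  show "subgroup L (add_monoid R)"
  proof (rule subgroup.intro)
    fix r assume "r \<in> L"
    then have "(\<ominus> \<one>) \<otimes> r \<in> L" "r \<in> carrier R" using assms by auto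
    then show "inv\<^bsub>add_monoid R\<^esub> r \<in> L" by (simp add: l_minus flip: a_inv_def)
  qed (use assms in auto)
next
  fix r s assume "r \<in> L" "s \<in> carrier R"
  then show "s \<otimes> r \<in> L" "r \<otimes> s \<in> L"
    using assms(4)[of s r] assms(1) m_comm[of r s] by auto
qed

lemma (in cring) idealD:
  assumes "ideal L R"
  shows "x \<in> L \<Longrightarrow> x \<in> carrier R" "\<zero> \<in> L" "x \<in> L \<Longrightarrow> y \<in> L \<Longrightarrow> x \<oplus> y \<in> L"
    "x \<in> L \<Longrightarrow> y \<in> L \<Longrightarrow> x \<ominus> y \<in> L" "r \<in> carrier R \<Longrightarrow> x \<in> L \<Longrightarrow> r \<otimes> x \<in> L"
    "r \<in> carrier R \<Longrightarrow> x \<in> L \<Longrightarrow> x \<otimes> r \<in> L"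
proof -
  interpret ideal L R by fact
  show "x \<in> L \<Longrightarrow> x \<in> carrier R" "\<zero> \<in> L" "x \<in> L \<Longrightarrow> y \<in> L \<Longrightarrow> x \<oplus> y \<in> L"
    "x \<in> L \<Longrightarrow> y \<in> L \<Longrightarrow> x \<ominus> y \<in> L" "r \<in> carrier R \<Longrightarrow> x \<in> L \<Longrightarrow> r \<otimes> x \<in> L"
    "r \<in> carrier R \<Longrightarrow> x \<in> L \<Longrightarrow> x \<otimes> r \<in> L"
    by (auto simp: I_l_closed I_r_closed a_minus_def)
qed

lemma ring_as_module_simps [simp]:
  "carrier (ring_as_module R) = carrier R" "add (ring_as_module R) = add R"
  "smult (ring_as_module R) = monoid.mult R" "ring.zero (ring_as_module R) = \<zero>\<^bsub>R\<^esub>"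
  by (simp_all add: ring_as_module_def)

lemma ring_as_module_a_inv [simp]: "\<ominus>\<^bsub>ring_as_module R\<^esub> x = \<ominus>\<^bsub>R\<^esub> x"
  by (simp add: a_inv_def m_inv_def)

lemma (in cring) module_ring_as_module: "module R (ring_as_module R)"
proof -
  have "abelian_group (ring_as_module R)"
    by (rule abelian_groupI) (auto simp: a_ac intro: l_neg)
  then show ?thesis
    by (intro moduleI is_cring) (auto simp: l_distr r_distr m_assoc)
qed

lemma (in module) colon_ideal:
  assumes "submodule N R M" "x \<in> carrier M"
  shows "ideal {r \<in> carrier R. r \<odot>\<^bsub>M\<^esub> x \<in> N} R"
  using assms(2) submoduleD[OF assms(1)]
  by (intro idealI_closed) (auto simp: smult_l_distr smult_assoc1)

lemma (in module) zero_submodule: "submodule {\<zero>\<^bsub>M\<^esub>} R M"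
  by (rule submoduleI_closed) auto

lemma (in module) ann_ideal:
  assumes "x \<in> carrier M"
  shows "ideal {r \<in> carrier R. r \<odot>\<^bsub>M\<^esub> x = \<zero>\<^bsub>M\<^esub>} R"
  using colon_ideal[OF zero_submodule assms] by simp

lemma (in cring) ideal_colon_ideal:
  assumes "ideal b R" "x \<in> carrier R"
  shows "ideal {r \<in> carrier R. r \<otimes> x \<in> b} R"
  using assms(2) idealD[OF assms(1)]
  by (intro idealI_closed) (auto simp: l_distr m_assoc)

definition adjoin :: "('a, 'm) ring_scheme \<Rightarrow> 'a set \<Rightarrow> 'a \<Rightarrow> 'a set"
  where "adjoin R b x = {l \<oplus>\<^bsub>R\<^esub> r \<otimes>\<^bsub>R\<^esub> x | l r. l \<in> b \<and> r \<in> carrier R}"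

lemma (in cring) adjoin_ideal:
  assumes b: "ideal b R" and x: "x \<in> carrier R"
  shows "ideal (adjoin R b x) R"
proof (rule idealI_closed)
  note [simp] = idealD[OF b] x
  show "adjoin R b x \<subseteq> carrier R" by (auto simp: adjoin_def)
  show "\<zero> \<in> adjoin R b x"
    unfolding adjoin_def by (intro CollectI exI[of _ \<zero>]) simp
  fix y z assume "y \<in> adjoin R b x" "z \<in> adjoin R b x"
  then obtain l r l' r' where *: "y = l \<oplus> r \<otimes> x" "z = l' \<oplus> r' \<otimes> x" "l \<in> b" "l' \<in> b"
    "r \<in> carrier R" "r' \<in> carrier R" by (auto simp: adjoin_def)
  then have "y \<oplus> z = (l \<oplus> l') \<oplus> (r \<oplus> r') \<otimes> x"
    by (simp add: l_distr a_ac)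
  with * show "y \<oplus> z \<in> adjoin R b x" unfolding adjoin_def
    by (intro CollectI exI[of _ "l \<oplus> l'"] exI[of _ "r \<oplus> r'"]) simp
next
  note [simp] = idealD[OF b] x
  fix s y assume s: "s \<in> carrier R" and "y \<in> adjoin R b x"
  then obtain l r where *: "y = l \<oplus> r \<otimes> x" "l \<in> b" "r \<in> carrier R" by (auto simp: adjoin_def)
  then have "s \<otimes> y = s \<otimes> l \<oplus> (s \<otimes> r) \<otimes> x" using s by (simp add: r_distr m_assoc)
  with * s show "s \<otimes> y \<in> adjoin R b x" unfolding adjoin_def
    by (intro CollectI exI[of _ "s \<otimes> l"] exI[of _ "s \<otimes> r"]) simp
qed

lemma (in cring) adjoin_superset:
  assumes b: "ideal b R" and x: "x \<in> carrier R"
  shows "b \<subseteq> adjoin R b x" "x \<in> adjoin R b x"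
proof -
  note [simp] = idealD[OF b] x
  show "b \<subseteq> adjoin R b x"
  proof
    fix l assume "l \<in> b"
    then show "l \<in> adjoin R b x"
      unfolding adjoin_def by (intro CollectI exI[of _ l] exI[of _ \<zero>]) simp
  qed
  show "x \<in> adjoin R b x"
    unfolding adjoin_def by (intro CollectI exI[of _ \<zero>] exI[of _ \<one>]) simp
qed

lemma (in cring) adjoin_subset:
  assumes "ideal b R" "ideal c R" "b \<subseteq> c" "x \<in> c"
  shows "adjoin R b x \<subseteq> c"
  using idealD[OF assms(2)] assms by (auto simp: adjoin_def)

text \<open>The union of a nonempty chain of ideals is a member of the chain, so Zorn's lemma
  applies to any property \<open>P\<close>. All Noetherian inductions below take this form: a
  maximal counterexample or a maximal complement.\<close>

lemma (in noetherian_ring) ideal_maximal: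
  assumes "ideal b0 R" "P b0"
  obtains b where "ideal b R" "P b" "\<And>c. ideal c R \<Longrightarrow> P c \<Longrightarrow> b \<subseteq> c \<Longrightarrow> c = b"
proof -
  let ?A = "{b. ideal b R \<and> P b}"
  have "\<exists>b\<in>?A. \<forall>c\<in>?A. b \<subseteq> c \<longrightarrow> c = b"
  proof (rule subset_Zorn_nonempty)
    show "?A \<noteq> {}" using assms by blast
    fix C assume "C \<noteq> {}" "subset.chain ?A C"
    then have "C \<subseteq> ?A" "subset.chain {I. ideal I R} C" by (auto simp: subset_chain_def)
    then show "\<Union>C \<in> ?A" using ideal_chain_is_trivial[OF \<open>C \<noteq> {}\<close>] by blast
  qed
  then show ?thesis using that by blast
qed

text \<open>Induction on generators without naming them: a maximal ideal \<open>c\<close> inside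
  \<open>b\<close> with \<open>P c\<close> absorbs every \<open>x\<close> in \<open>b\<close>,
  because \<open>c + Rx\<close> again has the property.\<close>

lemma (in noetherian_ring) ideal_adjoin_induct:
  assumes R: "cring R" and b: "ideal b R" and "P {\<zero>}"
    and step: "\<And>c x. ideal c R \<Longrightarrow> c \<subseteq> b \<Longrightarrow> x \<in> b \<Longrightarrow> P c \<Longrightarrow> P (adjoin R c x)"
  shows "P b"
proof -
  interpret cring R by fact
  have "{\<zero>} \<subseteq> b" using idealD[OF b] by simp
  then obtain c where c: "ideal c R" "c \<subseteq> b \<and> P c"
    and max: "\<And>c'. ideal c' R \<Longrightarrow> c' \<subseteq> b \<and> P c' \<Longrightarrow> c \<subseteq> c' \<Longrightarrow> c' = c"
    using ideal_maximal[OF zeroideal, of "\<lambda>c. c \<subseteq> b \<and> P c"] \<open>P {\<zero>}\<close> by blast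
  have "x \<in> c" if "x \<in> b" for x
  proof -
    have x: "x \<in> carrier R" using that idealD[OF b] by simp
    show ?thesis
      using max[OF adjoin_ideal[OF c(1) x]] adjoin_superset[OF c(1) x] adjoin_subset[OF c(1) b _ that]
        step[OF c(1) _ that] c(2) by blast
  qed
  then have "c = b" using c by blast
  then show ?thesis using c by simp
qed

section \<open>Powers of an ideal\<close>

lemma (in cring) ideal_power_0: "ideal_power R I 0 = carrier R"
  by (simp add: nat_pow_def ideals_set_def)

lemma (in cring) ideal_power_Suc: "ideal_power R I (Suc n) = ideal_power R I n \<cdot> I"
  by (simp add: nat_pow_def ideals_set_def)

lemma (in cring) ideal_power_ideal:
  assumes "ideal I R"
  shows "ideal (ideal_power R I n) R"
proof (induction n)
  case 0 show ?case by (simp only: ideal_power_0 oneideal)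
next
  case (Suc n) then show ?case by (simp only: ideal_power_Suc ideal_prod_is_ideal assms)
qed

lemma (in cring) ideal_power_1:
  assumes "ideal I R"
  shows "ideal_power R I 1 = I"
  using assms ideal_prod_one[OF assms] ideal_prod_commute[OF oneideal assms]
  by (simp only: One_nat_def ideal_power_Suc ideal_power_0)

lemma (in cring) ideal_power_add:
  assumes "ideal I R"
  shows "ideal_power R I (k + n) = ideal_power R I k \<cdot> ideal_power R I n"
proof -
  interpret S: comm_monoid "ideals_set R" by (rule ideals_set_is_comm_monoid)
  have "I \<in> carrier (ideals_set R)" using assms by (simp add: ideals_set_def)
  then show ?thesis using S.nat_pow_mult[of I k n] by (simp add: ideals_set_def)
qed

lemma (in cring) ideal_prod_subset:
  assumes "ideal c R" "\<And>x y. x \<in> a \<Longrightarrow> y \<in> b \<Longrightarrow> x \<otimes> y \<in> c"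
  shows "a \<cdot> b \<subseteq> c"
proof
  fix z assume "z \<in> a \<cdot> b"
  then show "z \<in> c" by (induction) (use assms idealD[OF assms(1)] in auto)
qed

lemma (in cring) ideal_power_antimono:
  assumes "ideal I R" "k \<le> n"
  shows "ideal_power R I n \<subseteq> ideal_power R I k"
proof -
  obtain j where "n = k + j" using assms le_Suc_ex by blast
  then show ?thesis
    using ideal_power_add[OF assms(1)] ideal_prod_inter[OF ideal_power_ideal ideal_power_ideal, OF assms(1) assms(1)]
    by auto
qed

lemma (in cring) ideal_pow_mem:
  assumes "ideal a R" "y \<in> a" "n > 0"
  shows "y [^] (n::nat) \<in> a"
proof -
  obtain k where "n = Suc k" using assms(3) gr0_implies_Suc by blast
  then show ?thesis using assms idealD[OF assms(1)] by simp
qed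

text \<open>A maximal counterexample \<open>c\<close> replaces the count of exponents over a set of
  generators: for an element \<open>z\<close> outside \<open>c\<close> with \<open>z^2\<close> in
  \<open>c\<close>, the larger ideal \<open>c + Rz\<close> contains a power of \<open>a\<close>, and
  its square lies in \<open>c\<close>.\<close>

lemma (in noetherian_ring) ideal_power_subset_of_nilpotent:
  assumes R: "cring R" and a: "ideal a R" and c0: "ideal c0 R"
    and nil: "\<And>y. y \<in> a \<Longrightarrow> \<exists>n::nat. y [^] n \<in> c0"
  shows "\<exists>n. ideal_power R a n \<subseteq> c0"
proof (rule ccontr)
  assume neg: "\<not> ?thesis"
  interpret cring R by fact
  obtain c where c: "ideal c R" "c0 \<subseteq> c" "\<not> (\<exists>n. ideal_power R a n \<subseteq> c)"
    and max: "\<And>c'. ideal c' R \<Longrightarrow> c0 \<subseteq> c' \<and> \<not> (\<exists>n. ideal_power R a n \<subseteq> c') \<Longrightarrow> c \<subseteq> c' \<Longrightarrow> c' = c"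
    by (rule ideal_maximal[OF c0, of "\<lambda>c. c0 \<subseteq> c \<and> \<not> (\<exists>n. ideal_power R a n \<subseteq> c)"])
      (use neg in simp, simp)
  note cD = idealD[OF c(1)]
  have "\<not> a \<subseteq> c" using c(3) ideal_power_1[OF a] by metis
  then obtain y where y: "y \<in> a" "y \<notin> c" by blast
  have yR: "y \<in> carrier R" using idealD[OF a] y by simp
  define k where "k = (LEAST n::nat. y [^] n \<in> c)"
  have k: "y [^] k \<in> c" unfolding k_def using nil[OF y(1)] c(2) by (metis (no_types, lifting) LeastI_ex subsetD)
  have k_min: "y [^] n \<notin> c" if "n < k" for n using not_less_Least that unfolding k_def by blast
  have "k \<noteq> 0"
  proof
    assume "k = 0"
    then have "\<one> \<in> c" using k by simp
    then show False using cD(5)[OF yR] yR y by fastforce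
  qed
  moreover have "k \<noteq> 1" using k y yR by (metis nat_pow_eone)
  ultimately have k2: "k \<ge> 2" by simp
  \<comment> \<open>The last power of \<open>y\<close> outside \<open>c\<close>. Its square is in
    \<open>c\<close> because \<open>2(k - 1) = (k - 2) + k\<close>; this is where
    \<open>k \<ge> 2\<close> matters.\<close>
  define z where "z = y [^] (k - 1)"
  have zR: "z \<in> carrier R" using yR by (simp add: z_def)
  have "z \<notin> c" unfolding z_def using k2 by (intro k_min) simp
  have "k - 1 + (k - 1) = k - 2 + k" using k2 by simp
  then have "z \<otimes> z = y [^] (k - 2) \<otimes> y [^] k"
    unfolding z_def using yR by (simp only: nat_pow_mult)
  then have zz: "z \<otimes> z \<in> c" using cD(5)[OF _ k] yR by simp
  have "z \<in> a" unfolding z_def using a y k2 by (intro ideal_pow_mem) auto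
  obtain n where n: "ideal_power R a n \<subseteq> adjoin R c z"
    using max[OF adjoin_ideal[OF c(1) zR]] adjoin_superset[OF c(1) zR] c(2) \<open>z \<notin> c\<close> by blast
  have "ideal_power R a (n + n) \<subseteq> c"
    unfolding ideal_power_add[OF a]
  proof (rule ideal_prod_subset[OF c(1)])
    fix u v assume "u \<in> ideal_power R a n" "v \<in> ideal_power R a n"
    then have "u \<in> adjoin R c z" "v \<in> adjoin R c z" using n by blast+
    then obtain l r l' r' where *: "u = l \<oplus> r \<otimes> z" "v = l' \<oplus> r' \<otimes> z" "l \<in> c" "l' \<in> c"
      "r \<in> carrier R" "r' \<in> carrier R" by (auto simp: adjoin_def)
    then have "u \<otimes> v = l \<otimes> (l' \<oplus> r' \<otimes> z) \<oplus> ((r \<otimes> z) \<otimes> l' \<oplus> (r \<otimes> r') \<otimes> (z \<otimes> z))"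
      using cD zR by (simp add: l_distr r_distr m_ac)
    then show "u \<otimes> v \<in> c" using * cD zR zz by simp
  qed
  then show False using c(3) by blast
qed

text \<open>A substitute for the Artin-Rees lemma.\<close>

lemma (in noetherian_ring) ideal_power_complement:
  assumes R: "cring R" and c: "ideal c R" and L: "ideal L R" and a: "ideal a R" and "c \<subseteq> L"
    and aL: "\<And>x l. x \<in> a \<Longrightarrow> l \<in> L \<Longrightarrow> x \<otimes> l \<in> c"
  obtains K s where "ideal K R" "c \<subseteq> K" "K \<inter> L \<subseteq> c" "ideal_power R a s \<subseteq> K"
proof -
  interpret cring R by fact
  obtain K where K: "ideal K R" "c \<subseteq> K \<and> K \<inter> L \<subseteq> c"
    and max: "\<And>K'. ideal K' R \<Longrightarrow> c \<subseteq> K' \<and> K' \<inter> L \<subseteq> c \<Longrightarrow> K \<subseteq> K' \<Longrightarrow> K' = K"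
    using ideal_maximal[OF c, of "\<lambda>K. c \<subseteq> K \<and> K \<inter> L \<subseteq> c"] by blast
  note KD = idealD[OF K(1)]
  have "\<exists>n::nat. y [^] n \<in> K" if y: "y \<in> a" for y
  proof -
    have yR: "y \<in> carrier R" using idealD[OF a] y by simp
    \<comment> \<open>The colon ideals \<open>(K : y^n)\<close> increase with \<open>n\<close>; a
      maximal member of the family yields an \<open>n\<close> with
      \<open>(K : y^(n+1)) = (K : y^n)\<close>.\<close>
    let ?C = "\<lambda>n::nat. {w \<in> carrier R. w \<otimes> y [^] n \<in> K}"
    have Cid: "ideal (?C n) R" for n using ideal_colon_ideal[OF K(1)] yR by simp
    obtain b where "b \<in> range ?C"
      and bmax: "\<And>c'. ideal c' R \<Longrightarrow> c' \<in> range ?C \<Longrightarrow> b \<subseteq> c' \<Longrightarrow> c' = b"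
      by (rule ideal_maximal[OF Cid[of 0], of "\<lambda>b. b \<in> range ?C"]) (rule range_eqI, rule refl, blast)
    then obtain n where b: "b = ?C n" by (elim rangeE)
    have "w \<otimes> y [^] Suc n \<in> K" if "w \<in> carrier R" "w \<otimes> y [^] n \<in> K" for w
      using KD(6)[OF yR that(2)] that yR by (simp add: m_assoc)
    then have "?C n \<subseteq> ?C (Suc n)" by blast
    then have stab: "?C (Suc n) = ?C n" using bmax[OF Cid rangeI] b by blast
    \<comment> \<open>For \<open>z = k + w y^n\<close> in \<open>L\<close>, the product
      \<open>y z\<close> lies in \<open>c\<close>, hence \<open>w y^(n+1)\<close> lies in
      \<open>K\<close>, and by the choice of \<open>n\<close> so does \<open>w y^n\<close>.
      Adjoining \<open>y^n\<close> to \<open>K\<close> therefore keeps the intersection with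
      \<open>L\<close> inside \<open>c\<close>, and maximality of \<open>K\<close> forces
      \<open>y^n\<close> into \<open>K\<close>.\<close>
    let ?K' = "adjoin R K (y [^] n)"
    have "?K' \<inter> L \<subseteq> c"
    proof
      fix z assume z: "z \<in> ?K' \<inter> L"
      then obtain k w where kw: "z = k \<oplus> w \<otimes> y [^] n" "k \<in> K" "w \<in> carrier R" by (auto simp: adjoin_def)
      have "y \<otimes> z \<in> K" using aL[OF y, of z] z K(2) by blast
      moreover have "w \<otimes> y [^] Suc n = y \<otimes> z \<ominus> y \<otimes> k"
        using kw KD yR by (simp add: r_distr m_ac a_minus_def r_neg1 r_neg2 a_ac)
      ultimately have "w \<otimes> y [^] Suc n \<in> K" using KD(4,5) kw yR by simp
      then have "w \<otimes> y [^] n \<in> K" using stab kw(3) by blast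
      then have "z \<in> K" using kw KD by simp
      then show "z \<in> c" using K z by blast
    qed
    then have "?K' = K"
      using max[OF adjoin_ideal[OF K(1)]] adjoin_superset[OF K(1), of "y [^] n"] yR K(2) by blast
    then show ?thesis using adjoin_superset(2)[OF K(1), of "y [^] n"] yR by auto
  qed
  then obtain s where "ideal_power R a s \<subseteq> K"
    using ideal_power_subset_of_nilpotent[OF R a K(1)] by blast
  with K that show ?thesis by blast
qed

subsection \<open>Homomorphisms and quotients\<close>

text \<open>In the normal form for the AC laws, \<open>x\<close> and \<open>\<ominus> x\<close> need not be adjacent.\<close>

lemma (in abelian_group) cancel_apart:
  "x \<in> carrier G \<Longrightarrow> y \<in> carrier G \<Longrightarrow> x \<oplus> (y \<oplus> \<ominus> x) = y"
  "x \<in> carrier G \<Longrightarrow> y \<in> carrier G \<Longrightarrow> w \<in> carrier G \<Longrightarrow> x \<oplus> (y \<oplus> (\<ominus> x \<oplus> w)) = y \<oplus> w"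
  "x \<in> carrier G \<Longrightarrow> y \<in> carrier G \<Longrightarrow> z \<in> carrier G \<Longrightarrow> x \<oplus> (y \<oplus> (z \<oplus> \<ominus> x)) = y \<oplus> z"
  "x \<in> carrier G \<Longrightarrow> y \<in> carrier G \<Longrightarrow> z \<in> carrier G \<Longrightarrow> w \<in> carrier G \<Longrightarrow> x \<oplus> (y \<oplus> (z \<oplus> (\<ominus> x \<oplus> w))) = y \<oplus> (z \<oplus> w)"
  "x \<in> carrier G \<Longrightarrow> y \<in> carrier G \<Longrightarrow> z \<in> carrier G \<Longrightarrow> u \<in> carrier G \<Longrightarrow> x \<oplus> (y \<oplus> (z \<oplus> (u \<oplus> \<ominus> x))) = y \<oplus> (z \<oplus> u)"
  "x \<in> carrier G \<Longrightarrow> y \<in> carrier G \<Longrightarrow> z \<in> carrier G \<Longrightarrow> u \<in> carrier G \<Longrightarrow> w \<in> carrier G \<Longrightarrow> x \<oplus> (y \<oplus> (z \<oplus> (u \<oplus> (\<ominus> x \<oplus> w)))) = y \<oplus> (z \<oplus> (u \<oplus> w))"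
  by (simp_all add: a_lcomm[of x y] a_lcomm[of x z] a_lcomm[of x u] r_neg r_neg2)

lemmas (in module) module_simprules =
  M.minus_eq smult_r_distr smult_l_distr smult_r_minus smult_l_minus smult_assoc1
  M.a_ac M.minus_add M.r_neg M.r_neg1 M.r_neg2 M.minus_minus M.cancel_apart

lemma (in module) diff_zero_iff:
  assumes "x \<in> carrier M" "y \<in> carrier M"
  shows "x \<ominus>\<^bsub>M\<^esub> y = \<zero>\<^bsub>M\<^esub> \<longleftrightarrow> x = y"
proof -
  have "x = (x \<ominus>\<^bsub>M\<^esub> y) \<oplus>\<^bsub>M\<^esub> y" using assms by (simp add: M.minus_eq M.a_assoc M.l_neg)
  then show ?thesis using assms by (auto simp: M.minus_eq M.r_neg)
qed

lemma (in module) smult_comm: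
  assumes "r \<in> carrier R" "s \<in> carrier R" "x \<in> carrier M"
  shows "r \<odot>\<^bsub>M\<^esub> (s \<odot>\<^bsub>M\<^esub> x) = s \<odot>\<^bsub>M\<^esub> (r \<odot>\<^bsub>M\<^esub> x)"
  using assms smult_assoc1[of r s x] smult_assoc1[of s r x] R.m_comm[of r s] by simp

lemma mod_homD:
  assumes "h \<in> mod_hom R A B"
  shows "x \<in> carrier A \<Longrightarrow> h x \<in> carrier B"
    "x \<in> carrier A \<Longrightarrow> y \<in> carrier A \<Longrightarrow> h (x \<oplus>\<^bsub>A\<^esub> y) = h x \<oplus>\<^bsub>B\<^esub> h y"
    "r \<in> carrier R \<Longrightarrow> x \<in> carrier A \<Longrightarrow> h (r \<odot>\<^bsub>A\<^esub> x) = r \<odot>\<^bsub>B\<^esub> h x"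
  using assms by (auto simp: mod_hom_def)

lemma mod_hom_eqI:
  assumes "f \<in> mod_hom R A B" "g \<in> mod_hom R A B" "\<And>x. x \<in> carrier A \<Longrightarrow> f x = g x"
  shows "f = g"
  using assms by (auto simp: mod_hom_def intro: PiE_ext)

lemma mod_hom_restrictI:
  assumes "module R A" "\<And>x. x \<in> carrier A \<Longrightarrow> h x \<in> carrier B"
    "\<And>x y. x \<in> carrier A \<Longrightarrow> y \<in> carrier A \<Longrightarrow> h (x \<oplus>\<^bsub>A\<^esub> y) = h x \<oplus>\<^bsub>B\<^esub> h y"
    "\<And>r x. r \<in> carrier R \<Longrightarrow> x \<in> carrier A \<Longrightarrow> h (r \<odot>\<^bsub>A\<^esub> x) = r \<odot>\<^bsub>B\<^esub> h x"
  shows "(\<lambda>x\<in>carrier A. h x) \<in> mod_hom R A B"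
proof -
  interpret A: module R A by fact
  show ?thesis using assms by (auto simp: mod_hom_def)
qed

lemma mod_hom_comp:
  assumes "module R A" "f \<in> mod_hom R A B" "g \<in> mod_hom R B C"
  shows "(\<lambda>x\<in>carrier A. g (f x)) \<in> mod_hom R A C"
  using mod_homD[OF assms(2)] mod_homD[OF assms(3)] by (intro mod_hom_restrictI assms(1)) auto

lemma mod_hom_zero_minus:
  assumes "module R A" "module R B" "h \<in> mod_hom R A B"
  shows "h \<zero>\<^bsub>A\<^esub> = \<zero>\<^bsub>B\<^esub>" "x \<in> carrier A \<Longrightarrow> h (\<ominus>\<^bsub>A\<^esub> x) = \<ominus>\<^bsub>B\<^esub> h x"
    "x \<in> carrier A \<Longrightarrow> y \<in> carrier A \<Longrightarrow> h (x \<ominus>\<^bsub>A\<^esub> y) = h x \<ominus>\<^bsub>B\<^esub> h y"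
proof -
  interpret A: module R A by fact
  interpret B: module R B by fact
  note h = mod_homD[OF assms(3)]
  show "h \<zero>\<^bsub>A\<^esub> = \<zero>\<^bsub>B\<^esub>" using h(3)[of "\<zero>\<^bsub>R\<^esub>" "\<zero>\<^bsub>A\<^esub>"] h(1)[of "\<zero>\<^bsub>A\<^esub>"] by simp
  have neg: "h (\<ominus>\<^bsub>A\<^esub> x) = \<ominus>\<^bsub>B\<^esub> h x" if "x \<in> carrier A" for x
    using h(3)[of "\<ominus>\<^bsub>R\<^esub> \<one>\<^bsub>R\<^esub>" x] h(1) that by (simp add: A.smult_l_minus B.smult_l_minus)
  then show "x \<in> carrier A \<Longrightarrow> h (\<ominus>\<^bsub>A\<^esub> x) = \<ominus>\<^bsub>B\<^esub> h x"
    "x \<in> carrier A \<Longrightarrow> y \<in> carrier A \<Longrightarrow> h (x \<ominus>\<^bsub>A\<^esub> y) = h x \<ominus>\<^bsub>B\<^esub> h y"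
    by (simp_all add: a_minus_def h)
qed

lemma kernel_submodule:
  assumes "module R A" "module R B" "h \<in> mod_hom R A B"
  shows "submodule {x \<in> carrier A. h x = \<zero>\<^bsub>B\<^esub>} R A"
proof -
  interpret A: module R A by fact
  interpret B: module R B by fact
  show ?thesis using mod_homD[OF assms(3)] mod_hom_zero_minus[OF assms]
    by (intro A.submoduleI_closed) auto
qed

lemma vimage_submodule:
  assumes "module R A" "module R B" "h \<in> mod_hom R A B" "submodule N R B"
  shows "submodule {x \<in> carrier A. h x \<in> N} R A"
proof -
  interpret A: module R A by fact
  interpret B: module R B by fact
  show ?thesis
    using mod_homD[OF assms(3)] mod_hom_zero_minus[OF assms(1-3)] B.submoduleD[OF assms(4)]
    by (intro A.submoduleI_closed) auto
qed

lemma image_submodule: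
  assumes "module R A" "module R B" "h \<in> mod_hom R A B" "submodule N R A"
  shows "submodule (h ` N) R B"
proof -
  interpret A: module R A by fact
  interpret B: module R B by fact
  note N = A.submoduleD[OF assms(4)] and h = mod_homD[OF assms(3)]
  show ?thesis
  proof (rule B.submoduleI_closed)
    show "\<zero>\<^bsub>B\<^esub> \<in> h ` N" using mod_hom_zero_minus(1)[OF assms(1-3)] N(2) by (metis imageI)
  next
    fix x y assume "x \<in> h ` N" "y \<in> h ` N"
    then obtain x' y' where *: "x' \<in> N" "y' \<in> N" "x = h x'" "y = h y'" by blast
    then have "x \<oplus>\<^bsub>B\<^esub> y = h (x' \<oplus>\<^bsub>A\<^esub> y')" using h N by simp
    then show "x \<oplus>\<^bsub>B\<^esub> y \<in> h ` N" using * N by blast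
  next
    fix r x assume r: "r \<in> carrier R" and "x \<in> h ` N"
    then obtain x' where *: "x' \<in> N" "x = h x'" by blast
    then have "r \<odot>\<^bsub>B\<^esub> x = h (r \<odot>\<^bsub>A\<^esub> x')" using h N r by simp
    then show "r \<odot>\<^bsub>B\<^esub> x \<in> h ` N" using N(6)[OF r *(1)] by simp
  qed (use h N in auto)
qed

lemma orbit_hom:
  fixes M :: "('a, 'b) module"
  assumes "module R M" "x \<in> carrier M"
  shows "(\<lambda>r\<in>carrier (ring_as_module R). r \<odot>\<^bsub>M\<^esub> x) \<in> mod_hom R (ring_as_module R) M"
proof -
  interpret module R M by fact
  show ?thesis
    using assms by (intro mod_hom_restrictI R.module_ring_as_module) (auto simp: smult_l_distr smult_assoc1)
qed

lemma smult_hom: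
  fixes M :: "('a, 'b) module"
  assumes "module R M" "r \<in> carrier R"
  shows "(\<lambda>x\<in>carrier M. r \<odot>\<^bsub>M\<^esub> x) \<in> mod_hom R M M"
proof -
  interpret module R M by fact
  show ?thesis
    using assms by (intro mod_hom_restrictI module_axioms) (auto simp: smult_r_distr smult_comm)
qed

text \<open>A submodule \<open>G\<close> of \<open>B \<times> Q\<close> that is single-valued at
  zero is the graph of a homomorphism on its domain, and this homomorphism extends by injectivity.
  Maps out of images and sums can thus be given by their graphs, with well-definedness reduced to
  the last hypothesis.\<close>

lemma injective_extend_rel:
  assumes Q: "injective_module R Q" and B: "module R B" and G: "G \<subseteq> carrier B \<times> carrier Q"
    and G0: "(\<zero>\<^bsub>B\<^esub>, \<zero>\<^bsub>Q\<^esub>) \<in> G"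
    and G_add: "\<And>x y x' y'. (x, y) \<in> G \<Longrightarrow> (x', y') \<in> G \<Longrightarrow> (x \<oplus>\<^bsub>B\<^esub> x', y \<oplus>\<^bsub>Q\<^esub> y') \<in> G"
    and G_sm: "\<And>r x y. r \<in> carrier R \<Longrightarrow> (x, y) \<in> G \<Longrightarrow> (r \<odot>\<^bsub>B\<^esub> x, r \<odot>\<^bsub>Q\<^esub> y) \<in> G"
    and G_fun: "\<And>y. (\<zero>\<^bsub>B\<^esub>, y) \<in> G \<Longrightarrow> y = \<zero>\<^bsub>Q\<^esub>"
  obtains h where "h \<in> mod_hom R B Q" "\<And>x y. (x, y) \<in> G \<Longrightarrow> h x = y"
proof -
  interpret Q: module R Q using Q unfolding injective_module_def by blast
  interpret B: module R B by fact
  have uniq: "y = y'" if "(x, y) \<in> G" "(x, y') \<in> G" for x y y'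
  proof -
    have cl: "x \<in> carrier B" "y \<in> carrier Q" "y' \<in> carrier Q" using that G by auto
    have "((\<ominus>\<^bsub>R\<^esub> \<one>\<^bsub>R\<^esub>) \<odot>\<^bsub>B\<^esub> x, (\<ominus>\<^bsub>R\<^esub> \<one>\<^bsub>R\<^esub>) \<odot>\<^bsub>Q\<^esub> y') \<in> G" using that by (intro G_sm) auto
    from G_add[OF that(1) this] have "y \<ominus>\<^bsub>Q\<^esub> y' = \<zero>\<^bsub>Q\<^esub>"
      using cl by (intro G_fun) (simp add: B.smult_l_minus Q.smult_l_minus a_minus_def B.M.r_neg)
    then show ?thesis using cl by (simp add: Q.diff_zero_iff)
  qed
  define g where "g x = (THE y. (x, y) \<in> G)" for x
  have g: "g x = y" if "(x, y) \<in> G" for x y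
    using that uniq unfolding g_def by blast
  have gG: "(x, g x) \<in> G" if "x \<in> Domain G" for x using that g by auto
  have sub: "submodule (Domain G) R B"
  proof (rule B.submoduleI_closed)
    show "\<zero>\<^bsub>B\<^esub> \<in> Domain G" using G0 by (rule DomainI)
    show "x \<oplus>\<^bsub>B\<^esub> y \<in> Domain G" if "x \<in> Domain G" "y \<in> Domain G" for x y
      using G_add gG that by blast
    show "r \<odot>\<^bsub>B\<^esub> x \<in> Domain G" if "r \<in> carrier R" "x \<in> Domain G" for r x
      using G_sm gG that by blast
  qed (use G in auto)
  let ?A = "B\<lparr>carrier := Domain G\<rparr>"
  have A: "module R ?A" using sub B by (rule submodule.submodule_is_module)
  interpret A: module R ?A by (rule A)
  have i: "(\<lambda>x\<in>carrier ?A. x) \<in> mod_hom R ?A B"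
    using B.submoduleD[OF sub] by (intro mod_hom_restrictI A) auto
  have g_hom: "(\<lambda>x\<in>carrier ?A. g x) \<in> mod_hom R ?A Q"
  proof (rule mod_hom_restrictI[OF A])
    show "g x \<in> carrier Q" if "x \<in> carrier ?A" for x
      using that gG[of x] G by auto
    show "g (x \<oplus>\<^bsub>?A\<^esub> y) = g x \<oplus>\<^bsub>Q\<^esub> g y" if "x \<in> carrier ?A" "y \<in> carrier ?A" for x y
      using G_add[OF gG gG] that by (intro g) auto
    show "g (r \<odot>\<^bsub>?A\<^esub> x) = r \<odot>\<^bsub>Q\<^esub> g x" if "r \<in> carrier R" "x \<in> carrier ?A" for r x
      using G_sm[OF _ gG] that by (intro g) auto
  qed
  obtain h where "h \<in> mod_hom R B Q" "\<forall>x\<in>Domain G. h x = g x"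
    using injective_module_extend[OF Q A B i _ g_hom] by (auto simp: inj_on_def)
  then show ?thesis using that g by blast
qed

text \<open>The pairs \<open>(\<phi> p, \<gamma> p)\<close> form the graph of a map on the image of
  \<open>P\<close>. This is the exactness of \<open>Hom(-, Q)\<close>, in a form where neither that
  image nor a quotient of \<open>P\<close> has to be made into a module.\<close>

lemma injective_factor:
  assumes Q: "injective_module R Q" and B: "module R B" and N: "module R N" and P: "submodule P R N"
    and \<phi>: "\<phi> \<in> mod_hom R N B" and \<gamma>: "\<gamma> \<in> mod_hom R N Q"
    and ker: "\<And>p. p \<in> P \<Longrightarrow> \<phi> p = \<zero>\<^bsub>B\<^esub> \<Longrightarrow> \<gamma> p = \<zero>\<^bsub>Q\<^esub>"
  obtains h where "h \<in> mod_hom R B Q" "\<And>p. p \<in> P \<Longrightarrow> h (\<phi> p) = \<gamma> p"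
proof -
  interpret Q: module R Q using Q unfolding injective_module_def by blast
  interpret B: module R B by fact
  interpret N: module R N by fact
  note PD = N.submoduleD[OF P] and \<phi>D = mod_homD[OF \<phi>] and \<gamma>D = mod_homD[OF \<gamma>]
  let ?G = "(\<lambda>p. (\<phi> p, \<gamma> p)) ` P"
  obtain h where h: "h \<in> mod_hom R B Q" and hG: "\<And>x y. (x, y) \<in> ?G \<Longrightarrow> h x = y"
  proof (rule injective_extend_rel[OF Q B, of ?G])
    show "?G \<subseteq> carrier B \<times> carrier Q" using PD \<phi>D \<gamma>D by auto
    show "(\<zero>\<^bsub>B\<^esub>, \<zero>\<^bsub>Q\<^esub>) \<in> ?G"
      using mod_hom_zero_minus(1)[OF N B \<phi>] mod_hom_zero_minus(1)[OF N Q.module_axioms \<gamma>] PD(2)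
      by (intro image_eqI[of _ _ "\<zero>\<^bsub>N\<^esub>"]) auto
  next
    fix x y x' y' assume "(x, y) \<in> ?G" "(x', y') \<in> ?G"
    then obtain p p' where "p \<in> P" "p' \<in> P" "x = \<phi> p" "x' = \<phi> p'" "y = \<gamma> p" "y' = \<gamma> p'" by blast
    then show "(x \<oplus>\<^bsub>B\<^esub> x', y \<oplus>\<^bsub>Q\<^esub> y') \<in> ?G"
      using PD \<phi>D \<gamma>D by (intro image_eqI[of _ _ "p \<oplus>\<^bsub>N\<^esub> p'"]) auto
  next
    fix r x y assume "r \<in> carrier R" "(x, y) \<in> ?G"
    then obtain p where "p \<in> P" "x = \<phi> p" "y = \<gamma> p" "r \<in> carrier R" by blast
    then show "(r \<odot>\<^bsub>B\<^esub> x, r \<odot>\<^bsub>Q\<^esub> y) \<in> ?G"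
      using PD \<phi>D \<gamma>D by (intro image_eqI[of _ _ "r \<odot>\<^bsub>N\<^esub> p"]) auto
  qed (use ker in auto)
  then show ?thesis using that by blast
qed

section \<open>Cosets and quotient modules\<close>

context module
begin

lemma coset_mem_iff:
  assumes N: "submodule N R M" and "x \<in> carrier M" "y \<in> carrier M"
  shows "y \<in> N +>\<^bsub>M\<^esub> x \<longleftrightarrow> y \<ominus>\<^bsub>M\<^esub> x \<in> N"
proof
  assume "y \<in> N +>\<^bsub>M\<^esub> x"
  then obtain n where n: "n \<in> N" "y = n \<oplus>\<^bsub>M\<^esub> x" by (auto simp: a_r_coset_def')
  then have "y \<ominus>\<^bsub>M\<^esub> x = n" using assms submoduleD[OF N] by (simp add: M.minus_eq M.a_assoc M.r_neg)
  then show "y \<ominus>\<^bsub>M\<^esub> x \<in> N" using n by simp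
next
  assume "y \<ominus>\<^bsub>M\<^esub> x \<in> N"
  moreover have "y = (y \<ominus>\<^bsub>M\<^esub> x) \<oplus>\<^bsub>M\<^esub> x" using assms by (simp add: M.minus_eq M.a_assoc M.l_neg)
  ultimately show "y \<in> N +>\<^bsub>M\<^esub> x" unfolding a_r_coset_def' by blast
qed

lemma coset_closed:
  assumes "submodule N R M" "x \<in> carrier M" "y \<in> N +>\<^bsub>M\<^esub> x"
  shows "y \<in> carrier M"
  using assms submoduleD[OF assms(1)] by (auto simp: a_r_coset_def')

lemma coset_eq_iff:
  assumes N: "submodule N R M" and x: "x \<in> carrier M" and y: "y \<in> carrier M"
  shows "N +>\<^bsub>M\<^esub> x = N +>\<^bsub>M\<^esub> y \<longleftrightarrow> x \<ominus>\<^bsub>M\<^esub> y \<in> N"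
proof
  have "x \<in> N +>\<^bsub>M\<^esub> x" using coset_mem_iff[OF N x x] submoduleD[OF N] x by (simp add: M.minus_eq M.r_neg)
  then show "N +>\<^bsub>M\<^esub> x = N +>\<^bsub>M\<^esub> y \<Longrightarrow> x \<ominus>\<^bsub>M\<^esub> y \<in> N"
    using coset_mem_iff[OF N y x] by simp
next
  assume d: "x \<ominus>\<^bsub>M\<^esub> y \<in> N"
  have "z \<in> N +>\<^bsub>M\<^esub> x \<longleftrightarrow> z \<in> N +>\<^bsub>M\<^esub> y" if z: "z \<in> carrier M" for z
  proof -
    have 1: "z \<ominus>\<^bsub>M\<^esub> y = (z \<ominus>\<^bsub>M\<^esub> x) \<oplus>\<^bsub>M\<^esub> (x \<ominus>\<^bsub>M\<^esub> y)" "z \<ominus>\<^bsub>M\<^esub> x = (z \<ominus>\<^bsub>M\<^esub> y) \<ominus>\<^bsub>M\<^esub> (x \<ominus>\<^bsub>M\<^esub> y)"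
      using x y z by (simp_all add: module_simprules)
    show ?thesis
      unfolding coset_mem_iff[OF N x z] coset_mem_iff[OF N y z]
      using submoduleD(3,4)[OF N] d 1 by metis
  qed
  then show "N +>\<^bsub>M\<^esub> x = N +>\<^bsub>M\<^esub> y"
    using coset_closed[OF N x] coset_closed[OF N y] by blast
qed

end

lemma quot_module_carrier: "carrier (quot_module M N) = {N +>\<^bsub>M\<^esub> x | x. x \<in> carrier M}"
  by (auto simp: quot_module_def A_RCOSETS_def')

lemma quot_module_simps:
  fixes M :: "('a, 'b) module"
  assumes M: "module R M" and N: "submodule N R M"
  shows "x \<in> carrier M \<Longrightarrow> y \<in> carrier M \<Longrightarrow>
      (N +>\<^bsub>M\<^esub> x) \<oplus>\<^bsub>quot_module M N\<^esub> (N +>\<^bsub>M\<^esub> y) = N +>\<^bsub>M\<^esub> (x \<oplus>\<^bsub>M\<^esub> y)"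
    and "r \<in> carrier R \<Longrightarrow> x \<in> carrier M \<Longrightarrow>
      r \<odot>\<^bsub>quot_module M N\<^esub> (N +>\<^bsub>M\<^esub> x) = N +>\<^bsub>M\<^esub> (r \<odot>\<^bsub>M\<^esub> x)"
    and "\<zero>\<^bsub>quot_module M N\<^esub> = N +>\<^bsub>M\<^esub> \<zero>\<^bsub>M\<^esub>"
proof -
  interpret module R M by fact
  interpret N: submodule N R M by fact
  interpret N: abelian_subgroup N M
    by (intro abelian_subgroupI3 additive_subgroupI N.subgroup_axioms M.abelian_group_axioms)
  note ND = submoduleD[OF N]
  show "x \<in> carrier M \<Longrightarrow> y \<in> carrier M \<Longrightarrow>
      (N +>\<^bsub>M\<^esub> x) \<oplus>\<^bsub>quot_module M N\<^esub> (N +>\<^bsub>M\<^esub> y) = N +>\<^bsub>M\<^esub> (x \<oplus>\<^bsub>M\<^esub> y)"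
    by (simp add: quot_module_def N.a_rcos_sum)
  show "\<zero>\<^bsub>quot_module M N\<^esub> = N +>\<^bsub>M\<^esub> \<zero>\<^bsub>M\<^esub>"
    using ND by (simp add: quot_module_def subsetI)
  assume r: "r \<in> carrier R" and x: "x \<in> carrier M"
  show "r \<odot>\<^bsub>quot_module M N\<^esub> (N +>\<^bsub>M\<^esub> x) = N +>\<^bsub>M\<^esub> (r \<odot>\<^bsub>M\<^esub> x)"
  proof (intro equalityI subsetI)
    fix z assume "z \<in> r \<odot>\<^bsub>quot_module M N\<^esub> (N +>\<^bsub>M\<^esub> x)"
    then obtain n n' where n: "n \<in> N" "n' \<in> N" "z = n \<oplus>\<^bsub>M\<^esub> r \<odot>\<^bsub>M\<^esub> (n' \<oplus>\<^bsub>M\<^esub> x)"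
      by (auto simp: quot_module_def set_add_def' a_r_coset_def')
    then have "z = (n \<oplus>\<^bsub>M\<^esub> r \<odot>\<^bsub>M\<^esub> n') \<oplus>\<^bsub>M\<^esub> r \<odot>\<^bsub>M\<^esub> x"
      using r x ND by (simp add: smult_r_distr M.a_assoc)
    then show "z \<in> N +>\<^bsub>M\<^esub> (r \<odot>\<^bsub>M\<^esub> x)" using n r ND unfolding a_r_coset_def' by blast
  next
    fix z assume "z \<in> N +>\<^bsub>M\<^esub> (r \<odot>\<^bsub>M\<^esub> x)"
    then obtain n where n: "n \<in> N" "z = n \<oplus>\<^bsub>M\<^esub> r \<odot>\<^bsub>M\<^esub> x" by (auto simp: a_r_coset_def')
    moreover have "x \<in> N +>\<^bsub>M\<^esub> x"
      using coset_mem_iff[OF N x x] ND x by (simp add: M.minus_eq M.r_neg)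
    ultimately show "z \<in> r \<odot>\<^bsub>quot_module M N\<^esub> (N +>\<^bsub>M\<^esub> x)"
      unfolding quot_module_def set_add_def' by auto
  qed
qed

lemma quot_module_module:
  fixes M :: "('a, 'b) module"
  assumes M: "module R M" and N: "submodule N R M"
  shows "module R (quot_module M N)"
proof -
  interpret module R M by fact
  note simps = quot_module_simps[OF M N] quot_module_carrier
  have "abelian_group (quot_module M N)"
  proof (rule abelian_groupI)
    fix x assume "x \<in> carrier (quot_module M N)"
    then obtain x' where x': "x = N +>\<^bsub>M\<^esub> x'" "x' \<in> carrier M" by (auto simp: simps)
    then show "\<exists>y\<in>carrier (quot_module M N). y \<oplus>\<^bsub>quot_module M N\<^esub> x = \<zero>\<^bsub>quot_module M N\<^esub>"
      by (intro bexI[of _ "N +>\<^bsub>M\<^esub> (\<ominus>\<^bsub>M\<^esub> x')"]) (auto simp: simps M.l_neg)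
  qed (auto simp: simps M.a_ac)
  then show ?thesis
    by (intro moduleI R.is_cring) (auto simp: simps smult_l_distr smult_r_distr smult_assoc1)
qed

lemma quot_proj_hom:
  fixes M :: "('a, 'b) module"
  assumes M: "module R M" and N: "submodule N R M"
  shows "(\<lambda>x\<in>carrier M. N +>\<^bsub>M\<^esub> x) \<in> mod_hom R M (quot_module M N)"
  using quot_module_simps[OF M N] by (intro mod_hom_restrictI M) (auto simp: quot_module_carrier)

text \<open>By Baer's criterion the hypothesis says that \<open>X\<close> is injective.\<close>

lemma injective_retract:
  assumes Q: "injective_module R Q" and X: "submodule X R Q"
    and baer: "\<And>L q. ideal L R \<Longrightarrow> q \<in> carrier Q \<Longrightarrow> (\<And>l. l \<in> L \<Longrightarrow> l \<odot>\<^bsub>Q\<^esub> q \<in> X) \<Longrightarrow>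
      \<exists>x\<in>X. \<forall>l\<in>L. l \<odot>\<^bsub>Q\<^esub> q = l \<odot>\<^bsub>Q\<^esub> x"
  obtains p where "p \<in> mod_hom R Q Q" "\<And>q. q \<in> carrier Q \<Longrightarrow> p q \<in> X" "\<And>x. x \<in> X \<Longrightarrow> p x = x"
proof -
  interpret Q: module R Q using Q unfolding injective_module_def by blast
  note XD = Q.submoduleD[OF X]
  \<comment> \<open>A maximal submodule \<open>Y\<close> that meets \<open>X\<close> only in zero
    will satisfy \<open>Q = X \<oplus> Y\<close>; the retraction is the projection onto
    \<open>X\<close> along \<open>Y\<close>.\<close>
  let ?A = "{Y. submodule Y R Q \<and> Y \<inter> X \<subseteq> {\<zero>\<^bsub>Q\<^esub>}}"
  have "\<exists>Y\<in>?A. \<forall>Y'\<in>?A. Y \<subseteq> Y' \<longrightarrow> Y' = Y"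
  proof (rule subset_Zorn_nonempty)
    show "?A \<noteq> {}" using Q.zero_submodule by blast
    fix C assume "C \<noteq> {}" and C: "subset.chain ?A C"
    have sub: "submodule Y R Q" if "Y \<in> C" for Y using C that by (auto simp: subset_chain_def)
    have lin: "Y \<subseteq> Y' \<or> Y' \<subseteq> Y" if "Y \<in> C" "Y' \<in> C" for Y Y'
      using C that by (auto simp: subset_chain_def)
    have "submodule (\<Union>C) R Q"
    proof (rule Q.submoduleI_closed)
      fix x y assume "x \<in> \<Union>C" "y \<in> \<Union>C"
      then obtain Y where "Y \<in> C" "x \<in> Y" "y \<in> Y" using lin by blast
      then show "x \<oplus>\<^bsub>Q\<^esub> y \<in> \<Union>C" using Q.submoduleD(3)[OF sub] by blast
    next
      obtain Y where "Y \<in> C" using \<open>C \<noteq> {}\<close> by blast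
      then show "\<zero>\<^bsub>Q\<^esub> \<in> \<Union>C" using Q.submoduleD(2)[OF sub] by blast
      show "\<Union>C \<subseteq> carrier Q" using Q.submoduleD(1)[OF sub] by blast
    next
      fix r x assume "r \<in> carrier R" "x \<in> \<Union>C"
      then show "r \<odot>\<^bsub>Q\<^esub> x \<in> \<Union>C" using Q.submoduleD(6)[OF sub] by blast
    qed
    then show "\<Union>C \<in> ?A" using C by (auto simp: subset_chain_def)
  qed
  then obtain Y where "Y \<in> ?A" and max: "\<forall>Y'\<in>?A. Y \<subseteq> Y' \<longrightarrow> Y' = Y" by (elim bexE)
  then have Y: "submodule Y R Q" "Y \<inter> X \<subseteq> {\<zero>\<^bsub>Q\<^esub>}" by simp_all
  note YD = Q.submoduleD[OF Y(1)]
  have uniq: "x = x'" if "q \<in> carrier Q" "x \<in> X" "x' \<in> X" "q \<ominus>\<^bsub>Q\<^esub> x \<in> Y" "q \<ominus>\<^bsub>Q\<^esub> x' \<in> Y" for q x x'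
  proof -
    have "x \<ominus>\<^bsub>Q\<^esub> x' = (q \<ominus>\<^bsub>Q\<^esub> x') \<ominus>\<^bsub>Q\<^esub> (q \<ominus>\<^bsub>Q\<^esub> x)" using that XD(1) by (simp add: Q.module_simprules)
    then have "x \<ominus>\<^bsub>Q\<^esub> x' \<in> Y" "x \<ominus>\<^bsub>Q\<^esub> x' \<in> X"
      using XD(4)[OF that(2,3)] YD(4)[OF that(5,4)] by simp_all
    then show ?thesis using Y(2) Q.diff_zero_iff[of x x'] XD(1) that(2,3) by blast
  qed
  \<comment> \<open>\<open>?D q x\<close> says that \<open>x\<close> is the
    \<open>X\<close>-component of \<open>q\<close> along \<open>Y\<close>; by \<open>uniq\<close>
    there is at most one.\<close>
  let ?D = "\<lambda>q x. x \<in> X \<and> q \<ominus>\<^bsub>Q\<^esub> x \<in> Y"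
  have D_add: "?D (q \<oplus>\<^bsub>Q\<^esub> q') (x \<oplus>\<^bsub>Q\<^esub> x')" if "?D q x" "?D q' x'" "q \<in> carrier Q" "q' \<in> carrier Q" for q q' x x'
  proof -
    have "(q \<oplus>\<^bsub>Q\<^esub> q') \<ominus>\<^bsub>Q\<^esub> (x \<oplus>\<^bsub>Q\<^esub> x') = (q \<ominus>\<^bsub>Q\<^esub> x) \<oplus>\<^bsub>Q\<^esub> (q' \<ominus>\<^bsub>Q\<^esub> x')"
      using that XD(1) by (simp add: Q.module_simprules)
    then show ?thesis using that XD(3) YD(3) by simp
  qed
  have D_sm: "?D (r \<odot>\<^bsub>Q\<^esub> q) (r \<odot>\<^bsub>Q\<^esub> x)" if "?D q x" "q \<in> carrier Q" "r \<in> carrier R" for q r x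
  proof -
    have "(r \<odot>\<^bsub>Q\<^esub> q) \<ominus>\<^bsub>Q\<^esub> (r \<odot>\<^bsub>Q\<^esub> x) = r \<odot>\<^bsub>Q\<^esub> (q \<ominus>\<^bsub>Q\<^esub> x)"
      using that XD(1) by (simp add: Q.module_simprules)
    then show ?thesis using that XD(6) YD(6) by simp
  qed
  have ex: "\<exists>x. ?D q x" if q: "q \<in> carrier Q" for q
  proof -
    \<comment> \<open>\<open>L\<close> consists of the scalars that bring \<open>q\<close> into
      \<open>X + Y\<close>, and \<open>g\<close> gives the \<open>X\<close>-components. Injectivity
      of \<open>Q\<close> turns \<open>g\<close> into multiplication by some \<open>q1\<close>, and
      the hypothesis on \<open>X\<close> replaces \<open>q1\<close> by an element \<open>x\<close>
      of \<open>X\<close>. Then \<open>L\<close> carries \<open>q' = q - x\<close> into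
      \<open>Y\<close>.\<close>
    define L where "L = {r \<in> carrier R. \<exists>x. ?D (r \<odot>\<^bsub>Q\<^esub> q) x}"
    define g where "g r = (THE x. ?D (r \<odot>\<^bsub>Q\<^esub> q) x)" for r
    have g_eq: "g r = x" if "r \<in> carrier R" "?D (r \<odot>\<^bsub>Q\<^esub> q) x" for r x
      unfolding g_def
    proof (rule the_equality)
      show "y = x" if "?D (r \<odot>\<^bsub>Q\<^esub> q) y" for y
        using uniq[of "r \<odot>\<^bsub>Q\<^esub> q"] that \<open>?D (r \<odot>\<^bsub>Q\<^esub> q) x\<close> \<open>r \<in> carrier R\<close> q by blast
    qed (rule that)
    have g: "?D (r \<odot>\<^bsub>Q\<^esub> q) (g r)" if "r \<in> L" for r
      using that g_eq unfolding L_def by blast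
    have LR: "r \<in> carrier R" if "r \<in> L" for r using that by (simp add: L_def)
    have add: "?D ((r \<oplus>\<^bsub>R\<^esub> s) \<odot>\<^bsub>Q\<^esub> q) (g r \<oplus>\<^bsub>Q\<^esub> g s)" if "r \<in> L" "s \<in> L" for r s
      using D_add[OF g g, OF that] that LR q by (simp add: Q.smult_l_distr)
    have sm: "?D ((r \<otimes>\<^bsub>R\<^esub> s) \<odot>\<^bsub>Q\<^esub> q) (r \<odot>\<^bsub>Q\<^esub> g s)" if "r \<in> carrier R" "s \<in> L" for r s
      using D_sm[OF g, OF that(2) _ that(1)] that LR q by (simp add: Q.smult_assoc1)
    have "?D (\<zero>\<^bsub>R\<^esub> \<odot>\<^bsub>Q\<^esub> q) \<zero>\<^bsub>Q\<^esub>" using q XD(2) YD(2) Q.diff_zero_iff[of "\<zero>\<^bsub>Q\<^esub>" "\<zero>\<^bsub>Q\<^esub>"] by simp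
    then have 0: "\<zero>\<^bsub>R\<^esub> \<in> L" unfolding L_def by blast
    have L: "ideal L R"
    proof (rule Q.R.idealI_closed)
      show "r \<oplus>\<^bsub>R\<^esub> s \<in> L" if "r \<in> L" "s \<in> L" for r s
        using add[OF that] LR that unfolding L_def by blast
      show "r \<otimes>\<^bsub>R\<^esub> s \<in> L" if "r \<in> carrier R" "s \<in> L" for r s
        using sm[OF that] LR that unfolding L_def by blast
    qed (use 0 LR in auto)
    obtain q1 where q1: "q1 \<in> carrier Q" "\<forall>l\<in>L. g l = l \<odot>\<^bsub>Q\<^esub> q1"
    proof -
      have "\<exists>q\<in>carrier Q. \<forall>l\<in>L. g l = l \<odot>\<^bsub>Q\<^esub> q"
      proof (rule baer_ideal_extend[OF Q L])
        show "g l \<in> carrier Q" if "l \<in> L" for l using g[OF that] XD(1) by blast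
        show "g (l \<oplus>\<^bsub>R\<^esub> l') = g l \<oplus>\<^bsub>Q\<^esub> g l'" if "l \<in> L" "l' \<in> L" for l l'
          using that LR add by (intro g_eq) auto
        show "g (r \<otimes>\<^bsub>R\<^esub> l) = r \<odot>\<^bsub>Q\<^esub> g l" if "r \<in> carrier R" "l \<in> L" for r l
          using that LR sm by (intro g_eq) auto
      qed
      then show ?thesis using that by blast
    qed
    have "l \<odot>\<^bsub>Q\<^esub> q1 \<in> X" if "l \<in> L" for l using q1 g[OF that] that by auto
    then obtain x where x: "x \<in> X" "\<forall>l\<in>L. l \<odot>\<^bsub>Q\<^esub> q1 = l \<odot>\<^bsub>Q\<^esub> x" using baer[OF L q1(1)] by blast
    have xQ: "x \<in> carrier Q" using x XD by simp
    define q' where "q' = q \<ominus>\<^bsub>Q\<^esub> x"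
    have q'Q: "q' \<in> carrier Q" using q xQ by (simp add: q'_def)
    have Lq': "l \<odot>\<^bsub>Q\<^esub> q' \<in> Y" if "l \<in> L" for l
    proof -
      have "l \<odot>\<^bsub>Q\<^esub> q' = l \<odot>\<^bsub>Q\<^esub> q \<ominus>\<^bsub>Q\<^esub> g l"
        using that LR q xQ q1 x by (simp add: q'_def Q.module_simprules)
      then show ?thesis using g[OF that] by simp
    qed
    let ?Y' = "{y \<oplus>\<^bsub>Q\<^esub> r \<odot>\<^bsub>Q\<^esub> q' | y r. y \<in> Y \<and> r \<in> carrier R}"
    have Y': "submodule ?Y' R Q"
    proof (rule Q.submoduleI_closed)
      show "?Y' \<subseteq> carrier Q" using YD(1) q'Q by auto
      show "\<zero>\<^bsub>Q\<^esub> \<in> ?Y'"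
        using YD(2) q'Q by (intro CollectI exI[of _ "\<zero>\<^bsub>Q\<^esub>"] exI[of _ "\<zero>\<^bsub>R\<^esub>"]) simp
    next
      fix a b assume "a \<in> ?Y'" "b \<in> ?Y'"
      then obtain y r y' r' where *: "a = y \<oplus>\<^bsub>Q\<^esub> r \<odot>\<^bsub>Q\<^esub> q'" "b = y' \<oplus>\<^bsub>Q\<^esub> r' \<odot>\<^bsub>Q\<^esub> q'" "y \<in> Y" "y' \<in> Y"
        "r \<in> carrier R" "r' \<in> carrier R" by blast
      then have "a \<oplus>\<^bsub>Q\<^esub> b = (y \<oplus>\<^bsub>Q\<^esub> y') \<oplus>\<^bsub>Q\<^esub> (r \<oplus>\<^bsub>R\<^esub> r') \<odot>\<^bsub>Q\<^esub> q'"
        using YD(1) q'Q by (simp add: Q.module_simprules)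
      then show "a \<oplus>\<^bsub>Q\<^esub> b \<in> ?Y'" using * YD(3) by blast
    next
      fix s a assume s: "s \<in> carrier R" and "a \<in> ?Y'"
      then obtain y r where *: "a = y \<oplus>\<^bsub>Q\<^esub> r \<odot>\<^bsub>Q\<^esub> q'" "y \<in> Y" "r \<in> carrier R" by blast
      then have "s \<odot>\<^bsub>Q\<^esub> a = s \<odot>\<^bsub>Q\<^esub> y \<oplus>\<^bsub>Q\<^esub> (s \<otimes>\<^bsub>R\<^esub> r) \<odot>\<^bsub>Q\<^esub> q'"
        using YD(1) q'Q s by (simp add: Q.module_simprules)
      then show "s \<odot>\<^bsub>Q\<^esub> a \<in> ?Y'" using * YD(6) s by blast
    qed
    \<comment> \<open>If \<open>z = y + r q'\<close> lies in \<open>X\<close>, then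
      \<open>r q\<close> lies in \<open>X + Y\<close>, so \<open>r\<close> is in \<open>L\<close>
      and \<open>r q'\<close> is in \<open>Y\<close>; hence \<open>z\<close> is in
      \<open>Y \<inter> X\<close>. Maximality of \<open>Y\<close> now puts \<open>q'\<close> into
      \<open>Y\<close>.\<close>
    have "?Y' \<inter> X \<subseteq> {\<zero>\<^bsub>Q\<^esub>}"
    proof
      fix z assume z: "z \<in> ?Y' \<inter> X"
      then obtain y r where *: "z = y \<oplus>\<^bsub>Q\<^esub> r \<odot>\<^bsub>Q\<^esub> q'" "y \<in> Y" "r \<in> carrier R" by blast
      note cl = YD(1)[OF *(2)] xQ q *(3)
      have "r \<odot>\<^bsub>Q\<^esub> q \<ominus>\<^bsub>Q\<^esub> (z \<oplus>\<^bsub>Q\<^esub> r \<odot>\<^bsub>Q\<^esub> x) = \<ominus>\<^bsub>Q\<^esub> y"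
        unfolding *(1) q'_def using cl by (simp add: Q.module_simprules)
      then have "?D (r \<odot>\<^bsub>Q\<^esub> q) (z \<oplus>\<^bsub>Q\<^esub> r \<odot>\<^bsub>Q\<^esub> x)"
        using z x XD(3,6) YD(5) * by simp
      then have "r \<in> L" using * by (auto simp: L_def)
      then have "z \<in> Y" using Lq' * YD(3) by simp
      then show "z \<in> {\<zero>\<^bsub>Q\<^esub>}" using z Y(2) by blast
    qed
    moreover have "Y \<subseteq> ?Y'"
    proof
      fix y assume "y \<in> Y"
      then show "y \<in> ?Y'" using YD(1) q'Q by (intro CollectI exI[of _ y] exI[of _ "\<zero>\<^bsub>R\<^esub>"]) simp
    qed
    ultimately have "?Y' = Y" using max[rule_format, of ?Y'] Y' by simp
    moreover have "q' \<in> ?Y'"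
      using YD(2) q'Q by (intro CollectI exI[of _ "\<zero>\<^bsub>Q\<^esub>"] exI[of _ "\<one>\<^bsub>R\<^esub>"]) simp
    ultimately show ?thesis using x q'_def by auto
  qed
  define p where "p q = (THE x. ?D q x)" for q
  have p_eq: "p q = x" if "q \<in> carrier Q" "?D q x" for q x
    unfolding p_def
  proof (rule the_equality)
    show "y = x" if "?D q y" for y using uniq that \<open>?D q x\<close> \<open>q \<in> carrier Q\<close> by blast
  qed (rule that)
  have p: "?D q (p q)" if "q \<in> carrier Q" for q
    using ex[OF that] p_eq[OF that] by metis
  show ?thesis
  proof (rule that[of "\<lambda>q\<in>carrier Q. p q"])
    show "(\<lambda>q\<in>carrier Q. p q) \<in> mod_hom R Q Q"
    proof (rule mod_hom_restrictI[OF Q.module_axioms])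
      show "p x \<in> carrier Q" if "x \<in> carrier Q" for x using p[OF that] XD(1) by blast
      show "p (x \<oplus>\<^bsub>Q\<^esub> y) = p x \<oplus>\<^bsub>Q\<^esub> p y" if "x \<in> carrier Q" "y \<in> carrier Q" for x y
        using D_add[OF p p that] that by (intro p_eq) auto
      show "p (r \<odot>\<^bsub>Q\<^esub> x) = r \<odot>\<^bsub>Q\<^esub> p x" if "r \<in> carrier R" "x \<in> carrier Q" for r x
        using D_sm[OF p that(2,1)] that by (intro p_eq) auto
    qed
    show "(\<lambda>q\<in>carrier Q. p q) q \<in> X" if "q \<in> carrier Q" for q using p that by simp
    show "(\<lambda>q\<in>carrier Q. p q) x = x" if "x \<in> X" for x
      using that XD(1) YD(2) p_eq[of x x] Q.diff_zero_iff[of x x] by simp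
  qed
qed

subsection \<open>Noetherian subquotients\<close>

text \<open>For submodules \<open>A\<close> and \<open>B\<close> this says that
  \<open>(A + B) / B\<close> is a Noetherian module. \<open>B\<close> need not lie in
  \<open>A\<close> and no quotient is formed, so subquotients of one module can be compared without
  a change of type.\<close>

definition noeth_over :: "('a, 'm) ring_scheme \<Rightarrow> ('a, 'b) module \<Rightarrow> 'b set \<Rightarrow> 'b set \<Rightarrow> bool"
  where "noeth_over R M A B \<longleftrightarrow> (\<forall>S. submodule S R M \<longrightarrow> S \<subseteq> A \<longrightarrow>
    (\<exists>F. finite F \<and> F \<subseteq> S \<and> S \<subseteq> mod_span R M F <+>\<^bsub>M\<^esub> B))"

text \<open>For an ideal \<open>b\<close> this is \<open>(0 : b)\<close>, the module
  \<open>Hom(R/b, M)\<close> realised inside \<open>M\<close>.\<close>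

definition ann_in :: "('a, 'b) module \<Rightarrow> 'a set \<Rightarrow> 'b set"
  where "ann_in M b = {x \<in> carrier M. \<forall>l\<in>b. l \<odot>\<^bsub>M\<^esub> x = \<zero>\<^bsub>M\<^esub>}"

lemma set_add_iff: "z \<in> A <+>\<^bsub>M\<^esub> B \<longleftrightarrow> (\<exists>x\<in>A. \<exists>y\<in>B. z = x \<oplus>\<^bsub>M\<^esub> y)"
  by (auto simp: set_add_def')

lemma set_addI: "x \<in> A \<Longrightarrow> y \<in> B \<Longrightarrow> x \<oplus>\<^bsub>M\<^esub> y \<in> A <+>\<^bsub>M\<^esub> B"
  by (auto simp: set_add_def')

lemma set_add_memI: "x \<in> A \<Longrightarrow> y \<in> B \<Longrightarrow> z = x \<oplus>\<^bsub>M\<^esub> y \<Longrightarrow> z \<in> A <+>\<^bsub>M\<^esub> B"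
  by (auto simp: set_add_def')

lemma set_addE:
  assumes "z \<in> A <+>\<^bsub>M\<^esub> B"
  obtains x y where "x \<in> A" "y \<in> B" "z = x \<oplus>\<^bsub>M\<^esub> y"
  using assms by (auto simp: set_add_iff)

lemma set_add_mono: "A \<subseteq> A' \<Longrightarrow> B \<subseteq> B' \<Longrightarrow> A <+>\<^bsub>M\<^esub> B \<subseteq> A' <+>\<^bsub>M\<^esub> B'"
  by (auto simp: set_add_def')

lemma (in module) submodule_set_add:
  assumes "submodule N R M" "submodule N' R M"
  shows "submodule (N <+>\<^bsub>M\<^esub> N') R M"
proof (rule submoduleI_closed)
  note D = submoduleD[OF assms(1)] and D' = submoduleD[OF assms(2)]
  show "N <+>\<^bsub>M\<^esub> N' \<subseteq> carrier M" using D(1) D'(1) by (auto simp: set_add_iff)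
  show "\<zero>\<^bsub>M\<^esub> \<in> N <+>\<^bsub>M\<^esub> N'" using set_addI[OF D(2) D'(2), of M] by simp
  fix x y assume "x \<in> N <+>\<^bsub>M\<^esub> N'" "y \<in> N <+>\<^bsub>M\<^esub> N'"
  then obtain a a' b b' where *: "a \<in> N" "a' \<in> N'" "b \<in> N" "b' \<in> N'" "x = a \<oplus>\<^bsub>M\<^esub> a'" "y = b \<oplus>\<^bsub>M\<^esub> b'"
    by (auto simp: set_add_iff)
  then have "x \<oplus>\<^bsub>M\<^esub> y = (a \<oplus>\<^bsub>M\<^esub> b) \<oplus>\<^bsub>M\<^esub> (a' \<oplus>\<^bsub>M\<^esub> b')" using D(1) D'(1) by (simp add: M.a_ac)
  then show "x \<oplus>\<^bsub>M\<^esub> y \<in> N <+>\<^bsub>M\<^esub> N'" using set_addI D(3) D'(3) * by metis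
next
  note D = submoduleD[OF assms(1)] and D' = submoduleD[OF assms(2)]
  fix r x assume r: "r \<in> carrier R" and "x \<in> N <+>\<^bsub>M\<^esub> N'"
  then obtain a a' where *: "a \<in> N" "a' \<in> N'" "x = a \<oplus>\<^bsub>M\<^esub> a'" by (auto simp: set_add_iff)
  then have "r \<odot>\<^bsub>M\<^esub> x = r \<odot>\<^bsub>M\<^esub> a \<oplus>\<^bsub>M\<^esub> r \<odot>\<^bsub>M\<^esub> a'" using D(1) D'(1) r by (simp add: smult_r_distr)
  then show "r \<odot>\<^bsub>M\<^esub> x \<in> N <+>\<^bsub>M\<^esub> N'" using set_addI D(6) D'(6) * r by metis
qed

lemma (in module) set_add_superset:
  assumes "submodule N R M" "submodule N' R M"
  shows "N \<subseteq> N <+>\<^bsub>M\<^esub> N'" "N' \<subseteq> N <+>\<^bsub>M\<^esub> N'"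
proof -
  note D = submoduleD[OF assms(1)] and D' = submoduleD[OF assms(2)]
  show "N \<subseteq> N <+>\<^bsub>M\<^esub> N'"
  proof
    fix x assume "x \<in> N"
    then show "x \<in> N <+>\<^bsub>M\<^esub> N'" using set_addI[OF _ D'(2), of x N M] D(1) by simp
  qed
  show "N' \<subseteq> N <+>\<^bsub>M\<^esub> N'"
  proof
    fix x assume "x \<in> N'"
    then show "x \<in> N <+>\<^bsub>M\<^esub> N'" using set_addI[OF D(2), of x N' M] D'(1) by simp
  qed
qed

lemma (in module) submodule_Int:
  assumes "submodule N R M" "submodule N' R M"
  shows "submodule (N \<inter> N') R M"
  using submoduleD[OF assms(1)] submoduleD[OF assms(2)] by (intro submoduleI_closed) auto

lemma submodule_ann_in:
  assumes "module R M" "b \<subseteq> carrier R"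
  shows "submodule (ann_in M b) R M"
proof -
  interpret module R M by fact
  have "l \<odot>\<^bsub>M\<^esub> (r \<odot>\<^bsub>M\<^esub> x) = \<zero>\<^bsub>M\<^esub>"
    if "l \<in> b" "r \<in> carrier R" "x \<in> carrier M" "l \<odot>\<^bsub>M\<^esub> x = \<zero>\<^bsub>M\<^esub>" for l r x
    using that assms(2) smult_comm[of l r x] by auto
  then show ?thesis
    using assms(2) by (intro submoduleI_closed) (auto simp: ann_in_def smult_r_distr subset_iff)
qed

lemma mod_span_superset: "F \<subseteq> mod_span R M F"
  by (auto simp: mod_span_def)

lemma mod_span_least: "submodule N R M \<Longrightarrow> F \<subseteq> N \<Longrightarrow> mod_span R M F \<subseteq> N"
  by (auto simp: mod_span_def)

lemma mod_span_submodule: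
  assumes "module R M" "F \<subseteq> carrier M"
  shows "submodule (mod_span R M F) R M"
proof -
  interpret module R M by fact
  have c: "submodule (carrier M) R M" by (rule carrier_is_submodule)
  show ?thesis
  proof (rule submoduleI_closed)
    show "mod_span R M F \<subseteq> carrier M" by (intro mod_span_least c assms)
    show "\<zero>\<^bsub>M\<^esub> \<in> mod_span R M F" by (auto simp: mod_span_def submoduleD(2))
    show "x \<oplus>\<^bsub>M\<^esub> y \<in> mod_span R M F" if "x \<in> mod_span R M F" "y \<in> mod_span R M F" for x y
      using that by (auto simp: mod_span_def submoduleD(3))
    show "r \<odot>\<^bsub>M\<^esub> x \<in> mod_span R M F" if "r \<in> carrier R" "x \<in> mod_span R M F" for r x
      using that by (auto simp: mod_span_def submoduleD(6))
  qed
qed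

lemma mod_span_mono: "F \<subseteq> F' \<Longrightarrow> mod_span R M F \<subseteq> mod_span R M F'"
  by (auto simp: mod_span_def)

lemma noeth_overD:
  assumes "noeth_over R M A B" "submodule S R M" "S \<subseteq> A"
  obtains F where "finite F" "F \<subseteq> S" "S \<subseteq> mod_span R M F <+>\<^bsub>M\<^esub> B"
  using assms(1)[unfolded noeth_over_def, rule_format, OF assms(2,3)] that by blast

lemma noeth_over_mono:
  assumes "noeth_over R M A B" "A' \<subseteq> A" "B \<subseteq> B'"
  shows "noeth_over R M A' B'"
  unfolding noeth_over_def
proof (intro allI impI)
  fix S assume "submodule S R M" "S \<subseteq> A'"
  then obtain F where "finite F" "F \<subseteq> S" "S \<subseteq> mod_span R M F <+>\<^bsub>M\<^esub> B"
    using noeth_overD[OF assms(1), of S] assms(2) by (metis subset_trans)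
  then show "\<exists>F. finite F \<and> F \<subseteq> S \<and> S \<subseteq> mod_span R M F <+>\<^bsub>M\<^esub> B'"
    using set_add_mono[OF order_refl assms(3)] by (metis subset_trans)
qed

lemma noeth_over_subset:
  assumes M: "module R M" and B: "submodule B R M" and "A \<subseteq> B"
  shows "noeth_over R M A B"
  unfolding noeth_over_def
proof (intro allI impI)
  interpret module R M by fact
  fix S assume "submodule S R M" "S \<subseteq> A"
  have "S \<subseteq> B" using \<open>S \<subseteq> A\<close> assms(3) by (rule subset_trans)
  then have "S \<subseteq> mod_span R M {} <+>\<^bsub>M\<^esub> B"
    using set_add_superset(2)[OF mod_span_submodule[OF M empty_subsetI] B] by (rule subset_trans)
  then show "\<exists>F. finite F \<and> F \<subseteq> S \<and> S \<subseteq> mod_span R M F <+>\<^bsub>M\<^esub> B" by blast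
qed

text \<open>The finite set is chosen inside \<open>S\<close>, so the remainder of an element of
  \<open>S\<close> modulo its span lies in \<open>S\<close> and hence in \<open>A\<close>.\<close>

lemma noeth_over_Int:
  assumes M: "module R M" and A: "submodule A R M" and AB: "noeth_over R M A B" and B: "B \<subseteq> carrier M"
  shows "noeth_over R M A (A \<inter> B)"
  unfolding noeth_over_def
proof (intro allI impI)
  interpret module R M by fact
  fix S assume S: "submodule S R M" "S \<subseteq> A"
  obtain F where F: "finite F" "F \<subseteq> S" "S \<subseteq> mod_span R M F <+>\<^bsub>M\<^esub> B" by (rule noeth_overD[OF AB S])
  have "S \<subseteq> mod_span R M F <+>\<^bsub>M\<^esub> (A \<inter> B)"
  proof
    fix x assume x: "x \<in> S"
    obtain y b where yb: "y \<in> mod_span R M F" "b \<in> B" "x = y \<oplus>\<^bsub>M\<^esub> b"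
      using set_addE[OF subsetD[OF F(3) x]] by blast
    have y: "y \<in> S" using yb mod_span_least[OF S(1) F(2)] by blast
    have "b = x \<ominus>\<^bsub>M\<^esub> y" using yb y submoduleD(1)[OF S(1)] B by (auto simp: module_simprules)
    then have "b \<in> A" using submoduleD(4)[OF S(1) x y] S(2) by blast
    then show "x \<in> mod_span R M F <+>\<^bsub>M\<^esub> (A \<inter> B)" using set_addI[OF yb(1), of b "A \<inter> B" M] yb by simp
  qed
  with F show "\<exists>F. finite F \<and> F \<subseteq> S \<and> S \<subseteq> mod_span R M F <+>\<^bsub>M\<^esub> (A \<inter> B)" by blast
qed

text \<open>Generators of \<open>S\<close> modulo \<open>B\<close> together with generators of
  \<open>S \<inter> B\<close> modulo \<open>C\<close> generate \<open>S\<close> modulo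
  \<open>C\<close>.\<close>

lemma noeth_over_trans:
  assumes M: "module R M" and B: "submodule B R M" and C: "C \<subseteq> carrier M"
    and AB: "noeth_over R M A B" and BC: "noeth_over R M B C"
  shows "noeth_over R M A C"
  unfolding noeth_over_def
proof (intro allI impI)
  interpret module R M by fact
  fix S assume S: "submodule S R M" "S \<subseteq> A"
  note SD = submoduleD[OF S(1)]
  obtain F where F: "finite F" "F \<subseteq> S" "S \<subseteq> mod_span R M F <+>\<^bsub>M\<^esub> B" by (rule noeth_overD[OF AB S])
  obtain G where G: "finite G" "G \<subseteq> S \<inter> B" "S \<inter> B \<subseteq> mod_span R M G <+>\<^bsub>M\<^esub> C"
    by (rule noeth_overD[OF BC submodule_Int[OF S(1) B]]) auto
  have FG: "F \<union> G \<subseteq> carrier M" using F(2) G(2) SD(1) by blast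
  note spD = submoduleD[OF mod_span_submodule[OF M FG]]
  have "S \<subseteq> mod_span R M (F \<union> G) <+>\<^bsub>M\<^esub> C"
  proof
    fix x assume x: "x \<in> S"
    obtain y b where yb: "y \<in> mod_span R M F" "b \<in> B" "x = y \<oplus>\<^bsub>M\<^esub> b"
      using set_addE[OF subsetD[OF F(3) x]] by blast
    have y: "y \<in> S" using yb mod_span_least[OF S(1) F(2)] by blast
    have "b = x \<ominus>\<^bsub>M\<^esub> y" using yb y SD(1) submoduleD(1)[OF B] by (auto simp: module_simprules)
    then have "b \<in> S \<inter> B" using SD(4)[OF x y] yb by blast
    then have "b \<in> mod_span R M G <+>\<^bsub>M\<^esub> C" using G(3) by blast
    then obtain g c where gc: "g \<in> mod_span R M G" "c \<in> C" "b = g \<oplus>\<^bsub>M\<^esub> c" by (rule set_addE)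
    have yg: "y \<in> mod_span R M (F \<union> G)" "g \<in> mod_span R M (F \<union> G)"
      using yb gc mod_span_mono[of F "F \<union> G" R M] mod_span_mono[of G "F \<union> G" R M] by auto
    have "x = (y \<oplus>\<^bsub>M\<^esub> g) \<oplus>\<^bsub>M\<^esub> c" using yb gc spD(1) yg C by (simp add: M.a_assoc subset_iff)
    then show "x \<in> mod_span R M (F \<union> G) <+>\<^bsub>M\<^esub> C" using set_addI[OF spD(3)[OF yg] gc(2), of M] by simp
  qed
  moreover have "finite (F \<union> G)" "F \<union> G \<subseteq> S" using F G by auto
  ultimately show "\<exists>F. finite F \<and> F \<subseteq> S \<and> S \<subseteq> mod_span R M F <+>\<^bsub>M\<^esub> C" by blast
qed

text \<open>The isomorphism \<open>(T + N)/N = T/(T \<inter> N)\<close>. For \<open>S\<close> inside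
  \<open>T + N\<close>, generators are first found for \<open>(S + N) \<inter> T\<close> and then
  moved into \<open>S\<close> by elements of \<open>N\<close>.\<close>

lemma noeth_over_add:
  assumes M: "module R M" and T: "submodule T R M" and N: "submodule N R M" and TN: "noeth_over R M T N"
  shows "noeth_over R M (T <+>\<^bsub>M\<^esub> N) N"
  unfolding noeth_over_def
proof (intro allI impI)
  interpret module R M by fact
  note TD = submoduleD[OF T] and ND = submoduleD[OF N]
  fix S assume S: "submodule S R M" "S \<subseteq> T <+>\<^bsub>M\<^esub> N"
  note SD = submoduleD[OF S(1)]
  have SN: "submodule (S <+>\<^bsub>M\<^esub> N) R M" by (rule submodule_set_add[OF S(1) N])
  obtain F' where F': "finite F'" "F' \<subseteq> (S <+>\<^bsub>M\<^esub> N) \<inter> T" "(S <+>\<^bsub>M\<^esub> N) \<inter> T \<subseteq> mod_span R M F' <+>\<^bsub>M\<^esub> N"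
    by (rule noeth_overD[OF TN submodule_Int[OF SN T]]) auto
  have "\<forall>f\<in>F'. \<exists>s\<in>S. \<exists>n\<in>N. f = s \<oplus>\<^bsub>M\<^esub> n" using F'(2) by (auto simp: set_add_iff)
  then obtain s where s: "\<And>f. f \<in> F' \<Longrightarrow> s f \<in> S \<and> (\<exists>n\<in>N. f = s f \<oplus>\<^bsub>M\<^esub> n)" by metis
  define F where "F = s ` F'"
  have F: "finite F" "F \<subseteq> S" using F'(1) s by (auto simp: F_def)
  have "F \<subseteq> carrier M" using F(2) SD(1) by blast
  then have sub: "submodule (mod_span R M F <+>\<^bsub>M\<^esub> N) R M" by (intro submodule_set_add mod_span_submodule M N)
  note FD = submoduleD[OF sub]
  have "F' \<subseteq> mod_span R M F <+>\<^bsub>M\<^esub> N"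
  proof
    fix f assume f: "f \<in> F'"
    then have "s f \<in> mod_span R M F" using mod_span_superset[of F R M] by (auto simp: F_def)
    then show "f \<in> mod_span R M F <+>\<^bsub>M\<^esub> N" using s[OF f] by (blast intro: set_add_memI)
  qed
  then have "mod_span R M F' \<subseteq> mod_span R M F <+>\<^bsub>M\<^esub> N" by (rule mod_span_least[OF sub])
  moreover have NF: "N \<subseteq> mod_span R M F <+>\<^bsub>M\<^esub> N"
    using \<open>F \<subseteq> carrier M\<close> by (intro set_add_superset mod_span_submodule M N)
  ultimately have le: "mod_span R M F' <+>\<^bsub>M\<^esub> N \<subseteq> mod_span R M F <+>\<^bsub>M\<^esub> N"
    using FD(3) by (blast elim: set_addE)
  have "S \<subseteq> mod_span R M F <+>\<^bsub>M\<^esub> N"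
  proof
    fix x assume x: "x \<in> S"
    obtain t n where tn: "t \<in> T" "n \<in> N" "x = t \<oplus>\<^bsub>M\<^esub> n"
      using set_addE[OF subsetD[OF S(2) x]] by blast
    have "t = x \<oplus>\<^bsub>M\<^esub> \<ominus>\<^bsub>M\<^esub> n" using tn TD(1) ND(1) by (auto simp: module_simprules)
    then have "t \<in> S <+>\<^bsub>M\<^esub> N" using set_addI[OF x ND(5)[OF tn(2)], of M] by simp
    then have "t \<in> mod_span R M F <+>\<^bsub>M\<^esub> N" using F'(3) tn(1) le by blast
    then show "x \<in> mod_span R M F <+>\<^bsub>M\<^esub> N" using FD(3) NF tn by blast
  qed
  with F show "\<exists>F. finite F \<and> F \<subseteq> S \<and> S \<subseteq> mod_span R M F <+>\<^bsub>M\<^esub> N" by blast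
qed

lemma noeth_over_image:
  assumes M: "module R M" and M': "module R M'" and h: "h \<in> mod_hom R M M'"
    and A: "submodule A R M" and B: "B \<subseteq> carrier M" and AB: "noeth_over R M A B"
  shows "noeth_over R M' (h ` A) (h ` B)"
  unfolding noeth_over_def
proof (intro allI impI)
  interpret M: module R M by fact
  interpret M': module R M' by fact
  note hD = mod_homD[OF h]
  fix S assume S: "submodule S R M'" "S \<subseteq> h ` A"
  let ?S = "A \<inter> {x \<in> carrier M. h x \<in> S}"
  have S0: "submodule ?S R M" by (intro M.submodule_Int A vimage_submodule[OF M M' h S(1)])
  obtain F where F: "finite F" "F \<subseteq> ?S" "?S \<subseteq> mod_span R M F <+>\<^bsub>M\<^esub> B"
    by (rule noeth_overD[OF AB S0]) auto
  have FM: "F \<subseteq> carrier M" "h ` F \<subseteq> carrier M'" using F(2) hD(1) by auto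
  have "mod_span R M F \<subseteq> {x \<in> carrier M. h x \<in> mod_span R M' (h ` F)}"
    using FM mod_span_superset[of "h ` F" R M']
    by (intro mod_span_least vimage_submodule[OF M M' h] mod_span_submodule M') auto
  then have sp: "\<And>x. x \<in> mod_span R M F \<Longrightarrow> x \<in> carrier M \<and> h x \<in> mod_span R M' (h ` F)" by blast
  have "S \<subseteq> mod_span R M' (h ` F) <+>\<^bsub>M'\<^esub> h ` B"
  proof
    fix z assume z: "z \<in> S"
    then obtain x where x: "x \<in> A" "z = h x" using S(2) by blast
    then have "x \<in> ?S" using z M.submoduleD(1)[OF A] by auto
    then have "x \<in> mod_span R M F <+>\<^bsub>M\<^esub> B" using F(3) by blast
    then obtain y b where yb: "y \<in> mod_span R M F" "b \<in> B" "x = y \<oplus>\<^bsub>M\<^esub> b" by (rule set_addE)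
    then have "z = h y \<oplus>\<^bsub>M'\<^esub> h b" using x hD(2) sp B by auto
    then show "z \<in> mod_span R M' (h ` F) <+>\<^bsub>M'\<^esub> h ` B"
      using set_addI[of "h y" _ "h b" "h ` B" M'] sp[OF yb(1)] yb(2) by simp
  qed
  moreover have "finite (h ` F)" "h ` F \<subseteq> S" using F by auto
  ultimately show "\<exists>F. finite F \<and> F \<subseteq> S \<and> S \<subseteq> mod_span R M' F <+>\<^bsub>M'\<^esub> h ` B" by blast
qed

text \<open>The hypotheses say that \<open>h\<close> induces an embedding of \<open>T\<close> modulo
  \<open>N\<close> into \<open>A'\<close> modulo \<open>B'\<close>. Generators of
  \<open>h(S)\<close> are lifted to \<open>S\<close>, and what remains of an element of
  \<open>S\<close> is mapped into \<open>B'\<close>.\<close>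

lemma noeth_over_vimage:
  assumes M: "module R M" and M': "module R M'" and h: "h \<in> mod_hom R M M'"
    and AB: "noeth_over R M' A' B'" and T: "\<And>x. x \<in> T \<Longrightarrow> h x \<in> A'"
    and N: "\<And>x. x \<in> T \<Longrightarrow> h x \<in> B' \<Longrightarrow> x \<in> N" and B': "B' \<subseteq> carrier M'"
  shows "noeth_over R M T N"
  unfolding noeth_over_def
proof (intro allI impI)
  interpret M: module R M by fact
  interpret M': module R M' by fact
  note hD = mod_homD[OF h]
  fix S assume S: "submodule S R M" "S \<subseteq> T"
  note SD = M.submoduleD[OF S(1)]
  obtain F' where F': "finite F'" "F' \<subseteq> h ` S" "h ` S \<subseteq> mod_span R M' F' <+>\<^bsub>M'\<^esub> B'"
    by (rule noeth_overD[OF AB image_submodule[OF M M' h S(1)]]) (use S T in auto)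
  obtain F where F: "finite F" "F \<subseteq> S" "F' = h ` F" using finite_subset_image[OF F'(1,2)] by blast
  have FM: "F \<subseteq> carrier M" using F(2) SD(1) by blast
  have "mod_span R M' F' \<subseteq> h ` mod_span R M F"
    using mod_span_superset[of F R M] F(3)
    by (intro mod_span_least image_submodule[OF M M' h] mod_span_submodule M FM) auto
  then have sp: "\<And>y'. y' \<in> mod_span R M' F' \<Longrightarrow> \<exists>y\<in>mod_span R M F. y' = h y" by blast
  have "S \<subseteq> mod_span R M F <+>\<^bsub>M\<^esub> N"
  proof
    fix x assume x: "x \<in> S"
    then have "h x \<in> mod_span R M' F' <+>\<^bsub>M'\<^esub> B'" using F'(3) by blast
    then obtain y' b' where yb': "y' \<in> mod_span R M' F'" "b' \<in> B'" "h x = y' \<oplus>\<^bsub>M'\<^esub> b'" by (rule set_addE)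
    then obtain y where y: "y \<in> mod_span R M F" "y' = h y" using sp by blast
    have yS: "y \<in> S" using y(1) mod_span_least[OF S(1) F(2)] by blast
    note cl = SD(1)[OF x] SD(1)[OF yS]
    have "h (x \<ominus>\<^bsub>M\<^esub> y) = h x \<ominus>\<^bsub>M'\<^esub> h y" using cl by (intro mod_hom_zero_minus(3)[OF M M' h])
    also have "\<dots> = b'" using yb' y cl hD(1) B' by (auto simp: M'.module_simprules)
    finally have "x \<ominus>\<^bsub>M\<^esub> y \<in> N" using N[of "x \<ominus>\<^bsub>M\<^esub> y"] SD(4)[OF x yS] S(2) yb'(2) by auto
    moreover have "x = y \<oplus>\<^bsub>M\<^esub> (x \<ominus>\<^bsub>M\<^esub> y)" using cl by (simp add: M.module_simprules)
    ultimately show "x \<in> mod_span R M F <+>\<^bsub>M\<^esub> N" by (rule set_add_memI[OF y(1)])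
  qed
  with F show "\<exists>F. finite F \<and> F \<subseteq> S \<and> S \<subseteq> mod_span R M F <+>\<^bsub>M\<^esub> N" by blast
qed

lemma (in cring) ideal_iff_submodule: "ideal L R \<longleftrightarrow> submodule L R (ring_as_module R)"
proof
  interpret R: module R "ring_as_module R" by (rule module_ring_as_module)
  show "ideal L R \<Longrightarrow> submodule L R (ring_as_module R)"
    using idealD[of L] by (intro R.submoduleI_closed) auto
  show "submodule L R (ring_as_module R) \<Longrightarrow> ideal L R"
    using R.submoduleD[of L] by (intro idealI_closed) auto
qed

lemma (in noetherian_ring) noeth_over_ring:
  assumes "cring R"
  shows "noeth_over R (ring_as_module R) (carrier R) {\<zero>}"
  unfolding noeth_over_def
proof (intro allI impI)
  interpret cring R by fact
  interpret R: module R "ring_as_module R" by (rule module_ring_as_module)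
  fix S assume "submodule S R (ring_as_module R)"
  then have S: "ideal S R" by (simp add: ideal_iff_submodule)
  then obtain F where F: "F \<subseteq> carrier R" "finite F" "S = Idl F" using finetely_gen by blast
  have sub: "submodule (mod_span R (ring_as_module R) F) R (ring_as_module R)"
    using F(1) by (intro mod_span_submodule module_ring_as_module) simp
  then have "S \<subseteq> mod_span R (ring_as_module R) F"
    unfolding F(3) by (intro genideal_minimal mod_span_superset) (simp add: ideal_iff_submodule)
  also have "\<dots> \<subseteq> mod_span R (ring_as_module R) F <+>\<^bsub>ring_as_module R\<^esub> {\<zero>}"
    using R.set_add_superset(1)[OF sub R.zero_submodule] by simp
  finally show "\<exists>F. finite F \<and> F \<subseteq> S \<and> S \<subseteq> mod_span R (ring_as_module R) F <+>\<^bsub>ring_as_module R\<^esub> {\<zero>}"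
    using F genideal_self by metis
qed

lemma noeth_over_fin_gen:
  assumes R: "noetherian_ring R" and fg: "fin_gen_module R M"
  shows "noeth_over R M (carrier M) {\<zero>\<^bsub>M\<^esub>}"
proof -
  have M: "module R M" using fg by (simp add: fin_gen_module_def)
  interpret noetherian_ring R by fact
  interpret M: module R M by fact
  interpret R: module R "ring_as_module R" by (rule M.R.module_ring_as_module)
  obtain S where S: "finite S" "S \<subseteq> carrier M" "mod_span R M S = carrier M"
    using fg by (auto simp: fin_gen_module_def)
  from S(1,2) have "noeth_over R M (mod_span R M S) {\<zero>\<^bsub>M\<^esub>}"
  proof (induction S)
    case empty
    show ?case by (intro noeth_over_subset M M.zero_submodule mod_span_least) simp
  next
    case (insert x S)
    then have x: "x \<in> carrier M" "S \<subseteq> carrier M" by auto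
    let ?h = "\<lambda>r\<in>carrier (ring_as_module R). r \<odot>\<^bsub>M\<^esub> x"
    let ?X = "?h ` carrier R" and ?N = "mod_span R M S"
    have N: "submodule ?N R M" using x by (intro mod_span_submodule M) auto
    have h: "?h \<in> mod_hom R (ring_as_module R) M" using x by (intro orbit_hom M)
    have X: "submodule ?X R M"
      using image_submodule[OF R.module_axioms M h R.carrier_is_submodule] by simp
    have "noeth_over R M ?X (?h ` {\<zero>\<^bsub>R\<^esub>})"
    proof -
      have "noeth_over R M (?h ` carrier (ring_as_module R)) (?h ` {\<zero>\<^bsub>R\<^esub>})"
        by (rule noeth_over_image[OF R.module_axioms M h R.carrier_is_submodule])
          (use noeth_over_ring[OF M.R.is_cring] in auto)
      then show ?thesis by simp
    qed
    then have "noeth_over R M ?X ?N"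
      by (rule noeth_over_mono) (use M.submoduleD(2)[OF N] x in auto)
    then have "noeth_over R M (?X <+>\<^bsub>M\<^esub> ?N) ?N" by (rule noeth_over_add[OF M X N])
    moreover have "mod_span R M (insert x S) \<subseteq> ?X <+>\<^bsub>M\<^esub> ?N"
    proof (rule mod_span_least[OF M.submodule_set_add[OF X N]])
      have "x \<in> ?X" using x by (intro image_eqI[of _ _ "\<one>\<^bsub>R\<^esub>"]) auto
      then show "insert x S \<subseteq> ?X <+>\<^bsub>M\<^esub> ?N"
        using M.set_add_superset[OF X N] mod_span_superset[of S R M] by blast
    qed
    ultimately have "noeth_over R M (mod_span R M (insert x S)) ?N" by (blast intro: noeth_over_mono)
    then show ?case by (intro noeth_over_trans[OF M N _ _ insert.IH]) (use x in auto)
  qed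
  then show ?thesis using S(3) by simp
qed

subsection \<open>Finiteness of Ext modules\<close>

text \<open>The assignment \<open>k + \<phi> l \<mapsto> l u\<close> on \<open>c + \<phi>(L)\<close>
  is well defined by \<open>ker\<close> and extends to \<open>R\<close>; \<open>y\<close> is the
  image of one. With \<open>\<phi>\<close> multiplication by \<open>x\<close> this divides
  \<open>u\<close> by \<open>x\<close> inside \<open>(0 : c)\<close>; with \<open>\<phi>\<close> the
  identity it replaces \<open>u\<close> by an element that acts alike on \<open>L\<close> and is
  killed by \<open>c\<close>.\<close>

lemma injective_adjoin_extend:
  assumes Q: "injective_module R Q" and R: "cring R" and c: "ideal c R" and L: "ideal L R" and u: "u \<in> carrier Q"
    and \<phi>: "\<And>l. l \<in> L \<Longrightarrow> \<phi> l \<in> carrier R" "\<And>l l'. l \<in> L \<Longrightarrow> l' \<in> L \<Longrightarrow> \<phi> (l \<oplus>\<^bsub>R\<^esub> l') = \<phi> l \<oplus>\<^bsub>R\<^esub> \<phi> l'"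
      "\<And>r l. r \<in> carrier R \<Longrightarrow> l \<in> L \<Longrightarrow> \<phi> (r \<otimes>\<^bsub>R\<^esub> l) = r \<otimes>\<^bsub>R\<^esub> \<phi> l"
    and ker: "\<And>l. l \<in> L \<Longrightarrow> \<phi> l \<in> c \<Longrightarrow> l \<odot>\<^bsub>Q\<^esub> u = \<zero>\<^bsub>Q\<^esub>"
  obtains y where "y \<in> carrier Q" "y \<in> ann_in Q c" "\<And>l. l \<in> L \<Longrightarrow> \<phi> l \<odot>\<^bsub>Q\<^esub> y = l \<odot>\<^bsub>Q\<^esub> u"
proof -
  interpret Q: module R Q using Q unfolding injective_module_def by blast
  note cD = Q.R.idealD[OF c] and LD = Q.R.idealD[OF L]
  let ?G = "{(k \<oplus>\<^bsub>R\<^esub> \<phi> l, l \<odot>\<^bsub>Q\<^esub> u) | k l. k \<in> c \<and> l \<in> L}"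
  have GI: "(k \<oplus>\<^bsub>R\<^esub> \<phi> l, l \<odot>\<^bsub>Q\<^esub> u) \<in> ?G" if "k \<in> c" "l \<in> L" for k l using that by blast
  have "\<phi> (\<zero>\<^bsub>R\<^esub> \<otimes>\<^bsub>R\<^esub> \<zero>\<^bsub>R\<^esub>) = \<zero>\<^bsub>R\<^esub>"
    using \<phi>(1)[OF LD(2)] \<phi>(3)[OF Q.R.zero_closed LD(2)] by simp
  then have \<phi>0: "\<phi> \<zero>\<^bsub>R\<^esub> = \<zero>\<^bsub>R\<^esub>" by simp
  obtain h where h: "h \<in> mod_hom R (ring_as_module R) Q" and hG: "\<And>x y. (x, y) \<in> ?G \<Longrightarrow> h x = y"
  proof (rule injective_extend_rel[OF Q Q.R.module_ring_as_module, of ?G])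
    show "?G \<subseteq> carrier (ring_as_module R) \<times> carrier Q"
      using cD(1) LD(1) \<phi>(1) u by auto
    show "(\<zero>\<^bsub>ring_as_module R\<^esub>, \<zero>\<^bsub>Q\<^esub>) \<in> ?G"
      using GI[OF cD(2) LD(2)] \<phi>0 u by simp
  next
    fix x y x' y' assume "(x, y) \<in> ?G" "(x', y') \<in> ?G"
    then obtain k l k' l' where *: "x = k \<oplus>\<^bsub>R\<^esub> \<phi> l" "y = l \<odot>\<^bsub>Q\<^esub> u" "k \<in> c" "l \<in> L"
      "x' = k' \<oplus>\<^bsub>R\<^esub> \<phi> l'" "y' = l' \<odot>\<^bsub>Q\<^esub> u" "k' \<in> c" "l' \<in> L" by blast
    have "x \<oplus>\<^bsub>R\<^esub> x' = (k \<oplus>\<^bsub>R\<^esub> k') \<oplus>\<^bsub>R\<^esub> \<phi> (l \<oplus>\<^bsub>R\<^esub> l')" "y \<oplus>\<^bsub>Q\<^esub> y' = (l \<oplus>\<^bsub>R\<^esub> l') \<odot>\<^bsub>Q\<^esub> u"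
      using * \<phi> cD(1) LD(1) u by (simp_all add: Q.R.a_ac Q.M.a_ac Q.smult_l_distr)
    then show "(x \<oplus>\<^bsub>ring_as_module R\<^esub> x', y \<oplus>\<^bsub>Q\<^esub> y') \<in> ?G"
      using GI[OF cD(3)[OF *(3,7)] LD(3)[OF *(4,8)]] by simp
  next
    fix r x y assume r: "r \<in> carrier R" and "(x, y) \<in> ?G"
    then obtain k l where *: "x = k \<oplus>\<^bsub>R\<^esub> \<phi> l" "y = l \<odot>\<^bsub>Q\<^esub> u" "k \<in> c" "l \<in> L" by blast
    have "r \<otimes>\<^bsub>R\<^esub> x = (r \<otimes>\<^bsub>R\<^esub> k) \<oplus>\<^bsub>R\<^esub> \<phi> (r \<otimes>\<^bsub>R\<^esub> l)" "r \<odot>\<^bsub>Q\<^esub> y = (r \<otimes>\<^bsub>R\<^esub> l) \<odot>\<^bsub>Q\<^esub> u"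
      using * \<phi> cD(1) LD(1) u r by (simp_all add: Q.R.r_distr Q.smult_assoc1)
    then show "(r \<odot>\<^bsub>ring_as_module R\<^esub> x, r \<odot>\<^bsub>Q\<^esub> y) \<in> ?G"
      using GI[OF cD(5)[OF r *(3)] LD(5)[OF r *(4)]] by simp
  next
    fix y assume "(\<zero>\<^bsub>ring_as_module R\<^esub>, y) \<in> ?G"
    then obtain k l where *: "\<zero>\<^bsub>R\<^esub> = k \<oplus>\<^bsub>R\<^esub> \<phi> l" "y = l \<odot>\<^bsub>Q\<^esub> u" "k \<in> c" "l \<in> L" by auto
    then have "\<phi> l = \<zero>\<^bsub>R\<^esub> \<ominus>\<^bsub>R\<^esub> k"
      using cD(1) \<phi>(1) by (metis Q.R.add.inv_equality Q.R.a_comm Q.R.minus_eq Q.R.l_zero Q.R.a_inv_closed)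
    then have "\<phi> l \<in> c" using cD(4)[OF cD(2) *(3)] by simp
    then show "y = \<zero>\<^bsub>Q\<^esub>" using ker * by simp
  qed blast
  note hD = mod_homD[OF h, simplified]
  have 1: "l \<odot>\<^bsub>Q\<^esub> h \<one>\<^bsub>R\<^esub> = h l" if "l \<in> carrier R" for l
    using hD(3)[OF that Q.R.one_closed] that by simp
  show ?thesis
  proof (rule that[of "h \<one>\<^bsub>R\<^esub>"])
    show y: "h \<one>\<^bsub>R\<^esub> \<in> carrier Q" using hD(1) by simp
    have "h k = \<zero>\<^bsub>Q\<^esub>" if "k \<in> c" for k
      using hG[OF GI[OF that LD(2)]] \<phi>0 cD(1)[OF that] u by simp
    then show "h \<one>\<^bsub>R\<^esub> \<in> ann_in Q c" using y 1 cD(1) by (auto simp: ann_in_def)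
    show "\<phi> l \<odot>\<^bsub>Q\<^esub> h \<one>\<^bsub>R\<^esub> = l \<odot>\<^bsub>Q\<^esub> u" if "l \<in> L" for l
      using hG[OF GI[OF cD(2) that]] 1 \<phi>(1)[OF that] by simp
  qed
qed

locale fin_gen_resolution =
  fixes R :: "('a, 'm) ring_scheme" and M :: "('a, 'b) module"
    and Q :: "nat \<Rightarrow> ('a, 'q) module" and \<epsilon> :: "'b \<Rightarrow> 'q" and d :: "nat \<Rightarrow> 'q \<Rightarrow> 'q"
  assumes R_cring: "cring R" and R_noeth: "noetherian_ring R"
    and fin_gen: "fin_gen_module R M" and resolution: "injective_resolution R M Q \<epsilon> d"
begin

sublocale R: noetherian_ring R by (rule R_noeth)
sublocale R: cring R by (rule R_cring)

lemma injective: "injective_module R (Q i)"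
  using resolution by (simp add: injective_resolution_def)

sublocale Q: module R "Q i" for i
  using injective[of i] by (simp add: injective_module_def)

lemmas Q_module = Q.module_axioms

lemma M_module: "module R M"
  using fin_gen by (simp add: fin_gen_module_def)

lemma d_hom: "d i \<in> mod_hom R (Q i) (Q (Suc i))"
  using resolution by (simp add: injective_resolution_def)

lemmas dD = mod_homD[OF d_hom]

lemmas d_zero_minus = mod_hom_zero_minus[OF Q_module Q_module d_hom]

lemma d_image: "d i ` carrier (Q i) = {x \<in> carrier (Q (Suc i)). d (Suc i) x = \<zero>\<^bsub>Q (Suc (Suc i))\<^esub>}"
  using resolution by (simp add: injective_resolution_def)

lemma d_d: "x \<in> carrier (Q i) \<Longrightarrow> d (Suc i) (d i x) = \<zero>\<^bsub>Q (Suc (Suc i))\<^esub>"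
  using d_image[of i] by blast

text \<open>The coboundaries of the deleted resolution: in degree zero they vanish, and the image of
  \<open>\<epsilon>\<close> does not count.\<close>

definition bound :: "nat \<Rightarrow> 'q set"
  where "bound i = (case i of 0 \<Rightarrow> {\<zero>\<^bsub>Q 0\<^esub>} | Suc j \<Rightarrow> d j ` carrier (Q j))"

lemma bound_submodule: "submodule (bound i) R (Q i)"
  unfolding bound_def
  by (cases i) (auto intro: Q.zero_submodule image_submodule[OF Q_module Q_module d_hom Q.carrier_is_submodule])

lemma d_bound: "x \<in> bound i \<Longrightarrow> d i x = \<zero>\<^bsub>Q (Suc i)\<^esub>"
  unfolding bound_def by (cases i) (auto simp: d_zero_minus d_d)

text \<open>With \<open>Ext\<close> computed from the resolution: \<open>hom_cocycles i b\<close> modulo \<open>hom_bound i b\<close> is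
  \<open>Ext\<^sup>i(R/b, M)\<close>, and \<open>ideal_cocycles i b\<close> modulo \<open>ideal_bound i b\<close> is \<open>Ext\<^sup>i(b, M)\<close>; in the
  latter, \<open>q\<close> stands for the map \<open>l \<mapsto> l q\<close> on \<open>b\<close>.\<close>

definition hom_cocycles :: "nat \<Rightarrow> 'a set \<Rightarrow> 'q set"
  where "hom_cocycles i b = ann_in (Q i) b \<inter> {q \<in> carrier (Q i). d i q = \<zero>\<^bsub>Q (Suc i)\<^esub>}"

definition hom_bound :: "nat \<Rightarrow> 'a set \<Rightarrow> 'q set"
  where "hom_bound i b = (case i of 0 \<Rightarrow> {\<zero>\<^bsub>Q 0\<^esub>} | Suc j \<Rightarrow> d j ` ann_in (Q j) b)"

definition ideal_cocycles :: "nat \<Rightarrow> 'a set \<Rightarrow> 'q set"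
  where "ideal_cocycles i b = {q \<in> carrier (Q i). d i q \<in> ann_in (Q (Suc i)) b}"

definition ideal_bound :: "nat \<Rightarrow> 'a set \<Rightarrow> 'q set"
  where "ideal_bound i b = bound i <+>\<^bsub>Q i\<^esub> ann_in (Q i) b"

lemma ideal_subset: "ideal b R \<Longrightarrow> b \<subseteq> carrier R"
  using R.idealD(1) by blast

lemma ann_submodule: "ideal b R \<Longrightarrow> submodule (ann_in (Q i) b) R (Q i)"
  by (intro submodule_ann_in Q_module ideal_subset)

lemma hom_cocycles_submodule: "ideal b R \<Longrightarrow> submodule (hom_cocycles i b) R (Q i)"
  unfolding hom_cocycles_def
  by (intro Q.submodule_Int ann_submodule kernel_submodule Q_module d_hom)

lemma ideal_cocycles_submodule: "ideal b R \<Longrightarrow> submodule (ideal_cocycles i b) R (Q i)"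
  unfolding ideal_cocycles_def by (intro vimage_submodule[OF Q_module Q_module d_hom] ann_submodule)

lemma ideal_bound_submodule: "ideal b R \<Longrightarrow> submodule (ideal_bound i b) R (Q i)"
  unfolding ideal_bound_def by (intro Q.submodule_set_add bound_submodule ann_submodule)

lemma hom_bound_subset: "hom_bound i b \<subseteq> carrier (Q i)"
  unfolding hom_bound_def by (cases i) (auto simp: ann_in_def dD)

lemma adjoin_annI:
  assumes c: "ideal c R" and x: "x \<in> carrier R" and q: "q \<in> ann_in (Q i) c" "x \<odot>\<^bsub>Q i\<^esub> q = \<zero>\<^bsub>Q i\<^esub>"
  shows "q \<in> ann_in (Q i) (adjoin R c x)"
  using q x R.idealD(1)[OF c]
  by (auto simp: ann_in_def adjoin_def Q.smult_l_distr Q.smult_assoc1)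

text \<open>As \<open>(c + Rx) / c\<close> is isomorphic to \<open>R / (c : x)\<close>, the kernel of the restriction map
  \<open>Ext\<^sup>i(c + Rx, M) \<rightarrow> Ext\<^sup>i(c, M)\<close> is a quotient of \<open>Ext\<^sup>i(R / (c : x), M)\<close>.\<close>

lemma noeth_ideal_step:
  assumes A: "\<And>b. ideal b R \<Longrightarrow> noeth_over R (Q i) (hom_cocycles i b) (hom_bound i b)"
    and c: "ideal c R" and x: "x \<in> carrier R"
    and P: "noeth_over R (Q i) (ideal_cocycles i c) (ideal_bound i c)"
  shows "noeth_over R (Q i) (ideal_cocycles i (adjoin R c x)) (ideal_bound i (adjoin R c x))"
proof -
  let ?c' = "adjoin R c x" and ?e = "{r \<in> carrier R. r \<otimes>\<^bsub>R\<^esub> x \<in> c}"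
  have c': "ideal ?c' R" and cc': "c \<subseteq> ?c'" "x \<in> ?c'"
    using R.adjoin_ideal[OF c x] R.adjoin_superset[OF c x] by auto
  have e: "ideal ?e R" by (rule R.ideal_colon_ideal[OF c x])
  \<comment> \<open>These elements represent the cocycles on \<open>c + Rx\<close> that vanish on
    \<open>c\<close>. Up to \<open>ideal_bound i ?c'\<close> they exhaust the kernel of the
    restriction to \<open>c\<close>: a class that becomes trivial there can be changed by a
    coboundary so as to vanish on \<open>c\<close>.\<close>
  let ?T = "ann_in (Q i) c \<inter> {q \<in> carrier (Q i). d i q \<in> ann_in (Q (Suc i)) {x}}"
  have T: "submodule ?T R (Q i)"
    using x by (intro Q.submodule_Int ann_submodule c vimage_submodule[OF Q_module Q_module d_hom] submodule_ann_in Q_module) auto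
  have boundQ: "y \<in> carrier (Q i)" if "y \<in> bound i" for y
    using that by (rule Q.submoduleD(1)[OF bound_submodule])
  have le: "ideal_cocycles i ?c' \<inter> ideal_bound i c \<subseteq> ?T <+>\<^bsub>Q i\<^esub> ideal_bound i ?c'"
  proof
    fix q assume "q \<in> ideal_cocycles i ?c' \<inter> ideal_bound i c"
    then obtain w a where w: "w \<in> bound i" and a: "a \<in> ann_in (Q i) c" and q: "q = w \<oplus>\<^bsub>Q i\<^esub> a"
      and dq: "d i q \<in> ann_in (Q (Suc i)) ?c'"
      unfolding ideal_cocycles_def ideal_bound_def by (blast elim: set_addE)
    have cl: "w \<in> carrier (Q i)" "a \<in> carrier (Q i)" using boundQ w a by (auto simp: ann_in_def)
    then have "d i a = d i q" using q d_bound[OF w] by (simp add: dD)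
    then have "a \<in> ?T" using a cl dq cc' by (auto simp: ann_in_def)
    moreover have "w \<in> ideal_bound i ?c'"
      unfolding ideal_bound_def using Q.set_add_superset(1)[OF bound_submodule ann_submodule[OF c']] w by blast
    moreover have "q = a \<oplus>\<^bsub>Q i\<^esub> w" using q cl by (simp add: Q.M.a_comm)
    ultimately show "q \<in> ?T <+>\<^bsub>Q i\<^esub> ideal_bound i ?c'" by (rule set_add_memI)
  qed
  \<comment> \<open>A map on \<open>c + Rx\<close> that vanishes on \<open>c\<close> is determined
    by its value at \<open>x\<close>, which is killed by \<open>(c : x)\<close>. So multiplication
    by \<open>x\<close> carries \<open>?T\<close> into \<open>hom_cocycles i ?e\<close>, where the
    finiteness hypothesis \<open>A\<close> applies.\<close>
  let ?h = "\<lambda>q\<in>carrier (Q i). x \<odot>\<^bsub>Q i\<^esub> q"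
  have h: "?h \<in> mod_hom R (Q i) (Q i)" by (rule smult_hom[OF Q_module x])
  have "noeth_over R (Q i) ?T (ideal_bound i ?c')"
  proof (rule noeth_over_vimage[OF Q_module Q_module h A[OF e] _ _ hom_bound_subset])
    fix q assume q: "q \<in> ?T"
    then have qQ: "q \<in> carrier (Q i)" by simp
    have "l \<odot>\<^bsub>Q i\<^esub> (x \<odot>\<^bsub>Q i\<^esub> q) = \<zero>\<^bsub>Q i\<^esub>" if "l \<in> ?e" for l
      using q that x Q.smult_assoc1[of l x q i] by (auto simp: ann_in_def)
    then show "?h q \<in> hom_cocycles i ?e"
      using q qQ x by (auto simp: hom_cocycles_def ann_in_def dD)
    assume hq: "?h q \<in> hom_bound i ?e"
    show "q \<in> ideal_bound i ?c'"
    proof (cases i)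
      case 0
      then have "x \<odot>\<^bsub>Q i\<^esub> q = \<zero>\<^bsub>Q i\<^esub>" using hq qQ by (simp add: hom_bound_def)
      then have "q \<in> ann_in (Q i) ?c'" using q by (intro adjoin_annI c x) auto
      then show ?thesis
        unfolding ideal_bound_def using Q.set_add_superset(2)[OF bound_submodule ann_submodule[OF c']] by blast
    next
      case (Suc j)
      then obtain u where u: "u \<in> ann_in (Q j) ?e" "x \<odot>\<^bsub>Q i\<^esub> q = d j u"
        using hq qQ by (auto simp: hom_bound_def)
      have uQ: "u \<in> carrier (Q j)" using u by (simp add: ann_in_def)
      \<comment> \<open>Here \<open>x q = d u\<close> with \<open>u\<close> killed by
        \<open>(c : x)\<close>. Injectivity gives \<open>y\<close> in \<open>(0 : c)\<close> with
        \<open>x y = u\<close>. Then \<open>q - d y\<close> is killed by \<open>c\<close> and by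
        \<open>x\<close>, and \<open>d y\<close> is a coboundary, so \<open>q\<close> is trivial in
        \<open>Ext\<close> of \<open>c + Rx\<close>.\<close>
      obtain y where y: "y \<in> carrier (Q j)" "y \<in> ann_in (Q j) c"
        and xy: "\<And>l. l \<in> carrier R \<Longrightarrow> (l \<otimes>\<^bsub>R\<^esub> x) \<odot>\<^bsub>Q j\<^esub> y = l \<odot>\<^bsub>Q j\<^esub> u"
        by (rule injective_adjoin_extend[OF injective R_cring c R.oneideal uQ, of "\<lambda>l. l \<otimes>\<^bsub>R\<^esub> x"])
          (use x u in \<open>auto simp: R.l_distr R.m_assoc ann_in_def\<close>)
      have xy1: "x \<odot>\<^bsub>Q j\<^esub> y = u" using xy[OF R.one_closed] x uQ by simp
      have dy: "d j y \<in> carrier (Q i)" using dD(1)[OF y(1)] Suc by simp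
      have dyc: "d j y \<in> ann_in (Q i) c"
      proof -
        have "l \<odot>\<^bsub>Q i\<^esub> d j y = \<zero>\<^bsub>Q i\<^esub>" if l: "l \<in> c" for l
          using dD(3)[OF R.idealD(1)[OF c l] y(1)] y(2) l Suc d_zero_minus(1)[of j] by (simp add: ann_in_def)
        then show ?thesis using dy by (simp add: ann_in_def)
      qed
      let ?z = "q \<ominus>\<^bsub>Q i\<^esub> d j y"
      have "?z \<in> ann_in (Q i) c"
        using q dyc by (intro Q.submoduleD(4)[OF ann_submodule[OF c]]) auto
      moreover have "x \<odot>\<^bsub>Q i\<^esub> ?z = \<zero>\<^bsub>Q i\<^esub>"
      proof -
        have "x \<odot>\<^bsub>Q i\<^esub> ?z = x \<odot>\<^bsub>Q i\<^esub> q \<ominus>\<^bsub>Q i\<^esub> x \<odot>\<^bsub>Q i\<^esub> d j y"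
          using x qQ dy by (simp add: Q.module_simprules)
        also have "x \<odot>\<^bsub>Q i\<^esub> d j y = d j u" using dD(3)[OF x y(1)] xy1 Suc by simp
        finally show ?thesis using u(2) dD(1)[OF uQ] Suc by (simp add: Q.diff_zero_iff)
      qed
      ultimately have z: "?z \<in> ann_in (Q i) ?c'" by (rule adjoin_annI[OF c x])
      have "d j y \<in> bound i" using y(1) Suc by (simp add: bound_def)
      moreover have "q = d j y \<oplus>\<^bsub>Q i\<^esub> ?z" using qQ dy by (simp add: Q.module_simprules)
      ultimately show ?thesis unfolding ideal_bound_def by (intro set_add_memI[OF _ z])
    qed
  qed
  then have "noeth_over R (Q i) (?T <+>\<^bsub>Q i\<^esub> ideal_bound i ?c') (ideal_bound i ?c')"
    by (rule noeth_over_add[OF Q_module T ideal_bound_submodule[OF c']])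
  then have 2: "noeth_over R (Q i) (ideal_cocycles i ?c' \<inter> ideal_bound i c) (ideal_bound i ?c')"
    by (rule noeth_over_mono[OF _ le order_refl])
  \<comment> \<open>The kernel of restriction is settled; its image is a submodule of
    \<open>Ext\<close> of \<open>c\<close> and is finite by \<open>P\<close>.\<close>
  have "ideal_cocycles i ?c' \<subseteq> ideal_cocycles i c"
    using cc' by (auto simp: ideal_cocycles_def ann_in_def)
  with P have "noeth_over R (Q i) (ideal_cocycles i ?c') (ideal_bound i c)"
    by (rule noeth_over_mono) simp
  then have 1: "noeth_over R (Q i) (ideal_cocycles i ?c') (ideal_cocycles i ?c' \<inter> ideal_bound i c)"
    by (rule noeth_over_Int[OF Q_module ideal_cocycles_submodule[OF c']])
      (use Q.submoduleD(1)[OF ideal_bound_submodule[OF c]] in blast)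
  show ?thesis
    by (rule noeth_over_trans[OF Q_module _ _ 1 2])
      (use Q.submoduleD(1)[OF ideal_bound_submodule[OF c']] c c' in
        \<open>auto intro: Q.submodule_Int ideal_cocycles_submodule ideal_bound_submodule\<close>)
qed

text \<open>The ideal is built up one generator at a time. The start is \<open>Ext\<close> of the
  zero ideal, which vanishes because the zero ideal annihilates all of \<open>Q i\<close>.\<close>

lemma noeth_ideal:
  assumes A: "\<And>b. ideal b R \<Longrightarrow> noeth_over R (Q i) (hom_cocycles i b) (hom_bound i b)" and b: "ideal b R"
  shows "noeth_over R (Q i) (ideal_cocycles i b) (ideal_bound i b)"
proof (rule R.ideal_adjoin_induct[OF R_cring b])
  have "carrier (Q i) \<subseteq> ann_in (Q i) {\<zero>\<^bsub>R\<^esub>}" by (auto simp: ann_in_def)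
  also have "\<dots> \<subseteq> ideal_bound i {\<zero>\<^bsub>R\<^esub>}"
    unfolding ideal_bound_def by (rule Q.set_add_superset(2)[OF bound_submodule ann_submodule[OF R.zeroideal]])
  finally have "ideal_cocycles i {\<zero>\<^bsub>R\<^esub>} \<subseteq> ideal_bound i {\<zero>\<^bsub>R\<^esub>}" by (auto simp: ideal_cocycles_def)
  then show "noeth_over R (Q i) (ideal_cocycles i {\<zero>\<^bsub>R\<^esub>}) (ideal_bound i {\<zero>\<^bsub>R\<^esub>})"
    by (rule noeth_over_subset[OF Q_module ideal_bound_submodule[OF R.zeroideal]])
next
  fix c x assume "ideal c R" "x \<in> b" "noeth_over R (Q i) (ideal_cocycles i c) (ideal_bound i c)"
  then show "noeth_over R (Q i) (ideal_cocycles i (adjoin R c x)) (ideal_bound i (adjoin R c x))"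
    using R.idealD(1)[OF b] by (intro noeth_ideal_step A)
qed

text \<open>Dimension shifting: since \<open>Q\<close> is exact in degree \<open>i + 1\<close>,
  every cocycle there that is killed by \<open>b\<close> is \<open>d i q\<close> for some
  \<open>q\<close>, and this \<open>q\<close> is a cocycle on \<open>b\<close>. So
  \<open>Ext\<close> of \<open>R/b\<close> in degree \<open>i + 1\<close> is a quotient of
  \<open>Ext\<close> of \<open>b\<close> in degree \<open>i\<close>. In degree zero it is a
  submodule of \<open>M\<close>.\<close>

lemma noeth_hom:
  assumes "ideal b R"
  shows "noeth_over R (Q i) (hom_cocycles i b) (hom_bound i b)"
  using assms
proof (induction i arbitrary: b)
  case 0
  have \<epsilon>: "\<epsilon> \<in> mod_hom R M (Q 0)" "\<epsilon> ` carrier M = {x \<in> carrier (Q 0). d 0 x = \<zero>\<^bsub>Q (Suc 0)\<^esub>}"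
    using resolution by (auto simp: injective_resolution_def)
  interpret M: module R M by (rule M_module)
  have "noeth_over R (Q 0) (\<epsilon> ` carrier M) (\<epsilon> ` {\<zero>\<^bsub>M\<^esub>})"
    by (intro noeth_over_image[OF M_module Q_module \<epsilon>(1) M.carrier_is_submodule] noeth_over_fin_gen R_noeth fin_gen) simp
  then show ?case
    by (rule noeth_over_mono)
      (auto simp: hom_cocycles_def hom_bound_def \<epsilon>(2) mod_hom_zero_minus(1)[OF M_module Q_module \<epsilon>(1)])
next
  case (Suc i)
  have "noeth_over R (Q (Suc i)) (d i ` ideal_cocycles i b) (d i ` ideal_bound i b)"
  proof (rule noeth_over_image[OF Q_module Q_module d_hom ideal_cocycles_submodule])
    show "ideal_bound i b \<subseteq> carrier (Q i)" using Q.submoduleD(1)[OF ideal_bound_submodule[OF Suc.prems]] by blast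
    show "noeth_over R (Q i) (ideal_cocycles i b) (ideal_bound i b)"
      using Suc by (intro noeth_ideal)
  qed (rule Suc.prems)
  then show ?case
  proof (rule noeth_over_mono)
    show "hom_cocycles (Suc i) b \<subseteq> d i ` ideal_cocycles i b"
    proof
      fix q assume "q \<in> hom_cocycles (Suc i) b"
      then have q: "q \<in> ann_in (Q (Suc i)) b" "q \<in> d i ` carrier (Q i)"
        by (auto simp: hom_cocycles_def d_image)
      then show "q \<in> d i ` ideal_cocycles i b" by (auto simp: ideal_cocycles_def)
    qed
    show "d i ` ideal_bound i b \<subseteq> hom_bound (Suc i) b"
    proof
      fix q assume "q \<in> d i ` ideal_bound i b"
      then obtain w a where wa: "w \<in> bound i" "a \<in> ann_in (Q i) b" "q = d i (w \<oplus>\<^bsub>Q i\<^esub> a)"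
        unfolding ideal_bound_def by (blast elim: set_addE)
      moreover have "w \<in> carrier (Q i)" "a \<in> carrier (Q i)"
        using wa Q.submoduleD(1)[OF bound_submodule] by (auto simp: ann_in_def)
      ultimately have "q = d i a" using d_bound dD by simp
      then show "q \<in> hom_bound (Suc i) b" using wa(2) by (simp add: hom_bound_def)
    qed
  qed
qed

end

subsection \<open>Torsion with respect to a pair of ideals\<close>

text \<open>These are the ideals \<open>a\<close> for which \<open>R/a\<close> is
  \<open>(I,J)\<close>-torsion. They play the part that the powers of \<open>I\<close> play for
  ordinary local cohomology.\<close>

definition ij_ideal :: "('a, 'm) ring_scheme \<Rightarrow> 'a set \<Rightarrow> 'a set \<Rightarrow> 'a set \<Rightarrow> bool"
  where "ij_ideal R I J a \<longleftrightarrow> ideal a R \<and> (\<exists>n. ideal_power R I n \<subseteq> a <+>\<^bsub>R\<^esub> J)"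

lemma ij_ideal_mono:
  "ij_ideal R I J a \<Longrightarrow> a \<subseteq> b \<Longrightarrow> ideal b R \<Longrightarrow> ij_ideal R I J b"
  unfolding ij_ideal_def using set_add_mono[of a b J J R] by blast

context cring
begin

text \<open>The reason is \<open>(a + J)(b + J) \<subseteq> ab + J\<close>. Closure under products
  makes sums of torsion elements torsion and lets finitely many annihilating ideals be replaced by
  one.\<close>

lemma ij_ideal_prod:
  assumes I: "ideal I R" and J: "ideal J R" and a: "ij_ideal R I J a" and b: "ij_ideal R I J b"
  shows "ij_ideal R I J (a \<cdot> b)"
proof -
  have ai: "ideal a R" and bi: "ideal b R" using a b by (auto simp: ij_ideal_def)
  obtain k n where k: "ideal_power R I k \<subseteq> a <+> J" and n: "ideal_power R I n \<subseteq> b <+> J"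
    using a b by (auto simp: ij_ideal_def)
  have ab: "ideal (a \<cdot> b) R" by (rule ideal_prod_is_ideal[OF ai bi])
  have abJ: "ideal ((a \<cdot> b) <+> J) R" by (rule add_ideals[OF ab J])
  note aD = idealD[OF ai] and bD = idealD[OF bi] and JD = idealD[OF J]
  have "ideal_power R I (k + n) \<subseteq> (a \<cdot> b) <+> J"
    unfolding ideal_power_add[OF I]
  proof (rule ideal_prod_subset[OF abJ])
    fix x y assume "x \<in> ideal_power R I k" "y \<in> ideal_power R I n"
    then have "x \<in> a <+> J" "y \<in> b <+> J" using k n by auto
    then obtain u j v j' where *: "u \<in> a" "j \<in> J" "x = u \<oplus> j" "v \<in> b" "j' \<in> J" "y = v \<oplus> j'"
      by (elim set_addE)
    have "x \<otimes> y = u \<otimes> v \<oplus> (u \<otimes> j' \<oplus> (j \<otimes> v \<oplus> j \<otimes> j'))"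
      using * aD(1) bD(1) JD(1) by (simp add: l_distr r_distr a_ac)
    moreover have "u \<otimes> v \<in> a \<cdot> b" by (rule ideal_prod.prod[OF *(1,4)])
    moreover have "u \<otimes> j' \<oplus> (j \<otimes> v \<oplus> j \<otimes> j') \<in> J"
      using * aD(1) bD(1) JD(1,3,5,6) by simp
    ultimately show "x \<otimes> y \<in> (a \<cdot> b) <+> J" by (intro set_add_memI)
  qed
  with ab show ?thesis by (auto simp: ij_ideal_def)
qed

lemma ij_ideal_carrier:
  assumes "ideal I R" "ideal J R"
  shows "ij_ideal R I J (carrier R)"
proof -
  have "ideal_power R I 0 \<subseteq> carrier R <+> J"
  proof
    fix x assume "x \<in> ideal_power R I 0"
    then have "x \<in> carrier R" by (simp only: ideal_power_0)
    then show "x \<in> carrier R <+> J"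
      using idealD(2)[OF assms(2)] by (intro set_add_memI[of x _ "\<zero>"]) auto
  qed
  then show ?thesis unfolding ij_ideal_def using oneideal by blast
qed

lemma ij_ideal_power:
  assumes "ideal I R" "ideal J R" "ij_ideal R I J a"
  shows "ij_ideal R I J (ideal_power R a n)"
proof (induction n)
  case 0
  show ?case using ij_ideal_carrier[OF assms(1,2)] by (simp only: ideal_power_0)
next
  case (Suc n)
  show ?case
    unfolding ideal_power_Suc by (rule ij_ideal_prod[OF assms(1,2) Suc assms(3)])
qed

end

text \<open>Modulo the annihilator of \<open>x\<close>, the inclusion
  \<open>I^n x \<subseteq> J x\<close> becomes \<open>I^n \<subseteq> ann(x) + J\<close>. As powers
  of \<open>I\<close> decrease, the condition for all large \<open>n\<close> follows from that for a
  single \<open>n\<close>.\<close>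

lemma ij_torsion_iff:
  assumes M: "module R M" and I: "ideal I R" and J: "ideal J R"
  shows "x \<in> ij_torsion R I J M \<longleftrightarrow>
    x \<in> carrier M \<and> ij_ideal R I J {r \<in> carrier R. r \<odot>\<^bsub>M\<^esub> x = \<zero>\<^bsub>M\<^esub>}"
proof (cases "x \<in> carrier M")
  case False then show ?thesis by (simp add: ij_torsion_def)
next
  case x: True
  interpret module R M by fact
  let ?a = "{r \<in> carrier R. r \<odot>\<^bsub>M\<^esub> x = \<zero>\<^bsub>M\<^esub>}"
  have a: "ideal ?a R" using x by (rule ann_ideal)
  note ID = R.idealD(1)[OF R.ideal_power_ideal[OF I]] and JD = R.idealD(1)[OF J]
  have key: "i \<in> ?a <+>\<^bsub>R\<^esub> J \<longleftrightarrow> i \<odot>\<^bsub>M\<^esub> x \<in> (\<lambda>b. b \<odot>\<^bsub>M\<^esub> x) ` J" if i: "i \<in> carrier R" for i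
  proof
    assume "i \<in> ?a <+>\<^bsub>R\<^esub> J"
    then obtain r j where "r \<in> ?a" "j \<in> J" "i = r \<oplus>\<^bsub>R\<^esub> j" by (rule set_addE)
    then show "i \<odot>\<^bsub>M\<^esub> x \<in> (\<lambda>b. b \<odot>\<^bsub>M\<^esub> x) ` J"
      using JD x by (intro image_eqI[of _ _ j]) (auto simp: smult_l_distr)
  next
    assume "i \<odot>\<^bsub>M\<^esub> x \<in> (\<lambda>b. b \<odot>\<^bsub>M\<^esub> x) ` J"
    then obtain j where j: "j \<in> J" "i \<odot>\<^bsub>M\<^esub> x = j \<odot>\<^bsub>M\<^esub> x" by blast
    have jR: "j \<in> carrier R" using JD j by blast
    have "(i \<ominus>\<^bsub>R\<^esub> j) \<odot>\<^bsub>M\<^esub> x = i \<odot>\<^bsub>M\<^esub> x \<ominus>\<^bsub>M\<^esub> j \<odot>\<^bsub>M\<^esub> x"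
      using i jR x by (simp add: R.minus_eq M.minus_eq smult_l_distr smult_l_minus)
    then have "i \<ominus>\<^bsub>R\<^esub> j \<in> ?a" using i jR x j by (simp add: M.minus_eq M.r_neg)
    moreover have "i = (i \<ominus>\<^bsub>R\<^esub> j) \<oplus>\<^bsub>R\<^esub> j" using i jR by (simp add: R.minus_eq R.a_assoc R.l_neg)
    ultimately show "i \<in> ?a <+>\<^bsub>R\<^esub> J" using j(1) by (intro set_add_memI)
  qed
  have key': "ideal_power R I n \<subseteq> ?a <+>\<^bsub>R\<^esub> J \<longleftrightarrow>
      (\<lambda>a. a \<odot>\<^bsub>M\<^esub> x) ` ideal_power R I n \<subseteq> (\<lambda>b. b \<odot>\<^bsub>M\<^esub> x) ` J" for n
    unfolding image_subset_iff subset_iff[of "ideal_power R I n"] using key ID[of _ n] by blast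
  have "x \<in> ij_torsion R I J M \<longleftrightarrow> (\<exists>N. \<forall>n\<ge>N. ideal_power R I n \<subseteq> ?a <+>\<^bsub>R\<^esub> J)"
    unfolding ij_torsion_def key' using x by simp
  also have "\<dots> \<longleftrightarrow> (\<exists>n. ideal_power R I n \<subseteq> ?a <+>\<^bsub>R\<^esub> J)"
  proof
    assume "\<exists>n. ideal_power R I n \<subseteq> ?a <+>\<^bsub>R\<^esub> J"
    then obtain k where k: "ideal_power R I k \<subseteq> ?a <+>\<^bsub>R\<^esub> J" by blast
    have "ideal_power R I n \<subseteq> ?a <+>\<^bsub>R\<^esub> J" if "n \<ge> k" for n
      using R.ideal_power_antimono[OF I that] k by (rule subset_trans)
    then show "\<exists>N. \<forall>n\<ge>N. ideal_power R I n \<subseteq> ?a <+>\<^bsub>R\<^esub> J" by blast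
  qed blast
  finally show ?thesis using x a by (simp add: ij_ideal_def)
qed

lemma ij_torsionI:
  assumes M: "module R M" and I: "ideal I R" and J: "ideal J R"
    and x: "x \<in> carrier M" and a: "ij_ideal R I J a" "\<And>r. r \<in> a \<Longrightarrow> r \<odot>\<^bsub>M\<^esub> x = \<zero>\<^bsub>M\<^esub>"
  shows "x \<in> ij_torsion R I J M"
proof -
  interpret module R M by fact
  have "a \<subseteq> {r \<in> carrier R. r \<odot>\<^bsub>M\<^esub> x = \<zero>\<^bsub>M\<^esub>}"
    using a R.idealD(1)[of a] by (auto simp: ij_ideal_def)
  then show ?thesis
    unfolding ij_torsion_iff[OF M I J] using ij_ideal_mono[OF a(1) _ ann_ideal[OF x]] x by simp
qed

lemma ij_torsionE:
  assumes M: "module R M" and I: "ideal I R" and J: "ideal J R" and x: "x \<in> ij_torsion R I J M"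
  obtains a where "x \<in> carrier M" "ij_ideal R I J a" "ideal a R" "\<And>r. r \<in> a \<Longrightarrow> r \<odot>\<^bsub>M\<^esub> x = \<zero>\<^bsub>M\<^esub>"
  using x[unfolded ij_torsion_iff[OF M I J]] that by (auto simp: ij_ideal_def)

lemma ij_torsion_submodule:
  assumes M: "module R M" and I: "ideal I R" and J: "ideal J R"
  shows "submodule (ij_torsion R I J M) R M"
proof -
  interpret module R M by fact
  show ?thesis
  proof (rule submoduleI_closed)
    show "ij_torsion R I J M \<subseteq> carrier M" by (auto simp: ij_torsion_def)
    show "\<zero>\<^bsub>M\<^esub> \<in> ij_torsion R I J M"
      by (rule ij_torsionI[OF M I J _ R.ij_ideal_carrier[OF I J]]) auto
  next
    fix x y assume x: "x \<in> ij_torsion R I J M" and y: "y \<in> ij_torsion R I J M"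
    obtain a where a: "x \<in> carrier M" "ij_ideal R I J a" "ideal a R" "\<And>r. r \<in> a \<Longrightarrow> r \<odot>\<^bsub>M\<^esub> x = \<zero>\<^bsub>M\<^esub>"
      by (rule ij_torsionE[OF M I J x]) blast
    obtain b where b: "y \<in> carrier M" "ij_ideal R I J b" "ideal b R" "\<And>r. r \<in> b \<Longrightarrow> r \<odot>\<^bsub>M\<^esub> y = \<zero>\<^bsub>M\<^esub>"
      by (rule ij_torsionE[OF M I J y]) blast
    show "x \<oplus>\<^bsub>M\<^esub> y \<in> ij_torsion R I J M"
    proof (rule ij_torsionI[OF M I J _ R.ij_ideal_prod[OF I J a(2) b(2)]])
      fix r assume "r \<in> a \<cdot>\<^bsub>R\<^esub> b"
      then have "r \<in> a" "r \<in> b" using R.ideal_prod_inter[OF a(3) b(3)] by auto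
      then show "r \<odot>\<^bsub>M\<^esub> (x \<oplus>\<^bsub>M\<^esub> y) = \<zero>\<^bsub>M\<^esub>"
        using a b R.idealD(1)[OF a(3)] by (simp add: smult_r_distr)
    qed (use a b in simp)
  next
    fix s x assume s: "s \<in> carrier R" and x: "x \<in> ij_torsion R I J M"
    obtain a where a: "x \<in> carrier M" "ij_ideal R I J a" "ideal a R" "\<And>r. r \<in> a \<Longrightarrow> r \<odot>\<^bsub>M\<^esub> x = \<zero>\<^bsub>M\<^esub>"
      by (rule ij_torsionE[OF M I J x]) blast
    show "s \<odot>\<^bsub>M\<^esub> x \<in> ij_torsion R I J M"
      using a s R.idealD(1)[OF a(3)] by (intro ij_torsionI[OF M I J _ a(2)]) (auto simp: smult_comm[of _ s])
  qed
qed

lemma ij_torsion_hom: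
  assumes M: "module R M" and N: "module R N" and I: "ideal I R" and J: "ideal J R"
    and h: "h \<in> mod_hom R M N" and x: "x \<in> ij_torsion R I J M"
  shows "h x \<in> ij_torsion R I J N"
proof -
  interpret M: module R M by fact
  obtain a where a: "x \<in> carrier M" "ij_ideal R I J a" "ideal a R" "\<And>r. r \<in> a \<Longrightarrow> r \<odot>\<^bsub>M\<^esub> x = \<zero>\<^bsub>M\<^esub>"
    by (rule ij_torsionE[OF M I J x]) blast
  show ?thesis
  proof (rule ij_torsionI[OF N I J _ a(2)])
    fix r assume r: "r \<in> a"
    then show "r \<odot>\<^bsub>N\<^esub> h x = \<zero>\<^bsub>N\<^esub>"
      using mod_homD(3)[OF h M.R.idealD(1)[OF a(3) r] a(1)] a(4)[OF r] mod_hom_zero_minus(1)[OF M N h] by simp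
  qed (use mod_homD(1)[OF h a(1)] in simp)
qed

text \<open>Torsion parts of injective modules are direct summands. By
  \<open>injective_retract\<close> it is enough to replace \<open>q\<close> by a torsion element
  without changing its products with \<open>L\<close>, given that these products are
  torsion.\<close>

lemma ij_torsion_retract:
  assumes R: "noetherian_ring R" and Q: "injective_module R Q" and I: "ideal I R" and J: "ideal J R"
  obtains p where "p \<in> mod_hom R Q Q" "\<And>q. q \<in> carrier Q \<Longrightarrow> p q \<in> ij_torsion R I J Q"
    "\<And>x. x \<in> ij_torsion R I J Q \<Longrightarrow> p x = x"
proof (rule injective_retract[OF Q])
  have Qm: "module R Q" using Q by (simp add: injective_module_def)
  interpret Q: module R Q by (rule Qm)
  interpret R: noetherian_ring R by fact
  show "submodule (ij_torsion R I J Q) R Q" by (rule ij_torsion_submodule[OF Qm I J])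
  fix L q assume L: "ideal L R" and q: "q \<in> carrier Q" and Lq: "\<And>l. l \<in> L \<Longrightarrow> l \<odot>\<^bsub>Q\<^esub> q \<in> ij_torsion R I J Q"
  \<comment> \<open>One ideal \<open>a\<close> annihilates all of \<open>L q\<close>: the ideals
    belonging to the successive generators of \<open>L\<close> are multiplied together.\<close>
  let ?P = "\<lambda>c a. ij_ideal R I J a \<and> ideal a R \<and> (\<forall>x\<in>a. \<forall>l\<in>c. x \<odot>\<^bsub>Q\<^esub> (l \<odot>\<^bsub>Q\<^esub> q) = \<zero>\<^bsub>Q\<^esub>)"
  have "\<exists>a. ?P L a"
  proof (rule R.ideal_adjoin_induct[OF Q.R.is_cring L])
    show "\<exists>a. ?P {\<zero>\<^bsub>R\<^esub>} a"
      using Q.R.ij_ideal_carrier[OF I J] Q.R.oneideal q by (intro exI[of _ "carrier R"]) auto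
  next
    fix c x assume c: "ideal c R" "x \<in> L" and "\<exists>a. ?P c a"
    then obtain a where a: "?P c a" by blast
    have xR: "x \<in> carrier R" by (rule Q.R.idealD(1)[OF L c(2)])
    obtain b where b: "ij_ideal R I J b" "ideal b R" "\<And>r. r \<in> b \<Longrightarrow> r \<odot>\<^bsub>Q\<^esub> (x \<odot>\<^bsub>Q\<^esub> q) = \<zero>\<^bsub>Q\<^esub>"
      by (rule ij_torsionE[OF Qm I J Lq[OF c(2)]]) blast
    have ab: "ideal (a \<cdot>\<^bsub>R\<^esub> b) R" using Q.R.ideal_prod_is_ideal a b(2) by blast
    have "y \<odot>\<^bsub>Q\<^esub> (l \<odot>\<^bsub>Q\<^esub> q) = \<zero>\<^bsub>Q\<^esub>" if y: "y \<in> a \<cdot>\<^bsub>R\<^esub> b" and l: "l \<in> adjoin R c x" for y l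
    proof -
      have yab: "y \<in> a" "y \<in> b" using y Q.R.ideal_prod_inter[of a b] a b(2) by auto
      have yR: "y \<in> carrier R" using Q.R.idealD(1)[OF b(2) yab(2)] .
      obtain k r where k: "k \<in> c" "r \<in> carrier R" "l = k \<oplus>\<^bsub>R\<^esub> r \<otimes>\<^bsub>R\<^esub> x" using l by (auto simp: adjoin_def)
      have kR: "k \<in> carrier R" by (rule Q.R.idealD(1)[OF c(1) k(1)])
      have "y \<odot>\<^bsub>Q\<^esub> (l \<odot>\<^bsub>Q\<^esub> q) = y \<odot>\<^bsub>Q\<^esub> (k \<odot>\<^bsub>Q\<^esub> q) \<oplus>\<^bsub>Q\<^esub> r \<odot>\<^bsub>Q\<^esub> (y \<odot>\<^bsub>Q\<^esub> (x \<odot>\<^bsub>Q\<^esub> q))"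
        using yR kR k xR q by (simp add: Q.smult_l_distr Q.smult_r_distr Q.smult_assoc1 Q.smult_comm[of y r])
      then show ?thesis using a yab k b(3) by simp
    qed
    then show "\<exists>a. ?P (adjoin R c x) a"
      using Q.R.ij_ideal_prod[OF I J _ b(1)] a ab by blast
  qed
  then obtain a where a: "ij_ideal R I J a" "ideal a R" "\<And>x l. x \<in> a \<Longrightarrow> l \<in> L \<Longrightarrow> x \<odot>\<^bsub>Q\<^esub> (l \<odot>\<^bsub>Q\<^esub> q) = \<zero>\<^bsub>Q\<^esub>"
    by blast
  note LD = Q.R.idealD[OF L] and aD = Q.R.idealD[OF a(2)]
  let ?c = "{r \<in> carrier R. r \<odot>\<^bsub>Q\<^esub> q = \<zero>\<^bsub>Q\<^esub>}"
  have c: "ideal ?c R" by (rule Q.ann_ideal[OF q])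
  \<comment> \<open>The largest ideal whose products with \<open>q\<close> are killed by
    \<open>a\<close>. It contains \<open>L\<close>, and \<open>a\<close> carries it into the
    annihilator of \<open>q\<close>, as \<open>ideal_power_complement\<close> requires.\<close>
  let ?L = "{l \<in> carrier R. \<forall>x\<in>a. x \<odot>\<^bsub>Q\<^esub> (l \<odot>\<^bsub>Q\<^esub> q) = \<zero>\<^bsub>Q\<^esub>}"
  have "x \<odot>\<^bsub>Q\<^esub> ((r \<otimes>\<^bsub>R\<^esub> l) \<odot>\<^bsub>Q\<^esub> q) = r \<odot>\<^bsub>Q\<^esub> (x \<odot>\<^bsub>Q\<^esub> (l \<odot>\<^bsub>Q\<^esub> q))"
    if "x \<in> a" "r \<in> carrier R" "l \<in> carrier R" for x r l
    using that aD(1) q by (simp add: Q.smult_assoc1 Q.smult_comm[of x r])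
  then have L': "ideal ?L R"
    using aD(1) q by (intro Q.R.idealI_closed) (auto simp: Q.smult_l_distr Q.smult_r_distr)
  have "?c \<subseteq> ?L" using aD(1) by auto
  moreover have "x \<otimes>\<^bsub>R\<^esub> l \<in> ?c" if "x \<in> a" "l \<in> ?L" for x l
    using that aD(1) q by (simp add: Q.smult_assoc1)
  ultimately obtain K s where K: "ideal K R" "?c \<subseteq> K" "K \<inter> ?L \<subseteq> ?c" "ideal_power R a s \<subseteq> K"
    using R.ideal_power_complement[OF Q.R.is_cring c L' a(2)] by (metis (no_types, lifting))
  have LL': "L \<subseteq> ?L" using LD(1) a(3) by blast
  \<comment> \<open>Elements of \<open>K \<inter> L\<close> kill \<open>q\<close>, so
    \<open>l \<mapsto> l q\<close> on \<open>L\<close> extends by zero on \<open>K\<close> and then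
    to \<open>R\<close>. The resulting \<open>y\<close> is killed by \<open>K\<close>, which
    contains a power of \<open>a\<close>, and is therefore torsion.\<close>
  obtain y where y: "y \<in> carrier Q" "y \<in> ann_in Q K" "\<And>l. l \<in> L \<Longrightarrow> l \<odot>\<^bsub>Q\<^esub> y = l \<odot>\<^bsub>Q\<^esub> q"
  proof (rule injective_adjoin_extend[OF Q Q.R.is_cring K(1) L q, of "\<lambda>l. l"])
    show "l \<odot>\<^bsub>Q\<^esub> q = \<zero>\<^bsub>Q\<^esub>" if "l \<in> L" "l \<in> K" for l using that LL' K(3) by blast
  qed (use LD(1) in blast)+
  have "ij_ideal R I J K"
    by (rule ij_ideal_mono[OF Q.R.ij_ideal_power[OF I J a(1)] K(4,1)])
  then have "y \<in> ij_torsion R I J Q"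
    using y(2) by (intro ij_torsionI[OF Qm I J y(1)]) (auto simp: ann_in_def)
  then show "\<exists>x\<in>ij_torsion R I J Q. \<forall>l\<in>L. l \<odot>\<^bsub>Q\<^esub> q = l \<odot>\<^bsub>Q\<^esub> x"
    using y(3) by (intro bexI[of _ y]) auto
qed blast

lemma (in abelian_group) minus_zero_right:
  assumes "x \<in> carrier G"
  shows "x \<ominus> \<zero> = x"
proof -
  have "\<ominus> \<zero> = \<zero>" using l_neg[OF zero_closed] r_zero[OF a_inv_closed[OF zero_closed]] by simp
  then show ?thesis using assms by (simp add: minus_eq)
qed

subsection \<open>The first nonvanishing local cohomology module\<close>

locale ij_resolution = fin_gen_resolution +
  fixes I J :: "'a set"
  assumes I_ideal: "ideal I R" and J_ideal: "ideal J R"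
begin

abbreviation "tor i \<equiv> ij_torsion R I J (Q i)"
abbreviation "cocyc i \<equiv> ij_cocycles R I J Q d i"
abbreviation "cobound i \<equiv> ij_coboundaries R I J Q d i"

lemma tor_submodule: "submodule (tor i) R (Q i)"
  by (rule ij_torsion_submodule[OF Q_module I_ideal J_ideal])

lemmas torD = Q.submoduleD[OF tor_submodule]

lemma tor_d: "x \<in> tor i \<Longrightarrow> d i x \<in> tor (Suc i)"
  by (rule ij_torsion_hom[OF Q_module Q_module I_ideal J_ideal d_hom])

lemma cocyc_eq: "cocyc i = tor i \<inter> {x \<in> carrier (Q i). d i x = \<zero>\<^bsub>Q (Suc i)\<^esub>}"
  using torD(1) by (auto simp: ij_cocycles_def)

lemma cocyc_submodule: "submodule (cocyc i) R (Q i)"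
  unfolding cocyc_eq by (intro Q.submodule_Int tor_submodule kernel_submodule Q_module d_hom)

lemmas cocycD = Q.submoduleD[OF cocyc_submodule]

lemma cobound_submodule: "submodule (cobound i) R (Q i)"
  unfolding ij_coboundaries_def
  by (cases i) (auto intro: Q.zero_submodule image_submodule[OF Q_module Q_module d_hom tor_submodule])

lemmas coboundD = Q.submoduleD[OF cobound_submodule]

lemma cobound_subset_cocyc: "cobound i \<subseteq> cocyc i"
proof (cases i)
  case 0
  then show ?thesis using cocycD(2)[of 0] by (simp add: ij_coboundaries_def)
next
  case (Suc j)
  then show ?thesis using tor_d[of _ j] torD(1) d_d by (auto simp: ij_coboundaries_def ij_cocycles_def)
qed

text \<open>Below the depth the torsion complex splits, since its terms are injective.\<close>

lemma cobound_retract: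
  assumes exact: "\<And>i. i < t \<Longrightarrow> cocyc i = cobound i" and "i \<le> t"
  shows "\<exists>\<rho>\<in>mod_hom R (Q i) (Q i). (\<forall>q\<in>carrier (Q i). \<rho> q \<in> cobound i) \<and> (\<forall>b\<in>cobound i. \<rho> b = b)"
  using \<open>i \<le> t\<close>
proof (induction i)
  case 0
  have "(\<lambda>q\<in>carrier (Q 0). \<zero>\<^bsub>Q 0\<^esub>) \<in> mod_hom R (Q 0) (Q 0)"
    by (intro mod_hom_restrictI Q_module) auto
  then show ?case by (rule bexI[rotated]) (auto simp: ij_coboundaries_def)
next
  case (Suc i)
  then obtain \<rho> where \<rho>: "\<rho> \<in> mod_hom R (Q i) (Q i)" "\<And>q. q \<in> carrier (Q i) \<Longrightarrow> \<rho> q \<in> cobound i"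
    "\<And>b. b \<in> cobound i \<Longrightarrow> \<rho> b = b" by (metis Suc_leD)
  note \<rho>D = mod_homD[OF \<rho>(1)]
  have ex: "cocyc i = cobound i" using Suc.prems by (intro exact) simp
  obtain p where p: "p \<in> mod_hom R (Q i) (Q i)" "\<And>q. q \<in> carrier (Q i) \<Longrightarrow> p q \<in> tor i"
    "\<And>x. x \<in> tor i \<Longrightarrow> p x = x"
    by (rule ij_torsion_retract[OF R_noeth injective I_ideal J_ideal]) blast
  \<comment> \<open>On \<open>tor i\<close> the map \<open>1 - \<rho>\<close> vanishes on cocycles,
    since these are coboundaries in degree \<open>i\<close> and \<open>\<rho>\<close> fixes them. It
    therefore factors through \<open>d i\<close> as some \<open>h\<close>, which splits
    \<open>d i\<close> up to \<open>\<rho>\<close>.\<close>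
  let ?\<gamma> = "\<lambda>x\<in>carrier (Q i). x \<ominus>\<^bsub>Q i\<^esub> \<rho> x"
  have \<gamma>: "?\<gamma> \<in> mod_hom R (Q i) (Q i)"
    using \<rho>D by (intro mod_hom_restrictI Q_module) (auto simp: Q.module_simprules)
  have ker: "?\<gamma> x = \<zero>\<^bsub>Q i\<^esub>" if "x \<in> tor i" "d i x = \<zero>\<^bsub>Q (Suc i)\<^esub>" for x
  proof -
    have "x \<in> cobound i" using that torD(1) ex by (auto simp: cocyc_eq)
    then show ?thesis using \<rho>(3) torD(1)[OF that(1)] by (simp add: Q.diff_zero_iff)
  qed
  obtain h where h: "h \<in> mod_hom R (Q (Suc i)) (Q i)" "\<And>x. x \<in> tor i \<Longrightarrow> h (d i x) = ?\<gamma> x"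
    using injective_factor[OF injective Q_module Q_module tor_submodule d_hom \<gamma> ker] by blast
  \<comment> \<open>Away from the image of \<open>tor i\<close> the values of \<open>h\<close> need
    not be torsion; the projection \<open>p\<close> is inserted so that \<open>d i\<close> maps them
    to coboundaries of the torsion complex.\<close>
  define \<rho>' where "\<rho>' = (\<lambda>q\<in>carrier (Q (Suc i)). d i (p (h q)))"
  have "(\<lambda>q\<in>carrier (Q (Suc i)). p (h q)) \<in> mod_hom R (Q (Suc i)) (Q i)"
    by (rule mod_hom_comp[OF Q_module h(1) p(1)])
  from mod_hom_comp[OF Q_module this d_hom] have "\<rho>' \<in> mod_hom R (Q (Suc i)) (Q (Suc i))"
    unfolding \<rho>'_def by (simp cong: restrict_cong)
  moreover have "\<rho>' q \<in> cobound (Suc i)" if "q \<in> carrier (Q (Suc i))" for q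
    using that p(2) mod_homD(1)[OF h(1)] by (auto simp: \<rho>'_def ij_coboundaries_def)
  moreover have "\<rho>' b = b" if b: "b \<in> cobound (Suc i)" for b
  proof -
    obtain x where x: "x \<in> tor i" "b = d i x" using b by (auto simp: ij_coboundaries_def)
    have xQ: "x \<in> carrier (Q i)" by (rule torD(1)[OF x(1)])
    have \<rho>x: "\<rho> x \<in> cocyc i" using \<rho>(2)[OF xQ] ex by simp
    then have \<rho>t: "\<rho> x \<in> tor i" "d i (\<rho> x) = \<zero>\<^bsub>Q (Suc i)\<^esub>" by (auto simp: cocyc_eq)
    have "\<rho>' b = d i (p (x \<ominus>\<^bsub>Q i\<^esub> \<rho> x))"
      using h(2)[OF x(1)] x(2) xQ dD(1)[OF xQ] by (simp add: \<rho>'_def)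
    also have "\<dots> = d i (x \<ominus>\<^bsub>Q i\<^esub> \<rho> x)" using p(3)[OF torD(4)[OF x(1) \<rho>t(1)]] by simp
    also have "\<dots> = d i x \<ominus>\<^bsub>Q (Suc i)\<^esub> \<zero>\<^bsub>Q (Suc i)\<^esub>"
      using d_zero_minus(3)[OF xQ \<rho>D(1)[OF xQ]] \<rho>t(2) by simp
    also have "\<dots> = b" using x(2) dD(1)[OF xQ] by (simp add: Q.M.minus_zero_right)
    finally show ?thesis .
  qed
  ultimately show ?case by blast
qed

text \<open>For a cocycle \<open>z\<close> with \<open>a z\<close> inside the coboundaries, the
  retraction \<open>\<rho>\<close> gives \<open>r (z - \<rho> z) = r z - \<rho> (r z) = 0\<close>
  for all \<open>r\<close> in \<open>a\<close>. So \<open>z - \<rho> z\<close> represents the same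
  class and is killed by \<open>a\<close>: the natural map from \<open>Ext\<close> of
  \<open>R/a\<close> in degree \<open>t\<close> onto \<open>(0 : a)\<close> in cohomology is
  surjective, and \<open>noeth_hom\<close> supplies the generators.\<close>

lemma ann_local_cohomology_lift:
  assumes exact: "\<And>i. i < t \<Longrightarrow> cocyc i = cobound i" and a: "ij_ideal R I J a"
  obtains F where "finite F" "F \<subseteq> cocyc t" "F \<subseteq> ann_in (Q t) a"
    "\<forall>z\<in>cocyc t. (\<forall>r\<in>a. r \<odot>\<^bsub>Q t\<^esub> z \<in> cobound t) \<longrightarrow>
      z \<in> mod_span R (Q t) F <+>\<^bsub>Q t\<^esub> cobound t"
proof -
  have ai: "ideal a R" using a by (simp add: ij_ideal_def)
  note aD = R.idealD[OF ai]
  obtain \<rho> where \<rho>: "\<rho> \<in> mod_hom R (Q t) (Q t)" "\<And>q. q \<in> carrier (Q t) \<Longrightarrow> \<rho> q \<in> cobound t"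
    "\<And>b. b \<in> cobound t \<Longrightarrow> \<rho> b = b" using cobound_retract[OF exact order_refl] by blast
  note \<rho>D = mod_homD[OF \<rho>(1)]
  obtain F where F: "finite F" "F \<subseteq> hom_cocycles t a"
    "hom_cocycles t a \<subseteq> mod_span R (Q t) F <+>\<^bsub>Q t\<^esub> hom_bound t a"
    using noeth_overD[OF noeth_hom[OF ai] hom_cocycles_submodule[OF ai] order_refl] by blast
  \<comment> \<open>The complex \<open>Hom(R/a, Q)\<close> lies inside the torsion complex, so its
    coboundaries are coboundaries there.\<close>
  have ann_tor: "x \<in> tor i" if "x \<in> ann_in (Q i) a" for x i
    using that by (intro ij_torsionI[OF Q_module I_ideal J_ideal _ a]) (auto simp: ann_in_def)
  have hb: "hom_bound t a \<subseteq> cobound t"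
    using ann_tor by (cases t) (auto simp: hom_bound_def ij_coboundaries_def)
  show ?thesis
  proof (rule that[of F])
    show "finite F" by (rule F(1))
    show "F \<subseteq> ann_in (Q t) a" using F(2) by (auto simp: hom_cocycles_def)
    then show "F \<subseteq> cocyc t" using F(2) ann_tor by (auto simp: hom_cocycles_def cocyc_eq)
  next
    show "\<forall>z\<in>cocyc t. (\<forall>r\<in>a. r \<odot>\<^bsub>Q t\<^esub> z \<in> cobound t) \<longrightarrow> z \<in> mod_span R (Q t) F <+>\<^bsub>Q t\<^esub> cobound t"
    proof (intro ballI impI)
      fix z assume z: "z \<in> cocyc t" and "\<forall>r\<in>a. r \<odot>\<^bsub>Q t\<^esub> z \<in> cobound t"
      then have az: "\<And>r. r \<in> a \<Longrightarrow> r \<odot>\<^bsub>Q t\<^esub> z \<in> cobound t" by blast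
      have zQ: "z \<in> carrier (Q t)" and dz: "d t z = \<zero>\<^bsub>Q (Suc t)\<^esub>" using z by (auto simp: cocyc_eq)
      let ?z = "z \<ominus>\<^bsub>Q t\<^esub> \<rho> z"
      have \<rho>z: "\<rho> z \<in> cobound t" "\<rho> z \<in> carrier (Q t)" using \<rho>(2)[OF zQ] coboundD(1) by auto
      have "r \<odot>\<^bsub>Q t\<^esub> ?z = \<zero>\<^bsub>Q t\<^esub>" if r: "r \<in> a" for r
      proof -
        have rR: "r \<in> carrier R" by (rule aD(1)[OF r])
        have "r \<odot>\<^bsub>Q t\<^esub> ?z = r \<odot>\<^bsub>Q t\<^esub> z \<ominus>\<^bsub>Q t\<^esub> \<rho> (r \<odot>\<^bsub>Q t\<^esub> z)"
          using rR zQ \<rho>z \<rho>D(3)[OF rR zQ] by (simp add: Q.module_simprules)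
        then show ?thesis using \<rho>(3)[OF az[OF r]] rR zQ by (simp add: Q.diff_zero_iff)
      qed
      moreover have "d t (\<rho> z) = \<zero>\<^bsub>Q (Suc t)\<^esub>"
        using \<rho>z(1) cobound_subset_cocyc by (auto simp: cocyc_eq)
      then have "d t ?z = \<zero>\<^bsub>Q (Suc t)\<^esub>"
        using d_zero_minus(3)[OF zQ \<rho>z(2)] dz Q.diff_zero_iff[of "\<zero>\<^bsub>Q (Suc t)\<^esub>"] by simp
      ultimately have "?z \<in> hom_cocycles t a" using zQ \<rho>z by (auto simp: hom_cocycles_def ann_in_def)
      then obtain f b where fb: "f \<in> mod_span R (Q t) F" "b \<in> cobound t" "?z = f \<oplus>\<^bsub>Q t\<^esub> b"
        using F(3) hb by (blast elim: set_addE)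
      have FQ: "F \<subseteq> carrier (Q t)" using F(2) by (auto simp: hom_cocycles_def)
      have fQ: "f \<in> carrier (Q t)" using Q.submoduleD(1)[OF mod_span_submodule[OF Q_module FQ] fb(1)] .
      have bQ: "b \<in> carrier (Q t)" using coboundD(1) fb by auto
      have "z = ?z \<oplus>\<^bsub>Q t\<^esub> \<rho> z" using zQ \<rho>z by (simp add: Q.module_simprules)
      also have "\<dots> = f \<oplus>\<^bsub>Q t\<^esub> (b \<oplus>\<^bsub>Q t\<^esub> \<rho> z)" unfolding fb(3) using fQ bQ \<rho>z by (simp add: Q.M.a_assoc)
      finally show "z \<in> mod_span R (Q t) F <+>\<^bsub>Q t\<^esub> cobound t"
        by (rule set_add_memI[OF fb(1) coboundD(3)[OF fb(2) \<rho>z(1)]])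
    qed
  qed
qed

section \<open>Cohomology classes and their annihilators\<close>

abbreviation "Z_mod i \<equiv> Q i\<lparr>carrier := cocyc i\<rparr>"

lemma Z_module: "module R (Z_mod i)"
  by (rule submodule.submodule_is_module[OF cocyc_submodule Q_module])

lemma cobound_submodule_Z: "submodule (cobound i) R (Z_mod i)"
proof -
  interpret Z: module R "Z_mod i" by (rule Z_module)
  show ?thesis
    using cobound_subset_cocyc coboundD by (intro Z.submoduleI_closed) auto
qed

abbreviation "coho i \<equiv> local_cohomology R I J Q d i"

lemma coho_module: "module R (coho i)"
  unfolding local_cohomology_def by (rule quot_module_module[OF Z_module cobound_submodule_Z])

abbreviation "cls i z \<equiv> cobound i +>\<^bsub>Z_mod i\<^esub> z"

lemma coho_carrier: "carrier (coho i) = {cls i z | z. z \<in> cocyc i}"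
  unfolding local_cohomology_def by (simp add: quot_module_carrier)

lemma cls_hom: "(\<lambda>z\<in>carrier (Z_mod i). cls i z) \<in> mod_hom R (Z_mod i) (coho i)"
  unfolding local_cohomology_def by (rule quot_proj_hom[OF Z_module cobound_submodule_Z])

lemma cls_zero_iff:
  assumes z: "z \<in> cocyc i"
  shows "cls i z = \<zero>\<^bsub>coho i\<^esub> \<longleftrightarrow> z \<in> cobound i"
proof -
  interpret Z: module R "Z_mod i" by (rule Z_module)
  have "\<zero>\<^bsub>coho i\<^esub> = cls i \<zero>\<^bsub>Q i\<^esub>"
    using quot_module_simps(3)[OF Z_module cobound_submodule_Z] by (simp add: local_cohomology_def)
  moreover have "z \<ominus>\<^bsub>Z_mod i\<^esub> \<zero>\<^bsub>Q i\<^esub> = z"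
    using z Z.M.minus_zero_right[of z] by simp
  ultimately show ?thesis
    using Z.coset_eq_iff[OF cobound_submodule_Z, of z "\<zero>\<^bsub>Q i\<^esub>"] z cocycD(2) by simp
qed

lemma exact_below_depth:
  assumes "ij_depth R I J Q d = enat t" "i < t"
  shows "cocyc i = cobound i"
proof -
  have "carrier (coho i) = {\<zero>\<^bsub>coho i\<^esub>}"
  proof (rule ccontr)
    assume "\<not> ?thesis"
    then have "ij_depth R I J Q d \<le> enat i" unfolding ij_depth_def by (intro Inf_lower) blast
    then show False using assms by simp
  qed
  then have "z \<in> cobound i" if "z \<in> cocyc i" for z
    using cls_zero_iff[OF that] coho_carrier that by blast
  then show ?thesis using cobound_subset_cocyc by blast
qed

text \<open>The ideal \<open>a\<close> is one that kills a torsion cocycle \<open>z\<close>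
  representing \<open>h\<close>. It may be smaller than the annihilator of \<open>h\<close>; taking
  it from the torsion condition on \<open>z\<close> makes \<open>R/a\<close> an
  \<open>(I,J)\<close>-torsion module.\<close>

theorem coho_ann_fin_gen:
  assumes t: "ij_depth R I J Q d = enat t" and h: "h \<in> carrier (coho t)"
  obtains a F where "ideal a R" "h \<in> ann_in (coho t) a" "finite F" "F \<subseteq> carrier (coho t)"
    "F \<subseteq> ann_in (coho t) a" "ann_in (coho t) a \<subseteq> mod_span R (coho t) F"
proof -
  interpret H: module R "coho t" by (rule coho_module)
  note clsD = mod_homD[OF cls_hom, simplified]
  have clsI: "cls t z \<in> carrier (coho t)" if "z \<in> cocyc t" for z using clsD(1)[OF that] that by simp
  have cls_sm: "r \<odot>\<^bsub>coho t\<^esub> cls t z = cls t (r \<odot>\<^bsub>Q t\<^esub> z)" if "r \<in> carrier R" "z \<in> cocyc t" for r z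
    using clsD(3)[OF that] that cocycD(6) by simp
  obtain z where z: "z \<in> cocyc t" "h = cls t z" using h coho_carrier by auto
  then have "z \<in> tor t" by (simp add: cocyc_eq)
  then obtain a where a: "z \<in> carrier (Q t)" "ij_ideal R I J a" "ideal a R" "\<And>r. r \<in> a \<Longrightarrow> r \<odot>\<^bsub>Q t\<^esub> z = \<zero>\<^bsub>Q t\<^esub>"
    by (rule ij_torsionE[OF Q_module I_ideal J_ideal]) blast
  note aD = R.idealD[OF a(3)]
  obtain F where F: "finite F" "F \<subseteq> cocyc t" "F \<subseteq> ann_in (Q t) a"
    and span: "\<forall>z\<in>cocyc t. (\<forall>r\<in>a. r \<odot>\<^bsub>Q t\<^esub> z \<in> cobound t) \<longrightarrow>
      z \<in> mod_span R (Q t) F <+>\<^bsub>Q t\<^esub> cobound t"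
    by (rule ann_local_cohomology_lift[OF exact_below_depth[OF t] a(2)]) blast
  have ann: "cls t x \<in> ann_in (coho t) a \<longleftrightarrow> (\<forall>r\<in>a. r \<odot>\<^bsub>Q t\<^esub> x \<in> cobound t)" if x: "x \<in> cocyc t" for x
  proof -
    have "r \<odot>\<^bsub>coho t\<^esub> cls t x = \<zero>\<^bsub>coho t\<^esub> \<longleftrightarrow> r \<odot>\<^bsub>Q t\<^esub> x \<in> cobound t" if "r \<in> a" for r
      using cls_sm[OF aD(1)[OF that] x] cls_zero_iff[OF cocycD(6)[OF aD(1)[OF that] x]] by simp
    then show ?thesis using clsI[OF x] by (auto simp: ann_in_def)
  qed
  show ?thesis
  proof (rule that[of a "cls t ` F"])
    show "h \<in> ann_in (coho t) a" using ann[OF z(1)] z a(4) coboundD(2) by simp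
    show "cls t ` F \<subseteq> carrier (coho t)" using F(2) clsI by blast
    show "cls t ` F \<subseteq> ann_in (coho t) a"
    proof (rule image_subsetI)
      fix f assume f: "f \<in> F"
      then have "\<forall>r\<in>a. r \<odot>\<^bsub>Q t\<^esub> f \<in> cobound t" using F(3) coboundD(2) by (auto simp: ann_in_def)
      then show "cls t f \<in> ann_in (coho t) a" using ann f F(2) by blast
    qed
    show "ann_in (coho t) a \<subseteq> mod_span R (coho t) (cls t ` F)"
    proof
      fix y assume y: "y \<in> ann_in (coho t) a"
      then obtain x where x: "x \<in> cocyc t" "y = cls t x" using coho_carrier by (auto simp: ann_in_def)
      then obtain f b where fb: "f \<in> mod_span R (Q t) F" "b \<in> cobound t" "x = f \<oplus>\<^bsub>Q t\<^esub> b"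
        using span x y ann[OF x(1)] by (blast elim: set_addE)
      have bZ: "b \<in> cocyc t" using fb cobound_subset_cocyc by blast
      have fZ: "f \<in> cocyc t" using mod_span_least[OF cocyc_submodule F(2)] fb(1) by blast
      have "y = cls t f \<oplus>\<^bsub>coho t\<^esub> cls t b"
        using clsD(2)[OF fZ bZ] x fb fZ bZ cocycD(3) by simp
      also have "\<dots> = cls t f" using cls_zero_iff[OF bZ] fb(2) clsI[OF fZ] by simp
      finally have y: "y = cls t f" .
      \<comment> \<open>The cocycles whose class lies in the span of the classes of
        \<open>F\<close>. As a submodule of \<open>Q t\<close> containing \<open>F\<close>, it
        contains \<open>f\<close>.\<close>
      let ?S = "{x \<in> cocyc t. cls t x \<in> mod_span R (coho t) (cls t ` F)}"
      have FH: "cls t ` F \<subseteq> carrier (coho t)" using F(2) clsI by blast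
      note spD = H.submoduleD[OF mod_span_submodule[OF coho_module FH]]
      have "submodule ?S R (Q t)"
      proof (rule Q.submoduleI_closed)
        show "?S \<subseteq> carrier (Q t)" using cocycD(1) by blast
        show "\<zero>\<^bsub>Q t\<^esub> \<in> ?S" using cls_zero_iff[OF cocycD(2)] coboundD(2) cocycD(2) spD(2) by simp
        show "u \<oplus>\<^bsub>Q t\<^esub> v \<in> ?S" if "u \<in> ?S" "v \<in> ?S" for u v
          using clsD(2)[of u t v] cocycD(3)[of u t v] that spD(3) by simp
        show "r \<odot>\<^bsub>Q t\<^esub> u \<in> ?S" if "r \<in> carrier R" "u \<in> ?S" for r u
          using cls_sm[of r u] cocycD(6)[of r u t] that spD(6) by (simp flip: cls_sm)
      qed
      moreover have "F \<subseteq> ?S" using F(2) mod_span_superset[of "cls t ` F" R "coho t"] by blast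
      ultimately have "f \<in> ?S" using mod_span_least fb(1) by blast
      then show "y \<in> mod_span R (coho t) (cls t ` F)" using y by simp
    qed
  qed (use F(1) a(3) in auto)
qed

end

subsection \<open>Endomorphisms of the injective hull of the residue field\<close>

locale matlis =
  fixes R :: "('a, 'm) ring_scheme" and \<mm> :: "'a set" and E :: "('a, 'e) module" and \<iota> :: "'a set \<Rightarrow> 'e"
  assumes local: "noetherian_local_ring R \<mm>" and complete: "adically_complete R \<mm>"
    and hull: "injective_hull R (residue_module R \<mm>) E \<iota>"
begin

lemma R_cring: "cring R" and R_noeth: "noetherian_ring R"
  using local by (auto simp: noetherian_local_ring_def)

sublocale R: noetherian_ring R by (rule R_noeth)
sublocale R: cring R by (rule R_cring)

lemma mm_maximal: "maximalideal \<mm> R"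
  using local by (simp add: noetherian_local_ring_def)

lemma mm_ideal: "ideal \<mm> R"
  using mm_maximal by (rule maximalideal.axioms(1))

lemmas mmD = R.idealD[OF mm_ideal]

lemma one_notin_mm: "\<one>\<^bsub>R\<^esub> \<notin> \<mm>"
proof
  assume "\<one>\<^bsub>R\<^esub> \<in> \<mm>"
  then have "carrier R \<subseteq> \<mm>" using mmD(5)[of _ "\<one>\<^bsub>R\<^esub>"] by force
  then show False using maximalideal.I_notcarr[OF mm_maximal] mmD(1) by blast
qed

lemma proper_ideal_subset:
  assumes a: "ideal a R" "a \<noteq> carrier R"
  shows "a \<subseteq> \<mm>"
proof -
  obtain b where b: "ideal b R" "a \<subseteq> b \<and> b \<noteq> carrier R"
    and max: "\<And>c. ideal c R \<Longrightarrow> a \<subseteq> c \<and> c \<noteq> carrier R \<Longrightarrow> b \<subseteq> c \<Longrightarrow> c = b"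
    by (rule R.ideal_maximal[OF a(1), of "\<lambda>b. a \<subseteq> b \<and> b \<noteq> carrier R"]) (use a(2) in simp, simp)
  have "maximalideal b R"
    using b max by (intro maximalidealI) auto
  then have "b = \<mm>" using local by (simp add: noetherian_local_ring_def)
  then show ?thesis using b by simp
qed

lemma bezout_mm:
  assumes "r \<in> carrier R" "r \<notin> \<mm>"
  obtains l s where "l \<in> \<mm>" "s \<in> carrier R" "\<one>\<^bsub>R\<^esub> = l \<oplus>\<^bsub>R\<^esub> s \<otimes>\<^bsub>R\<^esub> r"
proof -
  note adj = R.adjoin_ideal[OF mm_ideal assms(1)] R.adjoin_superset[OF mm_ideal assms(1)]
  have "\<not> adjoin R \<mm> r \<subseteq> \<mm>" using adj(3) assms(2) by blast
  then have "adjoin R \<mm> r = carrier R" using proper_ideal_subset[OF adj(1)] by blast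
  then have "\<one>\<^bsub>R\<^esub> \<in> adjoin R \<mm> r" by simp
  then show ?thesis using that by (auto simp: adjoin_def)
qed

lemma E_injective: "injective_module R E"
  using hull by (simp add: injective_hull_def)

lemma E_module: "module R E"
  using E_injective by (simp add: injective_module_def)

sublocale E: module R E by (rule E_module)

lemma RR_module: "module R (ring_as_module R)"
  by (rule R.module_ring_as_module)

sublocale RR: module R "ring_as_module R" by (rule RR_module)

text \<open>The composite \<open>R \<rightarrow> R/\<mm> \<rightarrow> E\<close>, through which the
  copy of the residue field in \<open>E\<close> is handled by ring elements.\<close>

definition soc :: "'a \<Rightarrow> 'e"
  where "soc = (\<lambda>r\<in>carrier R. \<iota> (\<mm> +>\<^bsub>ring_as_module R\<^esub> r))"

lemma mm_submodule: "submodule \<mm> R (ring_as_module R)"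
  using mm_ideal by (simp add: R.ideal_iff_submodule)

lemma soc_hom: "soc \<in> mod_hom R (ring_as_module R) E"
proof -
  have "\<iota> \<in> mod_hom R (quot_module (ring_as_module R) \<mm>) E"
    using hull by (simp add: injective_hull_def residue_module_def)
  from mod_hom_comp[OF RR_module quot_proj_hom[OF RR_module mm_submodule] this]
  show ?thesis by (simp add: soc_def cong: restrict_cong)
qed

lemmas socD = mod_homD[OF soc_hom, simplified]

lemma soc_image: "soc ` carrier R = \<iota> ` carrier (residue_module R \<mm>)"
  by (auto simp: soc_def residue_module_def quot_module_carrier)

lemma soc_zero_iff:
  assumes r: "r \<in> carrier R"
  shows "soc r = \<zero>\<^bsub>E\<^esub> \<longleftrightarrow> r \<in> \<mm>"
proof -
  let ?c = "\<lambda>r. \<mm> +>\<^bsub>ring_as_module R\<^esub> r"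
  have inj: "inj_on \<iota> (carrier (quot_module (ring_as_module R) \<mm>))"
    using hull by (simp add: injective_hull_def residue_module_def)
  have "soc \<zero>\<^bsub>R\<^esub> = \<zero>\<^bsub>E\<^esub>"
    using mod_hom_zero_minus(1)[OF RR_module E_module soc_hom] by simp
  then have "soc r = \<zero>\<^bsub>E\<^esub> \<longleftrightarrow> \<iota> (?c r) = \<iota> (?c \<zero>\<^bsub>R\<^esub>)" using r by (simp add: soc_def)
  also have "\<dots> \<longleftrightarrow> ?c r = ?c \<zero>\<^bsub>R\<^esub>"
    using r by (intro inj_on_eq_iff[OF inj]) (auto simp: quot_module_carrier)
  also have "\<dots> \<longleftrightarrow> r \<in> \<mm>"
    using RR.coset_eq_iff[OF mm_submodule, of r "\<zero>\<^bsub>R\<^esub>"] RR.M.minus_zero_right[of r] r by simp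
  finally show ?thesis .
qed

lemma essential:
  assumes x: "x \<in> carrier E" "x \<noteq> \<zero>\<^bsub>E\<^esub>"
  obtains r s where "r \<in> carrier R" "s \<in> carrier R" "r \<odot>\<^bsub>E\<^esub> x = soc s" "r \<odot>\<^bsub>E\<^esub> x \<noteq> \<zero>\<^bsub>E\<^esub>"
proof -
  let ?N = "(\<lambda>r\<in>carrier (ring_as_module R). r \<odot>\<^bsub>E\<^esub> x) ` carrier (ring_as_module R)"
  have N: "submodule ?N R E"
    by (rule image_submodule[OF RR_module E_module orbit_hom[OF E_module x(1)] RR.carrier_is_submodule])
  have "x \<in> ?N" using x by (intro image_eqI[of _ _ "\<one>\<^bsub>R\<^esub>"]) auto
  then have "?N \<noteq> {\<zero>\<^bsub>E\<^esub>}" using x(2) by blast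
  then have "?N \<inter> soc ` carrier R \<noteq> {\<zero>\<^bsub>E\<^esub>}"
    using hull N unfolding injective_hull_def soc_image by blast
  moreover have "\<zero>\<^bsub>E\<^esub> \<in> ?N \<inter> soc ` carrier R"
    using E.submoduleD(2)[OF N] soc_zero_iff[of "\<zero>\<^bsub>R\<^esub>"] mmD(2) by (metis IntI R.zero_closed imageI)
  ultimately obtain y where "y \<in> ?N" "y \<in> soc ` carrier R" "y \<noteq> \<zero>\<^bsub>E\<^esub>" by blast
  then show ?thesis using that by auto
qed

lemma mm_soc: "l \<in> \<mm> \<Longrightarrow> s \<in> carrier R \<Longrightarrow> l \<odot>\<^bsub>E\<^esub> soc s = \<zero>\<^bsub>E\<^esub>"
  using socD(3)[of l s] soc_zero_iff[of "l \<otimes>\<^bsub>R\<^esub> s"] mmD(1,6) by simp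

text \<open>If \<open>\<mm>\<close> kills a nonzero \<open>v\<close>, a multiple \<open>r v\<close>
  is a nonzero element of the residue field. Then \<open>r\<close> is outside \<open>\<mm>\<close>
  and invertible modulo \<open>\<mm>\<close>, so \<open>v\<close> itself lies in the residue field,
  a space of dimension one.\<close>

lemma socle_cyclic:
  assumes u: "u \<in> ann_in E \<mm>" "u \<noteq> \<zero>\<^bsub>E\<^esub>" and e: "e \<in> ann_in E \<mm>"
  obtains c where "c \<in> carrier R" "e = c \<odot>\<^bsub>E\<^esub> u"
proof -
  have soc_of: "\<exists>q\<in>carrier R. v = soc q" if v: "v \<in> ann_in E \<mm>" "v \<noteq> \<zero>\<^bsub>E\<^esub>" for v
  proof -
    have vE: "v \<in> carrier E" using v by (simp add: ann_in_def)
    obtain r s where rs: "r \<in> carrier R" "s \<in> carrier R" "r \<odot>\<^bsub>E\<^esub> v = soc s" "r \<odot>\<^bsub>E\<^esub> v \<noteq> \<zero>\<^bsub>E\<^esub>"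
      by (rule essential[OF vE v(2)])
    have "r \<notin> \<mm>" using rs(4) v by (auto simp: ann_in_def)
    then obtain l r' where l: "l \<in> \<mm>" "r' \<in> carrier R" "\<one>\<^bsub>R\<^esub> = l \<oplus>\<^bsub>R\<^esub> r' \<otimes>\<^bsub>R\<^esub> r"
      by (rule bezout_mm[OF rs(1)])
    have "v = (l \<oplus>\<^bsub>R\<^esub> r' \<otimes>\<^bsub>R\<^esub> r) \<odot>\<^bsub>E\<^esub> v" using vE by (simp flip: l(3))
    also have "\<dots> = l \<odot>\<^bsub>E\<^esub> v \<oplus>\<^bsub>E\<^esub> r' \<odot>\<^bsub>E\<^esub> soc s"
      using l(1,2) mmD(1) rs(1,3) vE by (simp add: E.smult_l_distr E.smult_assoc1)
    also have "\<dots> = soc (r' \<otimes>\<^bsub>R\<^esub> s)"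
      using l v rs socD by (simp add: ann_in_def)
    finally show ?thesis using l rs by blast
  qed
  obtain q where q: "q \<in> carrier R" "u = soc q" using soc_of[OF u] by blast
  have "q \<notin> \<mm>" using u(2) q soc_zero_iff by blast
  then obtain l s where l: "l \<in> \<mm>" "s \<in> carrier R" "\<one>\<^bsub>R\<^esub> = l \<oplus>\<^bsub>R\<^esub> s \<otimes>\<^bsub>R\<^esub> q"
    by (rule bezout_mm[OF q(1)])
  have "soc \<one>\<^bsub>R\<^esub> = soc l \<oplus>\<^bsub>E\<^esub> s \<odot>\<^bsub>E\<^esub> soc q"
    using l mmD(1) q(1) socD(2)[of l "s \<otimes>\<^bsub>R\<^esub> q"] socD(3)[of s q] by simp
  then have 1: "soc \<one>\<^bsub>R\<^esub> = s \<odot>\<^bsub>E\<^esub> u" using soc_zero_iff[of l] l mmD(1) q socD(1) by simp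
  show ?thesis
  proof (cases "e = \<zero>\<^bsub>E\<^esub>")
    case True
    then show ?thesis using that[of "\<zero>\<^bsub>R\<^esub>"] u by (simp add: ann_in_def)
  next
    case False
    then obtain p where p: "p \<in> carrier R" "e = soc p" using soc_of[OF e] by blast
    have "e = p \<odot>\<^bsub>E\<^esub> soc \<one>\<^bsub>R\<^esub>" using socD(3)[of p "\<one>\<^bsub>R\<^esub>"] p by simp
    also have "\<dots> = (p \<otimes>\<^bsub>R\<^esub> s) \<odot>\<^bsub>E\<^esub> u" using 1 p l u by (simp add: E.smult_assoc1 ann_in_def)
    finally show ?thesis using that p l by blast
  qed
qed

text \<open>The annihilator of a nonzero \<open>x\<close> is proper and so lies in
  \<open>\<mm>\<close>; hence \<open>r x \<mapsto> soc r\<close> is well defined on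
  \<open>Rx\<close>, is nonzero at \<open>x\<close> and extends by injectivity of
  \<open>E\<close>.\<close>

lemma cogenerator:
  assumes N: "module R N" and x: "x \<in> carrier N" "x \<noteq> \<zero>\<^bsub>N\<^esub>"
  obtains f where "f \<in> mod_hom R N E" "f x \<noteq> \<zero>\<^bsub>E\<^esub>"
proof -
  interpret N: module R N by (rule N)
  let ?\<phi> = "\<lambda>r\<in>carrier (ring_as_module R). r \<odot>\<^bsub>N\<^esub> x"
  have "{r \<in> carrier R. r \<odot>\<^bsub>N\<^esub> x = \<zero>\<^bsub>N\<^esub>} \<noteq> carrier R"
    using x N.smult_one[OF x(1)] R.one_closed by (metis (mono_tags, lifting) mem_Collect_eq)
  then have le: "{r \<in> carrier R. r \<odot>\<^bsub>N\<^esub> x = \<zero>\<^bsub>N\<^esub>} \<subseteq> \<mm>"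
    by (rule proper_ideal_subset[OF N.ann_ideal[OF x(1)]])
  have ker: "soc r = \<zero>\<^bsub>E\<^esub>" if "r \<in> carrier (ring_as_module R)" "?\<phi> r = \<zero>\<^bsub>N\<^esub>" for r
  proof -
    have "r \<in> \<mm>" using that le by auto
    then show ?thesis using that soc_zero_iff by simp
  qed
  obtain f where f: "f \<in> mod_hom R N E" "\<And>r. r \<in> carrier (ring_as_module R) \<Longrightarrow> f (?\<phi> r) = soc r"
    using injective_factor[OF E_injective N RR_module RR.carrier_is_submodule orbit_hom[OF N x(1)] soc_hom ker]
    by blast
  have "f x = soc \<one>\<^bsub>R\<^esub>" using f(2)[of "\<one>\<^bsub>R\<^esub>"] x by simp
  then show ?thesis using that f(1) soc_zero_iff[of "\<one>\<^bsub>R\<^esub>"] one_notin_mm by simp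
qed

section \<open>Powers of the maximal ideal and the endomorphisms of \<open>E\<close>\<close>

abbreviation "mpow n \<equiv> ideal_power R \<mm> n"

lemma mpow_ideal: "ideal (mpow n) R"
  by (rule R.ideal_power_ideal[OF mm_ideal])

text \<open>Take an ideal \<open>K\<close> containing a power of \<open>\<mm>\<close> that meets
  \<open>?L\<close>, the multipliers taking \<open>x\<close> into the socle, only in the annihilator
  of \<open>x\<close>. If some \<open>k\<close> in \<open>K\<close> had
  \<open>k x \<noteq> 0\<close>, essentiality would give \<open>r\<close> with \<open>r k x\<close>
  nonzero in the socle, so \<open>r k\<close> would lie in \<open>K \<inter> ?L\<close> without
  killing \<open>x\<close>.\<close>

lemma E_torsion:
  assumes x: "x \<in> carrier E"
  obtains n where "x \<in> ann_in E (mpow n)"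
proof -
  let ?c = "{r \<in> carrier R. r \<odot>\<^bsub>E\<^esub> x = \<zero>\<^bsub>E\<^esub>}"
  have c: "ideal ?c R" by (rule E.ann_ideal[OF x])
  let ?L = "{l \<in> carrier R. \<forall>s\<in>\<mm>. s \<odot>\<^bsub>E\<^esub> (l \<odot>\<^bsub>E\<^esub> x) = \<zero>\<^bsub>E\<^esub>}"
  have "s \<odot>\<^bsub>E\<^esub> ((r \<otimes>\<^bsub>R\<^esub> l) \<odot>\<^bsub>E\<^esub> x) = r \<odot>\<^bsub>E\<^esub> (s \<odot>\<^bsub>E\<^esub> (l \<odot>\<^bsub>E\<^esub> x))"
    if "s \<in> \<mm>" "r \<in> carrier R" "l \<in> carrier R" for s r l
    using that mmD(1) x by (simp add: E.smult_assoc1 E.smult_comm[of s r])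
  then have L: "ideal ?L R"
    using mmD(1) x by (intro R.idealI_closed) (auto simp: E.smult_l_distr E.smult_r_distr)
  have "?c \<subseteq> ?L" using mmD(1) by auto
  moreover have "s \<otimes>\<^bsub>R\<^esub> l \<in> ?c" if "s \<in> \<mm>" "l \<in> ?L" for s l
    using that mmD(1) x by (simp add: E.smult_assoc1)
  ultimately obtain K n where K: "ideal K R" "?c \<subseteq> K" "K \<inter> ?L \<subseteq> ?c" "mpow n \<subseteq> K"
    using R.ideal_power_complement[OF R_cring c L mm_ideal] by (metis (no_types, lifting))
  have "k \<odot>\<^bsub>E\<^esub> x = \<zero>\<^bsub>E\<^esub>" if k: "k \<in> K" for k
  proof (rule ccontr)
    assume ne: "k \<odot>\<^bsub>E\<^esub> x \<noteq> \<zero>\<^bsub>E\<^esub>"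
    have kR: "k \<in> carrier R" by (rule R.idealD(1)[OF K(1) k])
    then have "k \<odot>\<^bsub>E\<^esub> x \<in> carrier E" using x by simp
    then obtain r s where rs: "r \<in> carrier R" "s \<in> carrier R" "r \<odot>\<^bsub>E\<^esub> (k \<odot>\<^bsub>E\<^esub> x) = soc s"
      "r \<odot>\<^bsub>E\<^esub> (k \<odot>\<^bsub>E\<^esub> x) \<noteq> \<zero>\<^bsub>E\<^esub>" by (rule essential[OF _ ne])
    have rk: "(r \<otimes>\<^bsub>R\<^esub> k) \<odot>\<^bsub>E\<^esub> x = r \<odot>\<^bsub>E\<^esub> (k \<odot>\<^bsub>E\<^esub> x)" using rs kR x by (simp add: E.smult_assoc1)
    then have "r \<otimes>\<^bsub>R\<^esub> k \<in> ?L" using rs kR mm_soc by simp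
    then have "r \<otimes>\<^bsub>R\<^esub> k \<in> ?c" using K(3) R.idealD(5)[OF K(1) rs(1) k] by blast
    then show False using rk rs(4) by simp
  qed
  then have "x \<in> ann_in E (mpow n)" using K(4) x by (auto simp: ann_in_def)
  then show ?thesis by (rule that)
qed

text \<open>Descending from \<open>b + Rx\<close> to \<open>b\<close> with \<open>\<mm>x \<subseteq> b\<close>: if \<open>\<theta>\<close> is multiplication by \<open>r\<close> on
  \<open>(0 :\<^sub>E b + Rx)\<close>, then \<open>\<theta> - r\<close> on \<open>(0 :\<^sub>E b)\<close> factors through multiplication by \<open>x\<close> as a map from the
  socle to the socle, and the socle is one-dimensional.\<close>

lemma endo_on_ann:
  assumes \<theta>: "\<theta> \<in> mod_hom R E E"
  shows "\<exists>r\<in>carrier R. \<forall>e\<in>ann_in E (mpow n). \<theta> e = r \<odot>\<^bsub>E\<^esub> e"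
proof (rule ccontr)
  let ?good = "\<lambda>b. \<exists>r\<in>carrier R. \<forall>e\<in>ann_in E b. \<theta> e = r \<odot>\<^bsub>E\<^esub> e"
  note \<theta>D = mod_homD[OF \<theta>]
  assume neg: "\<not> ?thesis"
  \<comment> \<open>Noetherian induction over all ideals that contain the given power of
    \<open>\<mm>\<close>: \<open>b\<close> is a maximal ideal for which the claim fails.\<close>
  obtain b where b: "ideal b R" "mpow n \<subseteq> b \<and> \<not> ?good b"
    and max: "\<And>c. ideal c R \<Longrightarrow> mpow n \<subseteq> c \<and> \<not> ?good c \<Longrightarrow> b \<subseteq> c \<Longrightarrow> c = b"
    by (rule R.ideal_maximal[OF mpow_ideal[of n], of "\<lambda>b. mpow n \<subseteq> b \<and> \<not> ?good b"]) (use neg in simp, simp)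
  note bD = R.idealD[OF b(1)]
  have "?good (carrier R)"
  proof (intro bexI ballI)
    fix e assume "e \<in> ann_in E (carrier R)"
    then have "\<one>\<^bsub>R\<^esub> \<odot>\<^bsub>E\<^esub> e = \<zero>\<^bsub>E\<^esub>" "e \<in> carrier E" by (auto simp: ann_in_def)
    then show "\<theta> e = \<zero>\<^bsub>R\<^esub> \<odot>\<^bsub>E\<^esub> e" using mod_hom_zero_minus(1)[OF E_module E_module \<theta>] by simp
  qed simp
  then have bR: "\<not> carrier R \<subseteq> b" using b bD(1) by (metis subsetI subset_antisym)
  \<comment> \<open>An element \<open>x\<close> of \<open>\<mm>^(k-1)\<close> outside
    \<open>b\<close> satisfies \<open>\<mm> x \<subseteq> \<mm>^k \<subseteq> b\<close>.\<close>
  define k where "k = (LEAST k. mpow k \<subseteq> b)"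
  have k: "mpow k \<subseteq> b" unfolding k_def by (rule LeastI[of _ n]) (use b in simp)
  have "k \<noteq> 0" using bR k by (metis R.ideal_power_0)
  then obtain j where j: "k = Suc j" by (cases k) auto
  have "\<not> mpow j \<subseteq> b" using not_less_Least[of j "\<lambda>k. mpow k \<subseteq> b"] j k_def by simp
  then obtain x where x: "x \<in> mpow j" "x \<notin> b" by blast
  have xR: "x \<in> carrier R" by (rule R.idealD(1)[OF mpow_ideal x(1)])
  have mx: "s \<otimes>\<^bsub>R\<^esub> x \<in> b" if "s \<in> \<mm>" for s
  proof -
    have "x \<otimes>\<^bsub>R\<^esub> s \<in> mpow j \<cdot>\<^bsub>R\<^esub> \<mm>" using x(1) that by (rule ideal_prod.prod)
    then show ?thesis using k mmD(1)[OF that] xR unfolding j R.ideal_power_Suc by (auto simp: R.m_comm)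
  qed
  let ?b' = "adjoin R b x"
  have b': "ideal ?b' R" "b \<subseteq> ?b'" "x \<in> ?b'"
    using R.adjoin_ideal[OF b(1) xR] R.adjoin_superset[OF b(1) xR] by auto
  have "?good ?b'" using max[OF b'(1)] b b' x(2) by blast
  then obtain r where r: "r \<in> carrier R" "\<And>e. e \<in> ann_in E ?b' \<Longrightarrow> \<theta> e = r \<odot>\<^bsub>E\<^esub> e" by blast
  have ann': "e \<in> ann_in E ?b'" if "e \<in> ann_in E b" "x \<odot>\<^bsub>E\<^esub> e = \<zero>\<^bsub>E\<^esub>" for e
    using that xR bD(1) by (auto simp: ann_in_def adjoin_def E.smult_l_distr E.smult_assoc1)
  have annb: "e \<in> carrier E" if "e \<in> ann_in E b" for e using that by (simp add: ann_in_def)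
  note annD = E.submoduleD[OF submodule_ann_in[OF E_module]]
  have b_sub: "b \<subseteq> carrier R" using bD(1) by blast
  show False
  proof (cases "\<forall>e\<in>ann_in E b. x \<odot>\<^bsub>E\<^esub> e = \<zero>\<^bsub>E\<^esub>")
    case True
    then show False using b(2) r ann' by blast
  next
    case False
    then obtain e0 where e0: "e0 \<in> ann_in E b" "x \<odot>\<^bsub>E\<^esub> e0 \<noteq> \<zero>\<^bsub>E\<^esub>" by blast
    have e0E: "e0 \<in> carrier E" by (rule annb[OF e0(1)])
    define u where "u = x \<odot>\<^bsub>E\<^esub> e0"
    have xm: "x \<odot>\<^bsub>E\<^esub> (s \<odot>\<^bsub>E\<^esub> e) = \<zero>\<^bsub>E\<^esub>" if "s \<in> \<mm>" "e \<in> ann_in E b" for s e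
      using mx[OF that(1)] that(2) mmD(1)[OF that(1)] xR E.smult_assoc1[of s x e] E.smult_comm[of x s e]
      by (auto simp: ann_in_def)
    have xe: "x \<odot>\<^bsub>E\<^esub> e \<in> ann_in E \<mm>" if e: "e \<in> ann_in E b" for e
    proof -
      have "s \<odot>\<^bsub>E\<^esub> (x \<odot>\<^bsub>E\<^esub> e) = \<zero>\<^bsub>E\<^esub>" if s: "s \<in> \<mm>" for s
        using E.smult_comm[OF mmD(1)[OF s] xR annb[OF e]] xm[OF s e] by simp
      then show ?thesis using annb[OF e] xR by (simp add: ann_in_def)
    qed
    have u: "u \<in> ann_in E \<mm>" "u \<noteq> \<zero>\<^bsub>E\<^esub>"
      using xe[OF e0(1)] e0(2) by (simp_all add: u_def)
    \<comment> \<open>\<open>f = \<theta> - r\<close> vanishes on \<open>(0 : b + Rx)\<close>. Since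
      \<open>\<mm> x \<subseteq> b\<close>, the elements of \<open>\<mm> e0\<close> lie there, so
      \<open>f e0\<close> is in the socle and is a multiple \<open>q u\<close> of
      \<open>u = x e0\<close>.\<close>
    define f where "f e = \<theta> e \<ominus>\<^bsub>E\<^esub> r \<odot>\<^bsub>E\<^esub> e" for e
    have f_cl: "f e \<in> carrier E" if "e \<in> carrier E" for e using that r \<theta>D by (simp add: f_def)
    have f_add: "f (e \<oplus>\<^bsub>E\<^esub> e') = f e \<oplus>\<^bsub>E\<^esub> f e'" if "e \<in> carrier E" "e' \<in> carrier E" for e e'
      using that r \<theta>D by (simp add: f_def E.module_simprules)
    have f_sm: "f (s \<odot>\<^bsub>E\<^esub> e) = s \<odot>\<^bsub>E\<^esub> f e" if "s \<in> carrier R" "e \<in> carrier E" for s e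
      using that r \<theta>D E.smult_comm[of r s e] by (simp add: f_def E.module_simprules)
    have f0: "f e = \<zero>\<^bsub>E\<^esub>" if "e \<in> ann_in E ?b'" for e
      using r(2)[OF that] r(1) that by (simp add: f_def E.diff_zero_iff ann_in_def)
    have "f e0 \<in> ann_in E \<mm>"
    proof -
      have "s \<odot>\<^bsub>E\<^esub> f e0 = \<zero>\<^bsub>E\<^esub>" if s: "s \<in> \<mm>" for s
      proof -
        have "s \<odot>\<^bsub>E\<^esub> e0 \<in> ann_in E ?b'"
          using annD(6)[OF b_sub mmD(1)[OF s] e0(1)] xm[OF s e0(1)] by (rule ann')
        then show ?thesis using f0 f_sm[OF mmD(1)[OF s] e0E] by simp
      qed
      then show ?thesis using f_cl[OF e0E] by (simp add: ann_in_def)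
    qed
    then obtain q where q: "q \<in> carrier R" "f e0 = q \<odot>\<^bsub>E\<^esub> u" by (rule socle_cyclic[OF u])
    \<comment> \<open>With \<open>x e = c u\<close>, the difference \<open>z = e - c e0\<close> is
      killed by \<open>b\<close> and by \<open>x\<close>, so \<open>f z = 0\<close>. Hence
      \<open>f e = c q u = q x e\<close>, which makes \<open>\<theta>\<close> multiplication by
      \<open>r + q x\<close> on \<open>(0 : b)\<close>.\<close>
    have "\<theta> e = (r \<oplus>\<^bsub>R\<^esub> q \<otimes>\<^bsub>R\<^esub> x) \<odot>\<^bsub>E\<^esub> e" if e: "e \<in> ann_in E b" for e
    proof -
      have eE: "e \<in> carrier E" by (rule annb[OF e])
      obtain c where c: "c \<in> carrier R" "x \<odot>\<^bsub>E\<^esub> e = c \<odot>\<^bsub>E\<^esub> u" by (rule socle_cyclic[OF u xe[OF e]])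
      define z where "z = e \<ominus>\<^bsub>E\<^esub> c \<odot>\<^bsub>E\<^esub> e0"
      have zE: "z \<in> carrier E" using eE c e0E by (simp add: z_def)
      have "x \<odot>\<^bsub>E\<^esub> z = x \<odot>\<^bsub>E\<^esub> e \<ominus>\<^bsub>E\<^esub> c \<odot>\<^bsub>E\<^esub> u"
        unfolding z_def u_def using eE c(1) e0E xR E.smult_comm[of x c e0] by (simp add: E.module_simprules)
      then have "x \<odot>\<^bsub>E\<^esub> z = \<zero>\<^bsub>E\<^esub>" using c u by (simp add: E.diff_zero_iff ann_in_def)
      moreover have "z \<in> ann_in E b"
        unfolding z_def using annD(4)[OF b_sub e annD(6)[OF b_sub c(1) e0(1)]] .
      ultimately have "f z = \<zero>\<^bsub>E\<^esub>" by (intro f0 ann')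
      moreover have "e = z \<oplus>\<^bsub>E\<^esub> c \<odot>\<^bsub>E\<^esub> e0" unfolding z_def using eE c(1) e0E by (simp add: E.module_simprules)
      ultimately have "f e = c \<odot>\<^bsub>E\<^esub> (q \<odot>\<^bsub>E\<^esub> u)"
        using f_add[OF zE, of "c \<odot>\<^bsub>E\<^esub> e0"] f_sm[OF c(1) e0E] c(1) e0E q u f_cl by (simp add: ann_in_def)
      also have "\<dots> = q \<odot>\<^bsub>E\<^esub> (x \<odot>\<^bsub>E\<^esub> e)"
        using c q u by (simp add: E.smult_comm[of c q] ann_in_def)
      finally have fe: "f e = q \<odot>\<^bsub>E\<^esub> (x \<odot>\<^bsub>E\<^esub> e)" .
      have "\<theta> e = r \<odot>\<^bsub>E\<^esub> e \<oplus>\<^bsub>E\<^esub> f e" unfolding f_def using r(1) eE \<theta>D(1)[OF eE] by (simp add: E.module_simprules)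
      then show ?thesis using fe r(1) q(1) xR eE by (simp add: E.smult_l_distr E.smult_assoc1)
    qed
    then have "?good b" using r(1) q(1) xR by (intro bexI[of _ "r \<oplus>\<^bsub>R\<^esub> q \<otimes>\<^bsub>R\<^esub> x"]) auto
    then show False using b(2) by blast
  qed
qed

lemma mpow_submodule: "submodule (mpow n) R (ring_as_module R)"
  using mpow_ideal by (simp add: R.ideal_iff_submodule)

lemma mpow_coset_eq_iff:
  assumes "r \<in> carrier R" "s \<in> carrier R"
  shows "mpow n +>\<^bsub>R\<^esub> r = mpow n +>\<^bsub>R\<^esub> s \<longleftrightarrow> r \<ominus>\<^bsub>R\<^esub> s \<in> mpow n"
proof -
  have "mpow n +>\<^bsub>R\<^esub> x = mpow n +>\<^bsub>ring_as_module R\<^esub> x" for x by (simp add: a_r_coset_def')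
  then show ?thesis
    using RR.coset_eq_iff[OF mpow_submodule, of r s n] assms by (simp add: a_minus_def)
qed

text \<open>For \<open>r\<close> outside \<open>\<mm>^n\<close>, a map \<open>f\<close> from
  \<open>R/\<mm>^n\<close> to \<open>E\<close> that is nonzero at the class of \<open>r\<close>
  exists by \<open>cogenerator\<close>. The image \<open>e\<close> of one is killed by
  \<open>\<mm>^n\<close>, and \<open>r e = f r\<close> is nonzero.\<close>

lemma ann_ann_mpow:
  assumes r: "r \<in> carrier R" and kill: "\<And>e. e \<in> ann_in E (mpow n) \<Longrightarrow> r \<odot>\<^bsub>E\<^esub> e = \<zero>\<^bsub>E\<^esub>"
  shows "r \<in> mpow n"
proof (rule ccontr)
  assume rn: "r \<notin> mpow n"
  let ?N = "quot_module (ring_as_module R) (mpow n)" and ?c = "\<lambda>r. mpow n +>\<^bsub>ring_as_module R\<^esub> r"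
  have N: "module R ?N" by (rule quot_module_module[OF RR_module mpow_submodule])
  have c_zero: "?c s = \<zero>\<^bsub>?N\<^esub> \<longleftrightarrow> s \<in> mpow n" if "s \<in> carrier R" for s
    using RR.coset_eq_iff[OF mpow_submodule, of s "\<zero>\<^bsub>R\<^esub>" n] RR.M.minus_zero_right[of s] that
      quot_module_simps(3)[OF RR_module mpow_submodule[of n]] by simp
  have c_cl: "?c s \<in> carrier ?N" if "s \<in> carrier R" for s using that by (auto simp: quot_module_carrier)
  obtain f where f: "f \<in> mod_hom R ?N E" "f (?c r) \<noteq> \<zero>\<^bsub>E\<^esub>"
    by (rule cogenerator[OF N c_cl[OF r]]) (use c_zero[OF r] rn in auto)
  define e where "e = f (?c \<one>\<^bsub>R\<^esub>)"
  have se: "s \<odot>\<^bsub>E\<^esub> e = f (?c s)" if "s \<in> carrier R" for s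
    using mod_homD(3)[OF f(1) that c_cl[OF R.one_closed]]
      quot_module_simps(2)[OF RR_module mpow_submodule[of n] that, of "\<one>\<^bsub>R\<^esub>"] that by (simp add: e_def)
  have "e \<in> carrier E" using mod_homD(1)[OF f(1) c_cl[OF R.one_closed]] by (simp add: e_def)
  moreover have "s \<odot>\<^bsub>E\<^esub> e = \<zero>\<^bsub>E\<^esub>" if "s \<in> mpow n" for s
  proof -
    have sR: "s \<in> carrier R" by (rule R.idealD(1)[OF mpow_ideal that])
    have "?c s = \<zero>\<^bsub>?N\<^esub>" using c_zero[OF sR] that by simp
    then show ?thesis using se[OF sR] mod_hom_zero_minus(1)[OF N E_module f(1)] by simp
  qed
  ultimately have "e \<in> ann_in E (mpow n)" by (simp add: ann_in_def)
  then show False using kill se[OF r] f(2) by simp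
qed

text \<open>By \<open>ann_ann_mpow\<close> such an \<open>r\<close> lies in all powers of
  \<open>\<mm>\<close>; injectivity of the canonical map to the completion makes it zero.\<close>

lemma E_faithful:
  assumes r: "r \<in> carrier R" and kill: "\<And>e. e \<in> carrier E \<Longrightarrow> r \<odot>\<^bsub>E\<^esub> e = \<zero>\<^bsub>E\<^esub>"
  shows "r = \<zero>\<^bsub>R\<^esub>"
proof -
  have "r \<in> mpow n" for n using kill by (intro ann_ann_mpow r) (simp add: ann_in_def)
  then have "(\<lambda>n. mpow n +>\<^bsub>R\<^esub> r) = (\<lambda>n. mpow n +>\<^bsub>R\<^esub> \<zero>\<^bsub>R\<^esub>)"
    using mpow_coset_eq_iff[OF r R.zero_closed] r by (simp add: R.minus_zero_right)
  moreover have "inj_on (\<lambda>r n. mpow n +>\<^bsub>R\<^esub> r) (carrier R)"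
    using complete unfolding adically_complete_def by (rule bij_betw_imp_inj_on)
  ultimately show ?thesis using r by (auto dest: inj_onD)
qed

text \<open>The multipliers on the layers \<open>(0 : \<mm>^n)\<close> are determined modulo
  \<open>\<mm>^n\<close>, so they form a compatible sequence of cosets, and completeness provides a
  common \<open>r\<close>. The layers exhaust \<open>E\<close> by \<open>E_torsion\<close>.\<close>

theorem endo_E:
  assumes \<theta>: "\<theta> \<in> mod_hom R E E"
  obtains r where "r \<in> carrier R" "\<And>e. e \<in> carrier E \<Longrightarrow> \<theta> e = r \<odot>\<^bsub>E\<^esub> e"
proof -
  have "\<forall>n. \<exists>r. r \<in> carrier R \<and> (\<forall>e\<in>ann_in E (mpow n). \<theta> e = r \<odot>\<^bsub>E\<^esub> e)"
    using endo_on_ann[OF \<theta>] by blast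
  from choice[OF this] obtain \<rho> where \<rho>: "\<And>n. \<rho> n \<in> carrier R"
    "\<And>n e. e \<in> ann_in E (mpow n) \<Longrightarrow> \<theta> e = \<rho> n \<odot>\<^bsub>E\<^esub> e" by blast
  have mono: "mpow (Suc n) \<subseteq> mpow n" for n by (rule R.ideal_power_antimono[OF mm_ideal]) simp
  have step: "\<rho> (Suc n) \<ominus>\<^bsub>R\<^esub> \<rho> n \<in> mpow n" for n
  proof (rule ann_ann_mpow)
    fix e assume e: "e \<in> ann_in E (mpow n)"
    then have "e \<in> ann_in E (mpow (Suc n))" using mono[of n] by (auto simp: ann_in_def simp del: nat_pow_Suc)
    then have "\<rho> (Suc n) \<odot>\<^bsub>E\<^esub> e = \<rho> n \<odot>\<^bsub>E\<^esub> e" using \<rho>(2) e by metis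
    moreover have "e \<in> carrier E" using e by (simp add: ann_in_def)
    ultimately show "(\<rho> (Suc n) \<ominus>\<^bsub>R\<^esub> \<rho> n) \<odot>\<^bsub>E\<^esub> e = \<zero>\<^bsub>E\<^esub>"
      using \<rho>(1) by (simp add: R.minus_eq E.smult_l_distr E.smult_l_minus E.M.r_neg)
  qed (use \<rho>(1) in simp)
  let ?s = "\<lambda>n. mpow n +>\<^bsub>R\<^esub> \<rho> n"
  have "?s n \<in> carrier (R Quot mpow n)" for n
    using \<rho>(1) by (auto simp: FactRing_def A_RCOSETS_def')
  moreover have "?s (Suc n) \<subseteq> ?s n" for n
  proof -
    have "?s n = mpow n +>\<^bsub>R\<^esub> \<rho> (Suc n)" using mpow_coset_eq_iff[OF \<rho>(1) \<rho>(1)] step[of n] by metis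
    then show ?thesis using mono[of n] unfolding a_r_coset_def' by blast
  qed
  moreover have "(\<lambda>r n. mpow n +>\<^bsub>R\<^esub> r) ` carrier R =
      {s. (\<forall>n. s n \<in> carrier (R Quot mpow n)) \<and> (\<forall>n. s (Suc n) \<subseteq> s n)}"
    using complete unfolding adically_complete_def by (rule bij_betw_imp_surj_on)
  ultimately have "?s \<in> (\<lambda>r n. mpow n +>\<^bsub>R\<^esub> r) ` carrier R" by blast
  then obtain r where r: "r \<in> carrier R" "?s = (\<lambda>n. mpow n +>\<^bsub>R\<^esub> r)" by blast
  have rn: "\<rho> n \<ominus>\<^bsub>R\<^esub> r \<in> mpow n" for n
    using fun_cong[OF r(2), of n] mpow_coset_eq_iff[OF \<rho>(1) r(1)] by blast
  show ?thesis
  proof (rule that[OF r(1)])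
    fix e assume e: "e \<in> carrier E"
    then obtain n where n: "e \<in> ann_in E (mpow n)" by (rule E_torsion)
    have "(\<rho> n \<ominus>\<^bsub>R\<^esub> r) \<odot>\<^bsub>E\<^esub> e = \<zero>\<^bsub>E\<^esub>" using rn[of n] n by (auto simp: ann_in_def)
    then have "\<rho> n \<odot>\<^bsub>E\<^esub> e \<ominus>\<^bsub>E\<^esub> r \<odot>\<^bsub>E\<^esub> e = \<zero>\<^bsub>E\<^esub>"
      using \<rho>(1) r(1) e by (simp add: R.minus_eq E.M.minus_eq E.smult_l_distr E.smult_l_minus)
    then show "\<theta> e = r \<odot>\<^bsub>E\<^esub> e" using \<rho> n r(1) e by (simp add: E.diff_zero_iff)
  qed
qed

end

subsection \<open>Homothety maps\<close>

lemma hom_module_simps: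
  "carrier (hom_module R A B) = mod_hom R A B"
  "\<zero>\<^bsub>hom_module R A B\<^esub> = (\<lambda>x\<in>carrier A. \<zero>\<^bsub>B\<^esub>)"
  "x \<in> carrier A \<Longrightarrow> (f \<oplus>\<^bsub>hom_module R A B\<^esub> g) x = f x \<oplus>\<^bsub>B\<^esub> g x"
  "x \<in> carrier A \<Longrightarrow> (r \<odot>\<^bsub>hom_module R A B\<^esub> f) x = r \<odot>\<^bsub>B\<^esub> f x"
  by (simp_all add: hom_module_def)

lemma hom_module_module:
  assumes A: "module R A" and B: "module R B"
  shows "module R (hom_module R A B)"
proof -
  interpret A: module R A by fact
  interpret B: module R B by fact
  let ?H = "hom_module R A B"
  note s = hom_module_simps
  have add: "f \<oplus>\<^bsub>?H\<^esub> g \<in> mod_hom R A B" if "f \<in> mod_hom R A B" "g \<in> mod_hom R A B" for f g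
    using mod_homD[OF that(1)] mod_homD[OF that(2)] unfolding hom_module_def
    by simp (intro mod_hom_restrictI[OF A]; simp add: B.M.a_ac B.smult_r_distr)
  have sm: "r \<odot>\<^bsub>?H\<^esub> f \<in> mod_hom R A B" if "r \<in> carrier R" "f \<in> mod_hom R A B" for r f
    using mod_homD[OF that(2)] that(1) unfolding hom_module_def
    by simp (intro mod_hom_restrictI[OF A]; simp add: B.smult_r_distr B.smult_comm[of r])
  have zero: "\<zero>\<^bsub>?H\<^esub> \<in> mod_hom R A B" unfolding s by (intro mod_hom_restrictI[OF A]) auto
  note cl = add sm zero
  have "abelian_group ?H"
  proof (rule abelian_groupI; unfold s(1))
    fix f assume f: "f \<in> mod_hom R A B"
    let ?g = "(\<ominus>\<^bsub>R\<^esub> \<one>\<^bsub>R\<^esub>) \<odot>\<^bsub>?H\<^esub> f"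
    have g: "?g \<in> mod_hom R A B" using f by (intro sm) auto
    have "?g \<oplus>\<^bsub>?H\<^esub> f = \<zero>\<^bsub>?H\<^esub>"
      using mod_homD(1)[OF f]
      by (intro mod_hom_eqI[OF add[OF g f] zero]) (simp add: s B.smult_l_minus B.M.l_neg)
    then show "\<exists>g\<in>mod_hom R A B. g \<oplus>\<^bsub>?H\<^esub> f = \<zero>\<^bsub>?H\<^esub>" using g by blast
    show "\<zero>\<^bsub>?H\<^esub> \<oplus>\<^bsub>?H\<^esub> f = f"
      using mod_homD(1)[OF f] by (intro mod_hom_eqI[OF add[OF zero f] f]) (simp add: s)
  next
    fix f g assume fg: "f \<in> mod_hom R A B" "g \<in> mod_hom R A B"
    then show "f \<oplus>\<^bsub>?H\<^esub> g = g \<oplus>\<^bsub>?H\<^esub> f"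
      using mod_homD(1)[OF fg(1)] mod_homD(1)[OF fg(2)]
      by (intro mod_hom_eqI[OF add add]) (auto simp: s B.M.a_ac)
    fix h assume h: "h \<in> mod_hom R A B"
    then show "f \<oplus>\<^bsub>?H\<^esub> g \<oplus>\<^bsub>?H\<^esub> h = f \<oplus>\<^bsub>?H\<^esub> (g \<oplus>\<^bsub>?H\<^esub> h)"
      using fg mod_homD(1)[OF fg(1)] mod_homD(1)[OF fg(2)] mod_homD(1)[OF h]
      by (intro mod_hom_eqI[OF add[OF add] add[OF _ add]]) (auto simp: s B.M.a_assoc)
  qed (use cl in auto)
  then show ?thesis
  proof (rule moduleI[OF A.R.is_cring]; unfold s(1))
    fix a b f assume ab: "a \<in> carrier R" "b \<in> carrier R" and f: "f \<in> mod_hom R A B"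
    show "(a \<oplus>\<^bsub>R\<^esub> b) \<odot>\<^bsub>?H\<^esub> f = a \<odot>\<^bsub>?H\<^esub> f \<oplus>\<^bsub>?H\<^esub> b \<odot>\<^bsub>?H\<^esub> f"
      using ab f mod_homD(1)[OF f]
      by (intro mod_hom_eqI[OF sm add[OF sm sm]]) (auto simp: s B.smult_l_distr)
    show "(a \<otimes>\<^bsub>R\<^esub> b) \<odot>\<^bsub>?H\<^esub> f = a \<odot>\<^bsub>?H\<^esub> (b \<odot>\<^bsub>?H\<^esub> f)"
      using ab f mod_homD(1)[OF f]
      by (intro mod_hom_eqI[OF sm sm[OF _ sm]]) (auto simp: s B.smult_assoc1)
  next
    fix a f g assume a: "a \<in> carrier R" and fg: "f \<in> mod_hom R A B" "g \<in> mod_hom R A B"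
    show "a \<odot>\<^bsub>?H\<^esub> (f \<oplus>\<^bsub>?H\<^esub> g) = a \<odot>\<^bsub>?H\<^esub> f \<oplus>\<^bsub>?H\<^esub> a \<odot>\<^bsub>?H\<^esub> g"
      using a fg mod_homD(1)[OF fg(1)] mod_homD(1)[OF fg(2)]
      by (intro mod_hom_eqI[OF sm[OF _ add] add[OF sm sm]]) (auto simp: s B.smult_r_distr)
  next
    fix f assume f: "f \<in> mod_hom R A B"
    show "\<one>\<^bsub>R\<^esub> \<odot>\<^bsub>?H\<^esub> f = f"
      using f mod_homD(1)[OF f] by (intro mod_hom_eqI[OF sm f]) (auto simp: s)
  qed (use cl in auto)
qed

lemma hom_module_eval:
  assumes A: "module R A" and B: "module R B" and x: "x \<in> carrier A"
  shows "(\<lambda>f\<in>carrier (hom_module R A B). f x) \<in> mod_hom R (hom_module R A B) B"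
  using x mod_homD(1)[of _ R A B x]
  by (intro mod_hom_restrictI hom_module_module A B) (auto simp: hom_module_simps)

text \<open>Injectivity amounts to faithfulness and surjectivity to all endomorphisms being
  multiplications. The two halves are compared separately below, and equations between extensional
  functions become equations between values.\<close>

lemma homothety_iso_iff:
  assumes X: "module R X"
  shows "homothety R X \<in> mod_iso R (ring_as_module R) (hom_module R X X) \<longleftrightarrow>
    (\<forall>r\<in>carrier R. (\<forall>x\<in>carrier X. r \<odot>\<^bsub>X\<^esub> x = \<zero>\<^bsub>X\<^esub>) \<longrightarrow> r = \<zero>\<^bsub>R\<^esub>) \<and>
    (\<forall>h\<in>mod_hom R X X. \<exists>r\<in>carrier R. \<forall>x\<in>carrier X. h x = r \<odot>\<^bsub>X\<^esub> x)"
    (is "?iso \<longleftrightarrow> ?inj \<and> ?surj")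
proof -
  interpret X: module R X by fact
  let ?H = "hom_module R X X" and ?\<mu> = "homothety R X"
  have sm: "(\<lambda>x\<in>carrier X. r \<odot>\<^bsub>X\<^esub> x) \<in> mod_hom R X X" if "r \<in> carrier R" for r
    using that by (rule smult_hom[OF X])
  have hom: "?\<mu> \<in> mod_hom R (ring_as_module R) ?H"
    unfolding homothety_def ring_as_module_simps(1)[of R, symmetric]
    by (rule mod_hom_restrictI[OF X.R.module_ring_as_module])
      (auto simp: hom_module_def sm X.smult_l_distr X.smult_assoc1 intro!: restrict_ext)
  have inj: "inj_on ?\<mu> (carrier R) \<longleftrightarrow> ?inj"
  proof
    assume *: "inj_on ?\<mu> (carrier R)"
    show ?inj
    proof (intro ballI impI)
      fix r assume r: "r \<in> carrier R" "\<forall>x\<in>carrier X. r \<odot>\<^bsub>X\<^esub> x = \<zero>\<^bsub>X\<^esub>"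
      then have "?\<mu> r = ?\<mu> \<zero>\<^bsub>R\<^esub>" by (auto simp: homothety_def intro!: restrict_ext)
      then show "r = \<zero>\<^bsub>R\<^esub>" using * r by (auto dest: inj_onD)
    qed
  next
    assume *: ?inj
    show "inj_on ?\<mu> (carrier R)"
    proof (rule inj_onI)
      fix r s assume rs: "r \<in> carrier R" "s \<in> carrier R" "?\<mu> r = ?\<mu> s"
      have "(r \<ominus>\<^bsub>R\<^esub> s) \<odot>\<^bsub>X\<^esub> x = \<zero>\<^bsub>X\<^esub>" if "x \<in> carrier X" for x
        using fun_cong[OF rs(3), of x] rs that
        by (simp add: homothety_def X.R.minus_eq X.smult_l_distr X.smult_l_minus X.M.r_neg)
      then have "r \<ominus>\<^bsub>R\<^esub> s = \<zero>\<^bsub>R\<^esub>" using * rs by simp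
      then show "r = s" using rs by simp
    qed
  qed
  have surj: "?\<mu> ` carrier R = mod_hom R X X \<longleftrightarrow> ?surj"
  proof
    assume *: "?\<mu> ` carrier R = mod_hom R X X"
    show ?surj
    proof
      fix h assume "h \<in> mod_hom R X X"
      then obtain r where "r \<in> carrier R" "h = ?\<mu> r" using * by blast
      then show "\<exists>r\<in>carrier R. \<forall>x\<in>carrier X. h x = r \<odot>\<^bsub>X\<^esub> x" by (auto simp: homothety_def)
    qed
  next
    assume *: ?surj
    show "?\<mu> ` carrier R = mod_hom R X X"
    proof (intro equalityI subsetI)
      fix h assume "h \<in> ?\<mu> ` carrier R"
      then show "h \<in> mod_hom R X X" using sm by (auto simp: homothety_def)
    next
      fix h assume h: "h \<in> mod_hom R X X"
      then obtain r where r: "r \<in> carrier R" "\<forall>x\<in>carrier X. h x = r \<odot>\<^bsub>X\<^esub> x" using * by blast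
      have "h = ?\<mu> r" using r by (intro mod_hom_eqI[OF h]) (auto simp: homothety_def sm)
      then show "h \<in> ?\<mu> ` carrier R" using r by blast
    qed
  qed
  show ?thesis
    using hom inj surj by (simp add: mod_iso_def bij_betw_def hom_module_simps(1))
qed

subsection \<open>Matlis duality\<close>

locale matlis_module = matlis +
  fixes H :: "('a, 'h) module"
  assumes H_module: "module R H"
begin

sublocale H: module R H by (rule H_module)

abbreviation "DH \<equiv> hom_module R H E"

lemma DH_module: "module R DH"
  by (rule hom_module_module[OF H_module E_module])

sublocale DH: module R DH by (rule DH_module)


lemma DH_memD: "f \<in> mod_hom R H E \<Longrightarrow> f \<in> carrier DH"
  by (simp add: hom_module_simps)

text \<open>\<open>E\<close> is a cogenerator, so \<open>H\<close> embeds into its bidual. Equations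
  in \<open>H\<close> can be tested after applying all maps to \<open>E\<close>.\<close>

lemma separated:
  assumes "x \<in> carrier H" "y \<in> carrier H" "\<And>f. f \<in> mod_hom R H E \<Longrightarrow> f x = f y"
  shows "x = y"
proof (rule ccontr)
  assume "x \<noteq> y"
  then have ne: "x \<ominus>\<^bsub>H\<^esub> y \<noteq> \<zero>\<^bsub>H\<^esub>" using assms by (simp add: H.diff_zero_iff)
  obtain f where f: "f \<in> mod_hom R H E" "f (x \<ominus>\<^bsub>H\<^esub> y) \<noteq> \<zero>\<^bsub>E\<^esub>"
    by (rule cogenerator[OF H_module _ ne]) (use assms in auto)
  have "f (x \<ominus>\<^bsub>H\<^esub> y) = f x \<ominus>\<^bsub>E\<^esub> f y" by (rule mod_hom_zero_minus(3)[OF H_module E_module f(1) assms(1,2)])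
  then show False using f assms mod_homD(1)[OF f(1) assms(1)] mod_homD(1)[OF f(1) assms(2)]
    by (simp add: E.diff_zero_iff)
qed

text \<open>From \<open>(r f) x = f (r x)\<close> and separation, a scalar kills \<open>D(H)\<close>
  exactly when it kills \<open>H\<close>.\<close>

lemma DH_faithful_iff:
  "(\<forall>r\<in>carrier R. (\<forall>f\<in>carrier DH. r \<odot>\<^bsub>DH\<^esub> f = \<zero>\<^bsub>DH\<^esub>) \<longrightarrow> r = \<zero>\<^bsub>R\<^esub>) \<longleftrightarrow>
    (\<forall>r\<in>carrier R. (\<forall>x\<in>carrier H. r \<odot>\<^bsub>H\<^esub> x = \<zero>\<^bsub>H\<^esub>) \<longrightarrow> r = \<zero>\<^bsub>R\<^esub>)"
proof -
  have "(\<forall>f\<in>carrier DH. r \<odot>\<^bsub>DH\<^esub> f = \<zero>\<^bsub>DH\<^esub>) \<longleftrightarrow> (\<forall>x\<in>carrier H. r \<odot>\<^bsub>H\<^esub> x = \<zero>\<^bsub>H\<^esub>)"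
    if r: "r \<in> carrier R" for r
  proof
    assume *: "\<forall>f\<in>carrier DH. r \<odot>\<^bsub>DH\<^esub> f = \<zero>\<^bsub>DH\<^esub>"
    show "\<forall>x\<in>carrier H. r \<odot>\<^bsub>H\<^esub> x = \<zero>\<^bsub>H\<^esub>"
    proof
      fix x assume x: "x \<in> carrier H"
      show "r \<odot>\<^bsub>H\<^esub> x = \<zero>\<^bsub>H\<^esub>"
      proof (rule separated)
        fix f assume f: "f \<in> mod_hom R H E"
        have "f (r \<odot>\<^bsub>H\<^esub> x) = (r \<odot>\<^bsub>DH\<^esub> f) x" using mod_homD(3)[OF f r x] x by (simp add: hom_module_simps)
        also have "\<dots> = \<zero>\<^bsub>E\<^esub>" using * f x by (simp add: hom_module_simps)
        finally show "f (r \<odot>\<^bsub>H\<^esub> x) = f \<zero>\<^bsub>H\<^esub>"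
          using mod_hom_zero_minus(1)[OF H_module E_module f] by simp
      qed (use r x in auto)
    qed
  next
    assume *: "\<forall>x\<in>carrier H. r \<odot>\<^bsub>H\<^esub> x = \<zero>\<^bsub>H\<^esub>"
    show "\<forall>f\<in>carrier DH. r \<odot>\<^bsub>DH\<^esub> f = \<zero>\<^bsub>DH\<^esub>"
    proof
      fix f assume fD: "f \<in> carrier DH"
      then have f: "f \<in> mod_hom R H E" by (simp add: hom_module_simps)
      have "(r \<odot>\<^bsub>DH\<^esub> f) x = \<zero>\<^bsub>DH\<^esub> x" if x: "x \<in> carrier H" for x
        using mod_homD(3)[OF f r x] x * mod_hom_zero_minus(1)[OF H_module E_module f]
        by (simp add: hom_module_simps)
      then show "r \<odot>\<^bsub>DH\<^esub> f = \<zero>\<^bsub>DH\<^esub>"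
        using DH.smult_closed[OF r fD] DH.M.zero_closed
        by (intro mod_hom_eqI[of _ R H E]) (auto simp: hom_module_simps(1))
    qed
  qed
  then show ?thesis by blast
qed

text \<open>The analogue of the fact that a functional vanishing on the common kernel of finitely
  many others is their linear combination. On the maps that vanish on \<open>F\<close>, the
  functional \<open>\<phi>\<close> factors through evaluation at the new generator \<open>x\<close>;
  the resulting endomorphism of \<open>E\<close> is multiplication by some \<open>r\<close>, which
  is the coefficient of \<open>x\<close>.\<close>

lemma biduality_span:
  assumes "finite F" "F \<subseteq> carrier H" "\<phi> \<in> mod_hom R DH E"
    and "\<And>f. f \<in> mod_hom R H E \<Longrightarrow> (\<And>x. x \<in> F \<Longrightarrow> f x = \<zero>\<^bsub>E\<^esub>) \<Longrightarrow> \<phi> f = \<zero>\<^bsub>E\<^esub>"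
  shows "\<exists>w\<in>mod_span R H F. \<forall>f\<in>mod_hom R H E. \<phi> f = f w"
  using assms
proof (induction F arbitrary: \<phi> rule: finite_induct)
  case empty
  have "\<zero>\<^bsub>H\<^esub> \<in> mod_span R H {}" by (rule H.submoduleD(2)[OF mod_span_submodule[OF H_module]]) simp
  then show ?case
    using empty.prems(3) mod_hom_zero_minus(1)[OF H_module E_module] by (intro bexI[of _ "\<zero>\<^bsub>H\<^esub>"]) auto
next
  case (insert x F)
  have x: "x \<in> carrier H" and F: "F \<subseteq> carrier H" using insert.prems(1) by auto
  note \<phi> = insert.prems(2)
  note \<phi>D = mod_homD[OF \<phi>, unfolded hom_module_simps(1)]
  let ?ev = "\<lambda>f\<in>carrier DH. f x"
  have ev: "?ev \<in> mod_hom R DH E" by (rule hom_module_eval[OF H_module E_module x])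
  let ?P = "{f \<in> mod_hom R H E. \<forall>y\<in>F. f y = \<zero>\<^bsub>E\<^esub>}"
  have P: "submodule ?P R DH"
  proof (rule DH.submoduleI_closed)
    show "\<zero>\<^bsub>DH\<^esub> \<in> ?P" using F DH.M.zero_closed by (auto simp: hom_module_simps)
    show "f \<oplus>\<^bsub>DH\<^esub> g \<in> ?P" if "f \<in> ?P" "g \<in> ?P" for f g
      using that F DH.M.a_closed[of f g] by (auto simp: hom_module_simps subset_iff)
    show "r \<odot>\<^bsub>DH\<^esub> f \<in> ?P" if "r \<in> carrier R" "f \<in> ?P" for r f
      using that F DH.smult_closed[of r f] by (auto simp: hom_module_simps subset_iff)
  qed (auto simp: hom_module_simps)
  have ker: "\<phi> f = \<zero>\<^bsub>E\<^esub>" if "f \<in> ?P" "?ev f = \<zero>\<^bsub>E\<^esub>" for f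
    using that by (intro insert.prems(3)) (auto simp: hom_module_simps)
  obtain \<theta> where \<theta>: "\<theta> \<in> mod_hom R E E" "\<And>f. f \<in> ?P \<Longrightarrow> \<theta> (?ev f) = \<phi> f"
    using injective_factor[OF E_injective E_module DH_module P ev \<phi> ker] by blast
  obtain r where r: "r \<in> carrier R" "\<And>e. e \<in> carrier E \<Longrightarrow> \<theta> e = r \<odot>\<^bsub>E\<^esub> e" by (rule endo_E[OF \<theta>(1)]) blast
  \<comment> \<open>Subtracting evaluation at \<open>r x\<close> removes the contribution of
    \<open>x\<close>; what remains vanishes on the maps that are zero on \<open>F\<close>, so the
    induction hypothesis applies.\<close>
  define \<psi> where "\<psi> = (\<lambda>f\<in>carrier DH. \<phi> f \<ominus>\<^bsub>E\<^esub> f (r \<odot>\<^bsub>H\<^esub> x))"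
  have rx: "r \<odot>\<^bsub>H\<^esub> x \<in> carrier H" using r x by simp
  have \<psi>: "\<psi> \<in> mod_hom R DH E"
    unfolding \<psi>_def
  proof (rule mod_hom_restrictI[OF DH_module]; unfold hom_module_simps(1))
    show "\<phi> f \<ominus>\<^bsub>E\<^esub> f (r \<odot>\<^bsub>H\<^esub> x) \<in> carrier E" if "f \<in> mod_hom R H E" for f
      using \<phi>D(1)[OF that] mod_homD(1)[OF that rx] by simp
    show "\<phi> (f \<oplus>\<^bsub>DH\<^esub> g) \<ominus>\<^bsub>E\<^esub> (f \<oplus>\<^bsub>DH\<^esub> g) (r \<odot>\<^bsub>H\<^esub> x) =
        (\<phi> f \<ominus>\<^bsub>E\<^esub> f (r \<odot>\<^bsub>H\<^esub> x)) \<oplus>\<^bsub>E\<^esub> (\<phi> g \<ominus>\<^bsub>E\<^esub> g (r \<odot>\<^bsub>H\<^esub> x))"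
      if "f \<in> mod_hom R H E" "g \<in> mod_hom R H E" for f g
      using \<phi>D(1)[OF that(1)] mod_homD(1)[OF that(1) rx] \<phi>D(1)[OF that(2)] mod_homD(1)[OF that(2) rx]
        \<phi>D(2)[OF that] rx by (simp add: hom_module_simps E.module_simprules)
    show "\<phi> (s \<odot>\<^bsub>DH\<^esub> f) \<ominus>\<^bsub>E\<^esub> (s \<odot>\<^bsub>DH\<^esub> f) (r \<odot>\<^bsub>H\<^esub> x) = s \<odot>\<^bsub>E\<^esub> (\<phi> f \<ominus>\<^bsub>E\<^esub> f (r \<odot>\<^bsub>H\<^esub> x))"
      if "s \<in> carrier R" "f \<in> mod_hom R H E" for s f
      using \<phi>D(1)[OF that(2)] mod_homD(1)[OF that(2) rx] \<phi>D(3)[OF that] rx that(1)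
      by (simp add: hom_module_simps E.module_simprules)
  qed
  have "\<psi> f = \<zero>\<^bsub>E\<^esub>" if f: "f \<in> mod_hom R H E" "\<And>y. y \<in> F \<Longrightarrow> f y = \<zero>\<^bsub>E\<^esub>" for f
  proof -
    have fx: "f x \<in> carrier E" by (rule mod_homD(1)[OF f(1) x])
    have "\<phi> f = f (r \<odot>\<^bsub>H\<^esub> x)"
      using \<theta>(2)[of f] f r(2)[OF fx] mod_homD(3)[OF f(1) r(1) x] by (simp add: hom_module_simps)
    then show ?thesis using f(1) \<phi>D(1)[OF f(1)] mod_homD(1)[OF f(1) rx]
      by (simp add: \<psi>_def hom_module_simps E.diff_zero_iff)
  qed
  then obtain w where w: "w \<in> mod_span R H F" "\<forall>f\<in>mod_hom R H E. \<psi> f = f w"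
    using insert.IH[OF F \<psi>] by blast
  note sD = H.submoduleD[OF mod_span_submodule[OF H_module insert.prems(1)]]
  have w': "w \<in> mod_span R H (insert x F)" using w(1) mod_span_mono[of F "insert x F" R H] by blast
  have x': "x \<in> mod_span R H (insert x F)" using mod_span_superset[of "insert x F" R H] by blast
  show ?case
  proof (intro bexI ballI)
    show "w \<oplus>\<^bsub>H\<^esub> r \<odot>\<^bsub>H\<^esub> x \<in> mod_span R H (insert x F)" by (intro sD w' x' r)
    fix f assume f: "f \<in> mod_hom R H E"
    have "\<phi> f = \<psi> f \<oplus>\<^bsub>E\<^esub> f (r \<odot>\<^bsub>H\<^esub> x)"
      using f \<phi>D(1)[OF f] mod_homD(1)[OF f rx] by (simp add: \<psi>_def hom_module_simps E.module_simprules)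
    then show "\<phi> f = f (w \<oplus>\<^bsub>H\<^esub> r \<odot>\<^bsub>H\<^esub> x)"
      using w(2) f mod_homD(2)[OF f sD(1)[OF w'] rx] by simp
  qed
qed

text \<open>A map \<open>f\<close> that vanishes on \<open>(0 :\<^sub>H a)\<close> lies in \<open>a D(H)\<close>, because \<open>E\<close> is injective.\<close>

lemma bidual_vanish:
  assumes a: "ideal a R" and \<phi>: "\<phi> \<in> mod_hom R DH E"
    and kill: "\<And>r f. r \<in> a \<Longrightarrow> f \<in> mod_hom R H E \<Longrightarrow> r \<odot>\<^bsub>E\<^esub> \<phi> f = \<zero>\<^bsub>E\<^esub>"
  shows "\<forall>f\<in>mod_hom R H E. (\<forall>x\<in>ann_in H a. f x = \<zero>\<^bsub>E\<^esub>) \<longrightarrow> \<phi> f = \<zero>\<^bsub>E\<^esub>"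
proof (rule R.ideal_adjoin_induct[OF R_cring a])
  show "\<forall>f\<in>mod_hom R H E. (\<forall>x\<in>ann_in H {\<zero>\<^bsub>R\<^esub>}. f x = \<zero>\<^bsub>E\<^esub>) \<longrightarrow> \<phi> f = \<zero>\<^bsub>E\<^esub>"
  proof (intro ballI impI)
    fix f assume f: "f \<in> mod_hom R H E" "\<forall>x\<in>ann_in H {\<zero>\<^bsub>R\<^esub>}. f x = \<zero>\<^bsub>E\<^esub>"
    have "f = \<zero>\<^bsub>DH\<^esub>"
      using f(2) DH.M.zero_closed
      by (intro mod_hom_eqI[OF f(1)]) (auto simp: hom_module_simps ann_in_def)
    then show "\<phi> f = \<zero>\<^bsub>E\<^esub>" using mod_hom_zero_minus(1)[OF DH_module E_module \<phi>] by simp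
  qed
next
  fix c x assume c: "ideal c R" and x: "x \<in> a"
    and IH: "\<forall>f\<in>mod_hom R H E. (\<forall>x\<in>ann_in H c. f x = \<zero>\<^bsub>E\<^esub>) \<longrightarrow> \<phi> f = \<zero>\<^bsub>E\<^esub>"
  have xR: "x \<in> carrier R" by (rule R.idealD(1)[OF a x])
  note cD = R.idealD[OF c]
  have P: "submodule (ann_in H c) R H" using cD(1) by (intro submodule_ann_in H_module) blast
  let ?\<phi> = "\<lambda>y\<in>carrier H. x \<odot>\<^bsub>H\<^esub> y"
  show "\<forall>f\<in>mod_hom R H E. (\<forall>y\<in>ann_in H (adjoin R c x). f y = \<zero>\<^bsub>E\<^esub>) \<longrightarrow> \<phi> f = \<zero>\<^bsub>E\<^esub>"
  proof (intro ballI impI)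
    fix f assume f: "f \<in> mod_hom R H E" and f0: "\<forall>y\<in>ann_in H (adjoin R c x). f y = \<zero>\<^bsub>E\<^esub>"
    have ker: "f p = \<zero>\<^bsub>E\<^esub>" if "p \<in> ann_in H c" "?\<phi> p = \<zero>\<^bsub>H\<^esub>" for p
    proof -
      have "p \<in> ann_in H (adjoin R c x)"
        using that xR cD(1) by (auto simp: ann_in_def adjoin_def H.smult_l_distr H.smult_assoc1)
      then show ?thesis using f0 by blast
    qed
    \<comment> \<open>On \<open>(0 : c)\<close> the map \<open>f\<close> vanishes wherever
      multiplication by \<open>x\<close> does, so it agrees there with \<open>x g\<close> for some
      \<open>g\<close>. The induction hypothesis gives \<open>\<phi> (f - x g) = 0\<close>, and
      \<open>x \<phi> g = 0\<close> because \<open>x\<close> is in \<open>a\<close>.\<close>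
    obtain g where g: "g \<in> mod_hom R H E" "\<And>p. p \<in> ann_in H c \<Longrightarrow> g (?\<phi> p) = f p"
      using injective_factor[OF E_injective H_module H_module P smult_hom[OF H_module xR] f ker] by blast
    let ?f = "f \<ominus>\<^bsub>DH\<^esub> x \<odot>\<^bsub>DH\<^esub> g"
    have cl: "f \<in> carrier DH" "g \<in> carrier DH" "x \<odot>\<^bsub>DH\<^esub> g \<in> carrier DH" "?f \<in> carrier DH"
      using DH_memD[OF f] DH_memD[OF g(1)] xR by simp_all
    have "?f p = \<zero>\<^bsub>E\<^esub>" if p: "p \<in> ann_in H c" for p
    proof -
      have pH: "p \<in> carrier H" using p by (simp add: ann_in_def)
      have "?f p = f p \<ominus>\<^bsub>E\<^esub> x \<odot>\<^bsub>E\<^esub> g p"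
        using mod_hom_zero_minus(3)[OF DH_module E_module hom_module_eval[OF H_module E_module pH] cl(1,3)] cl pH
        by (simp add: hom_module_simps(4))
      also have "x \<odot>\<^bsub>E\<^esub> g p = f p" using g(2)[OF p] mod_homD(3)[OF g(1) xR pH] pH by simp
      finally show ?thesis using mod_homD(1)[OF f pH] by (simp add: E.diff_zero_iff)
    qed
    then have "\<phi> ?f = \<zero>\<^bsub>E\<^esub>" using IH cl(4) by (simp add: hom_module_simps(1))
    moreover have "\<phi> ?f = \<phi> f \<ominus>\<^bsub>E\<^esub> x \<odot>\<^bsub>E\<^esub> \<phi> g"
      using mod_hom_zero_minus(3)[OF DH_module E_module \<phi> cl(1,3)] mod_homD(3)[OF \<phi> xR cl(2)] by simp
    ultimately show "\<phi> f = \<zero>\<^bsub>E\<^esub>"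
      using kill[OF x g(1)] mod_homD(1)[OF \<phi> cl(1)] by (simp add: E.M.minus_zero_right)
  qed
qed

text \<open>A map that vanishes on \<open>F\<close> vanishes on \<open>(0 : a)\<close>, which lies
  in the span of \<open>F\<close>; by \<open>bidual_vanish\<close> it is then killed by
  \<open>\<phi>\<close>, and \<open>biduality_span\<close> produces \<open>w\<close>.\<close>

lemma bidual_eval:
  assumes a: "ideal a R" and F: "finite F" "F \<subseteq> carrier H" "ann_in H a \<subseteq> mod_span R H F"
    and F_ann: "F \<subseteq> ann_in H a" and \<phi>: "\<phi> \<in> mod_hom R DH E"
    and kill: "\<And>r f. r \<in> a \<Longrightarrow> f \<in> mod_hom R H E \<Longrightarrow> r \<odot>\<^bsub>E\<^esub> \<phi> f = \<zero>\<^bsub>E\<^esub>"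
  obtains w where "w \<in> carrier H" "\<And>f. f \<in> mod_hom R H E \<Longrightarrow> \<phi> f = f w"
proof -
  have "\<phi> f = \<zero>\<^bsub>E\<^esub>" if f: "f \<in> mod_hom R H E" "\<And>x. x \<in> F \<Longrightarrow> f x = \<zero>\<^bsub>E\<^esub>" for f
  proof -
    have "mod_span R H F \<subseteq> {x \<in> carrier H. f x = \<zero>\<^bsub>E\<^esub>}"
      using f F(2) by (intro mod_span_least kernel_submodule[OF H_module E_module]) auto
    then have "\<forall>x\<in>ann_in H a. f x = \<zero>\<^bsub>E\<^esub>" using F(3) by blast
    then show ?thesis using bidual_vanish[OF a \<phi> kill] f(1) by blast
  qed
  from biduality_span[OF F(1,2) \<phi> this] obtain w where
    "w \<in> mod_span R H F" "\<forall>f\<in>mod_hom R H E. \<phi> f = f w" by blast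
  moreover have "mod_span R H F \<subseteq> carrier H"
    by (rule mod_span_least[OF H.carrier_is_submodule F(2)])
  ultimately show ?thesis using that by blast
qed

text \<open>The hypothesis \<open>fin\<close> is the form in which finiteness of the cohomology
  enters: every element lies in a finitely generated annihilator. Faithfulness passes between
  \<open>H\<close> and its dual by \<open>DH_faithful_iff\<close>, so the proof compares
  endomorphisms.\<close>

theorem homothety_dual_iff:
  assumes fin: "\<And>h. h \<in> carrier H \<Longrightarrow> \<exists>a F. ideal a R \<and> h \<in> ann_in H a \<and> finite F \<and> F \<subseteq> carrier H \<and>
    F \<subseteq> ann_in H a \<and> ann_in H a \<subseteq> mod_span R H F"
  shows "homothety R H \<in> mod_iso R (ring_as_module R) (hom_module R H H) \<longleftrightarrow>
    homothety R DH \<in> mod_iso R (ring_as_module R) (hom_module R DH DH)"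
proof -
  have "(\<forall>h\<in>mod_hom R H H. \<exists>r\<in>carrier R. \<forall>x\<in>carrier H. h x = r \<odot>\<^bsub>H\<^esub> x) \<longleftrightarrow>
    (\<forall>h\<in>mod_hom R DH DH. \<exists>r\<in>carrier R. \<forall>x\<in>carrier DH. h x = r \<odot>\<^bsub>DH\<^esub> x)" (is "?S1 \<longleftrightarrow> ?S2")
  proof
    assume S1: ?S1
    show ?S2
    proof
      fix \<psi> assume \<psi>: "\<psi> \<in> mod_hom R DH DH"
      note \<psi>D = mod_homD[OF \<psi>]
      have \<psi>f: "\<psi> f \<in> mod_hom R H E" if "f \<in> mod_hom R H E" for f
        using \<psi>D(1)[OF DH_memD[OF that]] by (simp add: hom_module_simps)
      have "\<exists>w. w \<in> carrier H \<and> (\<forall>f\<in>mod_hom R H E. \<psi> f h = f w)" if h: "h \<in> carrier H" for h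
      proof -
        obtain a F where aF: "ideal a R" "h \<in> ann_in H a" "finite F" "F \<subseteq> carrier H"
          "F \<subseteq> ann_in H a" "ann_in H a \<subseteq> mod_span R H F" using fin[OF h] by blast
        let ?ev = "\<lambda>f\<in>carrier DH. f h"
        \<comment> \<open>The image of \<open>h\<close> under the map from \<open>H\<close> to its
          bidual that is adjoint to \<open>\<psi>\<close>. Since \<open>\<psi> f\<close> is linear,
          an ideal that kills \<open>h\<close> kills this functional, so \<open>bidual_eval\<close>
          turns it into evaluation at an element of \<open>H\<close>.\<close>
        let ?\<phi> = "\<lambda>f\<in>carrier DH. ?ev (\<psi> f)"
        have \<phi>: "?\<phi> \<in> mod_hom R DH E"
          by (rule mod_hom_comp[OF DH_module \<psi> hom_module_eval[OF H_module E_module h]])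
        have \<phi>f: "?\<phi> f = \<psi> f h" if "f \<in> mod_hom R H E" for f
          using DH_memD[OF that] DH_memD[OF \<psi>f[OF that]] by simp
        have kill: "r \<odot>\<^bsub>E\<^esub> ?\<phi> f = \<zero>\<^bsub>E\<^esub>" if r: "r \<in> a" and f: "f \<in> mod_hom R H E" for r f
        proof -
          have "r \<odot>\<^bsub>E\<^esub> \<psi> f h = \<psi> f (r \<odot>\<^bsub>H\<^esub> h)"
            using mod_homD(3)[OF \<psi>f[OF f] R.idealD(1)[OF aF(1) r] h] by simp
          also have "\<dots> = \<zero>\<^bsub>E\<^esub>"
            using aF(2) r mod_hom_zero_minus(1)[OF H_module E_module \<psi>f[OF f]] by (simp add: ann_in_def)
          finally show ?thesis unfolding \<phi>f[OF f] .
        qed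
        obtain w where "w \<in> carrier H" "\<And>f. f \<in> mod_hom R H E \<Longrightarrow> ?\<phi> f = f w"
          using bidual_eval[OF aF(1,3,4,6,5) \<phi> kill] by blast
        then show ?thesis using \<phi>f by auto
      qed
      then obtain w where w: "\<And>h. h \<in> carrier H \<Longrightarrow> w h \<in> carrier H"
        "\<And>h f. h \<in> carrier H \<Longrightarrow> f \<in> mod_hom R H E \<Longrightarrow> \<psi> f h = f (w h)" by metis
      \<comment> \<open>The choice of \<open>w h\<close> is unique because maps to \<open>E\<close>
        separate points; for the same reason \<open>w\<close> inherits linearity from the maps
        \<open>\<psi> f\<close>.\<close>
      have "(\<lambda>h\<in>carrier H. w h) \<in> mod_hom R H H"
      proof (rule mod_hom_restrictI[OF H_module w(1)])
        show "w (x \<oplus>\<^bsub>H\<^esub> y) = w x \<oplus>\<^bsub>H\<^esub> w y" if xy: "x \<in> carrier H" "y \<in> carrier H" for x y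
        proof (rule separated)
          fix f assume f: "f \<in> mod_hom R H E"
          have "f (w (x \<oplus>\<^bsub>H\<^esub> y)) = \<psi> f (x \<oplus>\<^bsub>H\<^esub> y)" using w(2)[OF H.M.a_closed[OF xy] f] by simp
          also have "\<dots> = \<psi> f x \<oplus>\<^bsub>E\<^esub> \<psi> f y" by (rule mod_homD(2)[OF \<psi>f[OF f] xy])
          also have "\<dots> = f (w x \<oplus>\<^bsub>H\<^esub> w y)"
            using w(2)[OF xy(1) f] w(2)[OF xy(2) f] mod_homD(2)[OF f w(1)[OF xy(1)] w(1)[OF xy(2)]] by simp
          finally show "f (w (x \<oplus>\<^bsub>H\<^esub> y)) = f (w x \<oplus>\<^bsub>H\<^esub> w y)" .
        qed (use xy w(1) in auto)
        show "w (r \<odot>\<^bsub>H\<^esub> x) = r \<odot>\<^bsub>H\<^esub> w x" if rx: "r \<in> carrier R" "x \<in> carrier H" for r x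
        proof (rule separated)
          fix f assume f: "f \<in> mod_hom R H E"
          have "f (w (r \<odot>\<^bsub>H\<^esub> x)) = \<psi> f (r \<odot>\<^bsub>H\<^esub> x)" using w(2)[OF H.smult_closed[OF rx] f] by simp
          also have "\<dots> = r \<odot>\<^bsub>E\<^esub> \<psi> f x" by (rule mod_homD(3)[OF \<psi>f[OF f] rx])
          also have "\<dots> = f (r \<odot>\<^bsub>H\<^esub> w x)"
            using w(2)[OF rx(2) f] mod_homD(3)[OF f rx(1) w(1)[OF rx(2)]] by simp
          finally show "f (w (r \<odot>\<^bsub>H\<^esub> x)) = f (r \<odot>\<^bsub>H\<^esub> w x)" .
        qed (use rx w(1) in auto)
      qed
      then obtain r where r: "r \<in> carrier R" "\<forall>x\<in>carrier H. (\<lambda>h\<in>carrier H. w h) x = r \<odot>\<^bsub>H\<^esub> x"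
        using S1 by blast
      have "\<psi> f = r \<odot>\<^bsub>DH\<^esub> f" if fD: "f \<in> carrier DH" for f
      proof -
        have f: "f \<in> mod_hom R H E" using fD by (simp add: hom_module_simps)
        show ?thesis
        proof (rule mod_hom_eqI[OF \<psi>f[OF f]])
          show "r \<odot>\<^bsub>DH\<^esub> f \<in> mod_hom R H E" using DH.smult_closed[OF r(1) fD] by (simp add: hom_module_simps)
          show "\<psi> f x = (r \<odot>\<^bsub>DH\<^esub> f) x" if x: "x \<in> carrier H" for x
            using w(2)[OF x f] r(2) x mod_homD(3)[OF f r(1) x] by (simp add: hom_module_simps)
        qed
      qed
      then show "\<exists>r\<in>carrier R. \<forall>x\<in>carrier DH. \<psi> x = r \<odot>\<^bsub>DH\<^esub> x" using r(1) by blast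
    qed
  next
    assume S2: ?S2
    show ?S1
    proof
      fix \<eta> assume \<eta>: "\<eta> \<in> mod_hom R H H"
      note \<eta>D = mod_homD[OF \<eta>]
      \<comment> \<open>Precomposition with \<open>\<eta>\<close> is the dual endomorphism of
        \<open>D(H)\<close>. If it is multiplication by \<open>r\<close>, then \<open>\<eta>\<close>
        is too, by separation.\<close>
      let ?c = "\<lambda>f. \<lambda>x\<in>carrier H. f (\<eta> x)"
      have c: "?c f \<in> mod_hom R H E" if "f \<in> mod_hom R H E" for f by (rule mod_hom_comp[OF H_module \<eta> that])
      have "(\<lambda>f\<in>carrier DH. ?c f) \<in> mod_hom R DH DH"
        using c \<eta>D(1) by (intro mod_hom_restrictI DH_module)
          (auto simp: hom_module_def intro!: restrict_ext)
      then obtain r where r: "r \<in> carrier R" "\<forall>f\<in>carrier DH. (\<lambda>f\<in>carrier DH. ?c f) f = r \<odot>\<^bsub>DH\<^esub> f" using S2 by blast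
      have "\<eta> x = r \<odot>\<^bsub>H\<^esub> x" if x: "x \<in> carrier H" for x
      proof (rule separated)
        fix f assume f: "f \<in> mod_hom R H E"
        have "?c f = r \<odot>\<^bsub>DH\<^esub> f" using r(2) DH_memD[OF f] by simp
        then have "f (\<eta> x) = (r \<odot>\<^bsub>DH\<^esub> f) x" using x by (metis restrict_apply')
        then show "f (\<eta> x) = f (r \<odot>\<^bsub>H\<^esub> x)" using mod_homD(3)[OF f r(1) x] x by (simp add: hom_module_simps)
      qed (use x r \<eta>D in auto)
      then show "\<exists>r\<in>carrier R. \<forall>x\<in>carrier H. \<eta> x = r \<odot>\<^bsub>H\<^esub> x" using r(1) by blast
    qed
  qed
  then show ?thesis
    unfolding homothety_iso_iff[OF H_module] homothety_iso_iff[OF DH_module] DH_faithful_iff by blast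
qed

end

subsection \<open>Tensor products\<close>

lemma free_module_simps:
  "c \<in> carrier (free_module R B) \<longleftrightarrow>
    (\<forall>b\<in>B. c b \<in> carrier R) \<and> (\<forall>b. b \<notin> B \<longrightarrow> c b = \<zero>\<^bsub>R\<^esub>) \<and> finite {b. c b \<noteq> \<zero>\<^bsub>R\<^esub>}"
  "\<zero>\<^bsub>free_module R B\<^esub> = (\<lambda>b. \<zero>\<^bsub>R\<^esub>)"
  "c \<oplus>\<^bsub>free_module R B\<^esub> d = (\<lambda>b. c b \<oplus>\<^bsub>R\<^esub> d b)"
  "r \<odot>\<^bsub>free_module R B\<^esub> c = (\<lambda>b. r \<otimes>\<^bsub>R\<^esub> c b)"
  by (simp_all add: free_module_def)

lemma (in cring) free_module_coeff:
  assumes "c \<in> carrier (free_module R B)"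
  shows "c b \<in> carrier R"
  using assms by (cases "b \<in> B") (auto simp: free_module_simps)

lemma (in cring) free_module_module: "module R (free_module R B)"
proof -
  let ?F = "free_module R B"
  note co = free_module_coeff
  have add: "c \<oplus>\<^bsub>?F\<^esub> d \<in> carrier ?F" if "c \<in> carrier ?F" "d \<in> carrier ?F" for c d
  proof -
    have "{b. c b \<oplus> d b \<noteq> \<zero>} \<subseteq> {b. c b \<noteq> \<zero>} \<union> {b. d b \<noteq> \<zero>}" by auto
    then show ?thesis using that by (auto simp: free_module_simps intro: finite_subset)
  qed
  have sm: "r \<odot>\<^bsub>?F\<^esub> c \<in> carrier ?F" if "r \<in> carrier R" "c \<in> carrier ?F" for r c
  proof -
    have "{b. r \<otimes> c b \<noteq> \<zero>} \<subseteq> {b. c b \<noteq> \<zero>}" using that(1) by auto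
    then show ?thesis using that by (auto simp: free_module_simps intro: finite_subset)
  qed
  have zero: "\<zero>\<^bsub>?F\<^esub> \<in> carrier ?F" by (simp add: free_module_simps)
  have "abelian_group ?F"
  proof (rule abelian_groupI)
    fix c assume c: "c \<in> carrier ?F"
    have "(\<ominus> \<one>) \<odot>\<^bsub>?F\<^esub> c \<oplus>\<^bsub>?F\<^esub> c = \<zero>\<^bsub>?F\<^esub>"
      using co[OF c] by (auto simp: free_module_simps l_minus l_neg)
    then show "\<exists>d\<in>carrier ?F. d \<oplus>\<^bsub>?F\<^esub> c = \<zero>\<^bsub>?F\<^esub>" using sm[OF _ c, of "\<ominus> \<one>"] by auto
    show "\<zero>\<^bsub>?F\<^esub> \<oplus>\<^bsub>?F\<^esub> c = c" using co[OF c] by (auto simp: free_module_simps)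
  next
    fix c d assume cd: "c \<in> carrier ?F" "d \<in> carrier ?F"
    show "c \<oplus>\<^bsub>?F\<^esub> d = d \<oplus>\<^bsub>?F\<^esub> c"
      using co[OF cd(1)] co[OF cd(2)] by (auto simp: free_module_simps a_comm)
    fix e assume "e \<in> carrier ?F"
    then show "c \<oplus>\<^bsub>?F\<^esub> d \<oplus>\<^bsub>?F\<^esub> e = c \<oplus>\<^bsub>?F\<^esub> (d \<oplus>\<^bsub>?F\<^esub> e)"
      using co[OF cd(1)] co[OF cd(2)] co[of e] by (auto simp: free_module_simps a_assoc)
  qed (use add zero in auto)
  then show ?thesis
  proof (rule moduleI[OF is_cring])
    fix a b c assume ab: "a \<in> carrier R" "b \<in> carrier R" and c: "c \<in> carrier ?F"
    show "(a \<oplus> b) \<odot>\<^bsub>?F\<^esub> c = a \<odot>\<^bsub>?F\<^esub> c \<oplus>\<^bsub>?F\<^esub> b \<odot>\<^bsub>?F\<^esub> c"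
      "(a \<otimes> b) \<odot>\<^bsub>?F\<^esub> c = a \<odot>\<^bsub>?F\<^esub> (b \<odot>\<^bsub>?F\<^esub> c)"
      using ab co[OF c] by (auto simp: free_module_simps l_distr m_assoc)
  next
    fix a c d assume "a \<in> carrier R" "c \<in> carrier ?F" "d \<in> carrier ?F"
    then show "a \<odot>\<^bsub>?F\<^esub> (c \<oplus>\<^bsub>?F\<^esub> d) = a \<odot>\<^bsub>?F\<^esub> c \<oplus>\<^bsub>?F\<^esub> a \<odot>\<^bsub>?F\<^esub> d"
      using co[of c] co[of d] by (auto simp: free_module_simps r_distr)
  next
    fix c assume "c \<in> carrier ?F"
    then show "\<one> \<odot>\<^bsub>?F\<^esub> c = c" using co[of c] by (auto simp: free_module_simps)
  qed (use sm in auto)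
qed

lemma (in cring) free_basis_closed:
  assumes "b \<in> B"
  shows "free_basis R b \<in> carrier (free_module R B)"
proof -
  have "{b'. free_basis R b b' \<noteq> \<zero>} \<subseteq> {b}" by (auto simp: free_basis_def)
  then show ?thesis using assms by (auto simp: free_module_simps free_basis_def intro: finite_subset)
qed

lemma (in cring) free_module_span:
  assumes N: "submodule N R (free_module R B)" and basis: "\<And>b. b \<in> B \<Longrightarrow> free_basis R b \<in> N"
  shows "carrier (free_module R B) \<subseteq> N"
proof -
  let ?F = "free_module R B"
  interpret F: module R ?F by (rule free_module_module)
  note ND = F.submoduleD[OF N]
  have "c \<in> N" if "finite A" "c \<in> carrier ?F" "{b. c b \<noteq> \<zero>} \<subseteq> A" for A c
    using that
  proof (induction A arbitrary: c rule: finite_induct)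
    case empty
    then have "c = \<zero>\<^bsub>?F\<^esub>" by (auto simp: free_module_simps)
    then show ?case using ND(2) by simp
  next
    case (insert a A)
    show ?case
    proof (cases "c a = \<zero>")
      case True
      then have "{b. c b \<noteq> \<zero>} \<subseteq> A" using insert.prems(2) by auto
      then show ?thesis using insert.IH insert.prems(1) by blast
    next
      case False
      then have a: "a \<in> B" using insert.prems(1) by (auto simp: free_module_simps)
      define c' where "c' = (\<lambda>b. if b = a then \<zero> else c b)"
      have "{b. c' b \<noteq> \<zero>} \<subseteq> {b. c b \<noteq> \<zero>}" by (auto simp: c'_def)
      then have c': "c' \<in> carrier ?F"
        using insert.prems(1) by (auto simp: free_module_simps c'_def intro: finite_subset)
      have "c' \<in> N" using insert.prems(2) by (intro insert.IH[OF c']) (auto simp: c'_def)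
      moreover have "c = c' \<oplus>\<^bsub>?F\<^esub> c a \<odot>\<^bsub>?F\<^esub> free_basis R a"
        using free_module_coeff[OF insert.prems(1)] by (auto simp: free_module_simps c'_def free_basis_def)
      ultimately show ?thesis
        using ND(3)[OF _ ND(6)[OF free_module_coeff[OF insert.prems(1)] basis[OF a]]] by metis
    qed
  qed
  then show ?thesis by (auto simp: free_module_simps(1))
qed

section \<open>Linear extension from a basis\<close>

definition lin_ext :: "('a, 'm) ring_scheme \<Rightarrow> ('a, 'd) module \<Rightarrow> ('b \<Rightarrow> 'd) \<Rightarrow> ('b \<Rightarrow> 'a) \<Rightarrow> 'd"
  where "lin_ext R Z g c = (\<Oplus>\<^bsub>Z\<^esub>b\<in>{b. c b \<noteq> \<zero>\<^bsub>R\<^esub>}. c b \<odot>\<^bsub>Z\<^esub> g b)"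

text \<open>Terms outside the support contribute zero, so the sum can be taken over any larger
  finite set; additivity requires a common index set for two elements with different
  supports.\<close>

lemma lin_ext_eq:
  assumes Z: "module R Z" and g: "\<And>b. b \<in> B \<Longrightarrow> g b \<in> carrier Z" and c: "c \<in> carrier (free_module R B)"
    and A: "finite A" "A \<subseteq> B" "{b. c b \<noteq> \<zero>\<^bsub>R\<^esub>} \<subseteq> A"
  shows "lin_ext R Z g c = (\<Oplus>\<^bsub>Z\<^esub>b\<in>A. c b \<odot>\<^bsub>Z\<^esub> g b)"
proof -
  interpret Z: module R Z by fact
  show ?thesis
    unfolding lin_ext_def
  proof (rule Z.M.add.finprod_mono_neutral_cong_left[OF A(1,3)])
    show "c i \<odot>\<^bsub>Z\<^esub> g i = \<zero>\<^bsub>Z\<^esub>" if "i \<in> A - {b. c b \<noteq> \<zero>\<^bsub>R\<^esub>}" for i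
      using that g A(2) by auto
    show "(\<lambda>b. c b \<odot>\<^bsub>Z\<^esub> g b) \<in> A \<rightarrow> carrier Z"
      using Z.R.free_module_coeff[OF c] g A(2) by auto
  qed simp
qed

lemma lin_ext_hom:
  assumes Z: "module R Z" and g: "\<And>b. b \<in> B \<Longrightarrow> g b \<in> carrier Z"
  shows "(\<lambda>c\<in>carrier (free_module R B). lin_ext R Z g c) \<in> mod_hom R (free_module R B) Z"
proof -
  interpret Z: module R Z by fact
  let ?F = "free_module R B"
  interpret F: module R ?F by (rule Z.R.free_module_module)
  let ?S = "\<lambda>c. {b. c b \<noteq> \<zero>\<^bsub>R\<^esub>}"
  have S: "finite (?S c)" "?S c \<subseteq> B" if "c \<in> carrier ?F" for c
    using that by (auto simp: free_module_simps)
  note co = Z.R.free_module_coeff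
  have cl: "(\<lambda>b. c b \<odot>\<^bsub>Z\<^esub> g b) \<in> A \<rightarrow> carrier Z" if "c \<in> carrier ?F" "A \<subseteq> B" for c A
    using co[OF that(1)] g that(2) by auto
  show ?thesis
  proof (rule mod_hom_restrictI[OF F.module_axioms])
    fix c assume c: "c \<in> carrier ?F"
    show "lin_ext R Z g c \<in> carrier Z"
      unfolding lin_ext_def by (rule Z.M.finsum_closed[OF cl[OF c S(2)[OF c]]])
    fix r assume r: "r \<in> carrier R"
    have "lin_ext R Z g (r \<odot>\<^bsub>?F\<^esub> c) = (\<Oplus>\<^bsub>Z\<^esub>b\<in>?S c. (r \<odot>\<^bsub>?F\<^esub> c) b \<odot>\<^bsub>Z\<^esub> g b)"
      using c r S[OF c] by (intro lin_ext_eq[OF Z g F.smult_closed]) (auto simp: free_module_simps(4))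
    also have "\<dots> = (\<Oplus>\<^bsub>Z\<^esub>b\<in>?S c. r \<odot>\<^bsub>Z\<^esub> (c b \<odot>\<^bsub>Z\<^esub> g b))"
      using r co[OF c] g S(2)[OF c]
      by (intro Z.M.finsum_cong') (auto simp: free_module_simps(4) Z.smult_assoc1)
    also have "\<dots> = r \<odot>\<^bsub>Z\<^esub> lin_ext R Z g c"
      unfolding lin_ext_def by (rule Z.finsum_smult_ldistr[symmetric, OF S(1)[OF c] r cl[OF c S(2)[OF c]]])
    finally show "lin_ext R Z g (r \<odot>\<^bsub>?F\<^esub> c) = r \<odot>\<^bsub>Z\<^esub> lin_ext R Z g c" .
  next
    fix c d assume c: "c \<in> carrier ?F" and d: "d \<in> carrier ?F"
    let ?A = "?S c \<union> ?S d"
    have A: "finite ?A" "?A \<subseteq> B" using S[OF c] S[OF d] by auto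
    have "lin_ext R Z g (c \<oplus>\<^bsub>?F\<^esub> d) = (\<Oplus>\<^bsub>Z\<^esub>b\<in>?A. (c \<oplus>\<^bsub>?F\<^esub> d) b \<odot>\<^bsub>Z\<^esub> g b)"
      using c d A by (intro lin_ext_eq[OF Z g F.M.a_closed]) (auto simp: free_module_simps(3))
    also have "\<dots> = (\<Oplus>\<^bsub>Z\<^esub>b\<in>?A. c b \<odot>\<^bsub>Z\<^esub> g b \<oplus>\<^bsub>Z\<^esub> d b \<odot>\<^bsub>Z\<^esub> g b)"
      using co[OF c] co[OF d] g A(2)
      by (intro Z.M.finsum_cong') (auto simp: free_module_simps(3) Z.smult_l_distr)
    also have "\<dots> = (\<Oplus>\<^bsub>Z\<^esub>b\<in>?A. c b \<odot>\<^bsub>Z\<^esub> g b) \<oplus>\<^bsub>Z\<^esub> (\<Oplus>\<^bsub>Z\<^esub>b\<in>?A. d b \<odot>\<^bsub>Z\<^esub> g b)"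
      by (rule Z.M.finsum_addf[OF cl[OF c A(2)] cl[OF d A(2)]])
    also have "\<dots> = lin_ext R Z g c \<oplus>\<^bsub>Z\<^esub> lin_ext R Z g d"
      using lin_ext_eq[OF Z g c A] lin_ext_eq[OF Z g d A] by simp
    finally show "lin_ext R Z g (c \<oplus>\<^bsub>?F\<^esub> d) = lin_ext R Z g c \<oplus>\<^bsub>Z\<^esub> lin_ext R Z g d" .
  qed
qed

lemma lin_ext_basis:
  assumes Z: "module R Z" and g: "\<And>b. b \<in> B \<Longrightarrow> g b \<in> carrier Z" and b: "b \<in> B"
  shows "lin_ext R Z g (free_basis R b) = g b"
proof -
  interpret Z: module R Z by fact
  have "lin_ext R Z g (free_basis R b) = (\<Oplus>\<^bsub>Z\<^esub>b'\<in>{b}. free_basis R b b' \<odot>\<^bsub>Z\<^esub> g b')"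
    using b by (intro lin_ext_eq[OF Z g Z.R.free_basis_closed]) (auto simp: free_basis_def)
  also have "\<dots> = g b"
    using g[OF b] Z.M.finsum_insert[of "{}" b "\<lambda>b'. free_basis R b b' \<odot>\<^bsub>Z\<^esub> g b'"] by (simp add: free_basis_def)
  finally show ?thesis .
qed

section \<open>The tensor product and its universal property\<close>

locale tensor =
  fixes R :: "('a, 'm) ring_scheme" and X :: "('a, 'b) module" and Y :: "('a, 'c) module"
  assumes X_module: "module R X" and Y_module: "module R Y"
begin

sublocale X: module R X by (rule X_module)
sublocale Y: module R Y by (rule Y_module)

abbreviation "F \<equiv> tensor_free R X Y"
abbreviation "T \<equiv> tensor_module R X Y"
abbreviation "N \<equiv> mod_span R F (tensor_relators R X Y)"
abbreviation "e x y \<equiv> free_basis R (x, y)"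

definition tens :: "'b \<Rightarrow> 'c \<Rightarrow> ('b \<times> 'c \<Rightarrow> 'a) set"
  where "tens x y = N +>\<^bsub>F\<^esub> e x y"

lemma F_module: "module R F"
  by (rule X.R.free_module_module)

sublocale F: module R F by (rule F_module)

lemma e_closed: "x \<in> carrier X \<Longrightarrow> y \<in> carrier Y \<Longrightarrow> e x y \<in> carrier F"
  by (rule X.R.free_basis_closed) simp

lemma relatorsI:
  "x \<in> carrier X \<Longrightarrow> x' \<in> carrier X \<Longrightarrow> y \<in> carrier Y \<Longrightarrow>
    e (x \<oplus>\<^bsub>X\<^esub> x') y \<ominus>\<^bsub>F\<^esub> (e x y \<oplus>\<^bsub>F\<^esub> e x' y) \<in> tensor_relators R X Y"
  "x \<in> carrier X \<Longrightarrow> y \<in> carrier Y \<Longrightarrow> y' \<in> carrier Y \<Longrightarrow>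
    e x (y \<oplus>\<^bsub>Y\<^esub> y') \<ominus>\<^bsub>F\<^esub> (e x y \<oplus>\<^bsub>F\<^esub> e x y') \<in> tensor_relators R X Y"
  "r \<in> carrier R \<Longrightarrow> x \<in> carrier X \<Longrightarrow> y \<in> carrier Y \<Longrightarrow>
    e (r \<odot>\<^bsub>X\<^esub> x) y \<ominus>\<^bsub>F\<^esub> r \<odot>\<^bsub>F\<^esub> e x y \<in> tensor_relators R X Y"
  "r \<in> carrier R \<Longrightarrow> x \<in> carrier X \<Longrightarrow> y \<in> carrier Y \<Longrightarrow>
    e x (r \<odot>\<^bsub>Y\<^esub> y) \<ominus>\<^bsub>F\<^esub> r \<odot>\<^bsub>F\<^esub> e x y \<in> tensor_relators R X Y"
  unfolding tensor_relators_def Let_def by blast+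

lemma relators_subset:
  assumes "\<And>x x' y. x \<in> carrier X \<Longrightarrow> x' \<in> carrier X \<Longrightarrow> y \<in> carrier Y \<Longrightarrow>
      e (x \<oplus>\<^bsub>X\<^esub> x') y \<ominus>\<^bsub>F\<^esub> (e x y \<oplus>\<^bsub>F\<^esub> e x' y) \<in> P"
    "\<And>x y y'. x \<in> carrier X \<Longrightarrow> y \<in> carrier Y \<Longrightarrow> y' \<in> carrier Y \<Longrightarrow>
      e x (y \<oplus>\<^bsub>Y\<^esub> y') \<ominus>\<^bsub>F\<^esub> (e x y \<oplus>\<^bsub>F\<^esub> e x y') \<in> P"
    "\<And>r x y. r \<in> carrier R \<Longrightarrow> x \<in> carrier X \<Longrightarrow> y \<in> carrier Y \<Longrightarrow>
      e (r \<odot>\<^bsub>X\<^esub> x) y \<ominus>\<^bsub>F\<^esub> r \<odot>\<^bsub>F\<^esub> e x y \<in> P"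
    "\<And>r x y. r \<in> carrier R \<Longrightarrow> x \<in> carrier X \<Longrightarrow> y \<in> carrier Y \<Longrightarrow>
      e x (r \<odot>\<^bsub>Y\<^esub> y) \<ominus>\<^bsub>F\<^esub> r \<odot>\<^bsub>F\<^esub> e x y \<in> P"
  shows "tensor_relators R X Y \<subseteq> P"
  unfolding tensor_relators_def Let_def using assms by auto

lemma relators_closed: "tensor_relators R X Y \<subseteq> carrier F"
  by (rule relators_subset) (simp_all add: e_closed)

lemma N_submodule: "submodule N R F"
  by (rule mod_span_submodule[OF F_module relators_closed])

lemma T_eq: "T = quot_module F N"
  by (simp add: tensor_module_def)

lemma T_module: "module R T"
  unfolding T_eq by (rule quot_module_module[OF F_module N_submodule])

sublocale T: module R T by (rule T_module)

abbreviation "proj \<equiv> \<lambda>c\<in>carrier F. N +>\<^bsub>F\<^esub> c"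

lemma proj_hom: "proj \<in> mod_hom R F T"
  unfolding T_eq by (rule quot_proj_hom[OF F_module N_submodule])

lemma T_carrier: "carrier T = {N +>\<^bsub>F\<^esub> c | c. c \<in> carrier F}"
  unfolding T_eq by (rule quot_module_carrier)

lemma tens_closed: "x \<in> carrier X \<Longrightarrow> y \<in> carrier Y \<Longrightarrow> tens x y \<in> carrier T"
  unfolding T_carrier tens_def using e_closed by blast

lemma coset_eqI:
  assumes "c \<in> carrier F" "d \<in> carrier F" "c \<ominus>\<^bsub>F\<^esub> d \<in> tensor_relators R X Y"
  shows "N +>\<^bsub>F\<^esub> c = N +>\<^bsub>F\<^esub> d"
  unfolding F.coset_eq_iff[OF N_submodule assms(1,2)]
  using assms(3) mod_span_superset[of "tensor_relators R X Y" R F] by blast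

lemma T_ops:
  "c \<in> carrier F \<Longrightarrow> d \<in> carrier F \<Longrightarrow> (N +>\<^bsub>F\<^esub> c) \<oplus>\<^bsub>T\<^esub> (N +>\<^bsub>F\<^esub> d) = N +>\<^bsub>F\<^esub> (c \<oplus>\<^bsub>F\<^esub> d)"
  "r \<in> carrier R \<Longrightarrow> c \<in> carrier F \<Longrightarrow> r \<odot>\<^bsub>T\<^esub> (N +>\<^bsub>F\<^esub> c) = N +>\<^bsub>F\<^esub> (r \<odot>\<^bsub>F\<^esub> c)"
  unfolding T_eq by (rule quot_module_simps[OF F_module N_submodule]; assumption)+

lemma tens_add_left:
  "x \<in> carrier X \<Longrightarrow> x' \<in> carrier X \<Longrightarrow> y \<in> carrier Y \<Longrightarrow> tens (x \<oplus>\<^bsub>X\<^esub> x') y = tens x y \<oplus>\<^bsub>T\<^esub> tens x' y"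
  unfolding tens_def by (simp add: T_ops e_closed coset_eqI relatorsI)

lemma tens_add_right:
  "x \<in> carrier X \<Longrightarrow> y \<in> carrier Y \<Longrightarrow> y' \<in> carrier Y \<Longrightarrow> tens x (y \<oplus>\<^bsub>Y\<^esub> y') = tens x y \<oplus>\<^bsub>T\<^esub> tens x y'"
  unfolding tens_def by (simp add: T_ops e_closed coset_eqI relatorsI)

lemma tens_smult_left:
  "r \<in> carrier R \<Longrightarrow> x \<in> carrier X \<Longrightarrow> y \<in> carrier Y \<Longrightarrow> tens (r \<odot>\<^bsub>X\<^esub> x) y = r \<odot>\<^bsub>T\<^esub> tens x y"
  unfolding tens_def by (simp add: T_ops e_closed coset_eqI relatorsI)

lemma tens_smult_right:
  "r \<in> carrier R \<Longrightarrow> x \<in> carrier X \<Longrightarrow> y \<in> carrier Y \<Longrightarrow> tens x (r \<odot>\<^bsub>Y\<^esub> y) = r \<odot>\<^bsub>T\<^esub> tens x y"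
  unfolding tens_def by (simp add: T_ops e_closed coset_eqI relatorsI)

lemma tensor_span:
  assumes P: "submodule P R T" and tens: "\<And>x y. x \<in> carrier X \<Longrightarrow> y \<in> carrier Y \<Longrightarrow> tens x y \<in> P"
  shows "carrier T \<subseteq> P"
proof -
  have "carrier F \<subseteq> {c \<in> carrier F. proj c \<in> P}"
  proof (rule X.R.free_module_span[OF vimage_submodule[OF F_module T_module proj_hom P]])
    fix b assume "b \<in> carrier X \<times> carrier Y"
    then obtain x y where "b = (x, y)" "x \<in> carrier X" "y \<in> carrier Y" by auto
    then show "free_basis R b \<in> {c \<in> carrier F. proj c \<in> P}"
      using e_closed tens by (simp add: tens_def)
  qed
  then show ?thesis by (auto simp: T_carrier)
qed

lemma tensor_hom_eq:
  assumes Z: "module R Z" and f: "f \<in> mod_hom R T Z" and g: "g \<in> mod_hom R T Z"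
    and eq: "\<And>x y. x \<in> carrier X \<Longrightarrow> y \<in> carrier Y \<Longrightarrow> f (tens x y) = g (tens x y)" and \<tau>: "\<tau> \<in> carrier T"
  shows "f \<tau> = g \<tau>"
proof -
  have "submodule {t \<in> carrier T. f t = g t} R T"
    using mod_homD[OF f] mod_homD[OF g] mod_hom_zero_minus(1)[OF T_module Z f] mod_hom_zero_minus(1)[OF T_module Z g]
    by (intro T.submoduleI_closed) auto
  then have "carrier T \<subseteq> {t \<in> carrier T. f t = g t}" using tens_closed eq by (intro tensor_span) auto
  then show ?thesis using \<tau> by blast
qed

lemma tensor_lift:
  assumes Z: "module R Z"
    and cl: "\<And>x y. x \<in> carrier X \<Longrightarrow> y \<in> carrier Y \<Longrightarrow> \<beta> x y \<in> carrier Z"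
    and add_l: "\<And>x x' y. x \<in> carrier X \<Longrightarrow> x' \<in> carrier X \<Longrightarrow> y \<in> carrier Y \<Longrightarrow>
      \<beta> (x \<oplus>\<^bsub>X\<^esub> x') y = \<beta> x y \<oplus>\<^bsub>Z\<^esub> \<beta> x' y"
    and add_r: "\<And>x y y'. x \<in> carrier X \<Longrightarrow> y \<in> carrier Y \<Longrightarrow> y' \<in> carrier Y \<Longrightarrow>
      \<beta> x (y \<oplus>\<^bsub>Y\<^esub> y') = \<beta> x y \<oplus>\<^bsub>Z\<^esub> \<beta> x y'"
    and sm_l: "\<And>r x y. r \<in> carrier R \<Longrightarrow> x \<in> carrier X \<Longrightarrow> y \<in> carrier Y \<Longrightarrow> \<beta> (r \<odot>\<^bsub>X\<^esub> x) y = r \<odot>\<^bsub>Z\<^esub> \<beta> x y"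
    and sm_r: "\<And>r x y. r \<in> carrier R \<Longrightarrow> x \<in> carrier X \<Longrightarrow> y \<in> carrier Y \<Longrightarrow> \<beta> x (r \<odot>\<^bsub>Y\<^esub> y) = r \<odot>\<^bsub>Z\<^esub> \<beta> x y"
  shows "tensor_lift R X Y Z \<beta> \<in> mod_hom R T Z"
    and "x \<in> carrier X \<Longrightarrow> y \<in> carrier Y \<Longrightarrow> tensor_lift R X Y Z \<beta> (tens x y) = \<beta> x y"
proof -
  interpret Z: module R Z by fact
  let ?g = "\<lambda>p. \<beta> (fst p) (snd p)" and ?B = "carrier X \<times> carrier Y"
  let ?\<Lambda> = "lin_ext R Z ?g" and ?\<Lambda>r = "\<lambda>c\<in>carrier F. lin_ext R Z ?g c"
  have g: "\<And>p. p \<in> ?B \<Longrightarrow> ?g p \<in> carrier Z" using cl by auto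
  have \<Lambda>: "?\<Lambda>r \<in> mod_hom R F Z" by (rule lin_ext_hom[OF Z g])
  note \<Lambda>D = mod_homD[OF \<Lambda>]
  have \<Lambda>e: "?\<Lambda>r (e x y) = \<beta> x y" if "x \<in> carrier X" "y \<in> carrier Y" for x y
    using lin_ext_basis[OF Z g, where b = "(x, y)"] e_closed[OF that] that by simp
  have \<Lambda>z: "?\<Lambda>r (c \<ominus>\<^bsub>F\<^esub> d) = \<zero>\<^bsub>Z\<^esub>" if "c \<in> carrier F" "d \<in> carrier F" "?\<Lambda>r c = ?\<Lambda>r d" for c d
    using mod_hom_zero_minus(3)[OF F_module Z \<Lambda> that(1,2)] that \<Lambda>D(1)[OF that(1)] \<Lambda>D(1)[OF that(2)]
    by (simp only: Z.diff_zero_iff)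
  let ?K = "{c \<in> carrier F. ?\<Lambda>r c = \<zero>\<^bsub>Z\<^esub>}"
  have "tensor_relators R X Y \<subseteq> ?K"
  proof (rule relators_subset)
    fix x x' y assume *: "x \<in> carrier X" "x' \<in> carrier X" "y \<in> carrier Y"
    then have cl': "e (x \<oplus>\<^bsub>X\<^esub> x') y \<in> carrier F" "e x y \<in> carrier F" "e x' y \<in> carrier F" by (simp_all add: e_closed)
    have "?\<Lambda>r (e (x \<oplus>\<^bsub>X\<^esub> x') y) = ?\<Lambda>r (e x y \<oplus>\<^bsub>F\<^esub> e x' y)"
      unfolding \<Lambda>D(2)[OF cl'(2,3)] using * by (simp only: \<Lambda>e X.M.a_closed add_l)
    then show "e (x \<oplus>\<^bsub>X\<^esub> x') y \<ominus>\<^bsub>F\<^esub> (e x y \<oplus>\<^bsub>F\<^esub> e x' y) \<in> ?K"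
      using cl' \<Lambda>z[of "e (x \<oplus>\<^bsub>X\<^esub> x') y" "e x y \<oplus>\<^bsub>F\<^esub> e x' y"] by simp
  next
    fix x y y' assume *: "x \<in> carrier X" "y \<in> carrier Y" "y' \<in> carrier Y"
    then have cl': "e x (y \<oplus>\<^bsub>Y\<^esub> y') \<in> carrier F" "e x y \<in> carrier F" "e x y' \<in> carrier F" by (simp_all add: e_closed)
    have "?\<Lambda>r (e x (y \<oplus>\<^bsub>Y\<^esub> y')) = ?\<Lambda>r (e x y \<oplus>\<^bsub>F\<^esub> e x y')"
      unfolding \<Lambda>D(2)[OF cl'(2,3)] using * by (simp only: \<Lambda>e Y.M.a_closed add_r)
    then show "e x (y \<oplus>\<^bsub>Y\<^esub> y') \<ominus>\<^bsub>F\<^esub> (e x y \<oplus>\<^bsub>F\<^esub> e x y') \<in> ?K"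
      using cl' \<Lambda>z[of "e x (y \<oplus>\<^bsub>Y\<^esub> y')" "e x y \<oplus>\<^bsub>F\<^esub> e x y'"] by simp
  next
    fix r x y assume *: "r \<in> carrier R" "x \<in> carrier X" "y \<in> carrier Y"
    then have cl': "e (r \<odot>\<^bsub>X\<^esub> x) y \<in> carrier F" "e x (r \<odot>\<^bsub>Y\<^esub> y) \<in> carrier F" "e x y \<in> carrier F"
      by (simp_all add: e_closed)
    have "?\<Lambda>r (e (r \<odot>\<^bsub>X\<^esub> x) y) = ?\<Lambda>r (r \<odot>\<^bsub>F\<^esub> e x y)" "?\<Lambda>r (e x (r \<odot>\<^bsub>Y\<^esub> y)) = ?\<Lambda>r (r \<odot>\<^bsub>F\<^esub> e x y)"
      unfolding \<Lambda>D(3)[OF *(1) cl'(3)]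
      using * by (simp_all only: \<Lambda>e X.smult_closed Y.smult_closed sm_l sm_r)
    then show "e (r \<odot>\<^bsub>X\<^esub> x) y \<ominus>\<^bsub>F\<^esub> r \<odot>\<^bsub>F\<^esub> e x y \<in> ?K" "e x (r \<odot>\<^bsub>Y\<^esub> y) \<ominus>\<^bsub>F\<^esub> r \<odot>\<^bsub>F\<^esub> e x y \<in> ?K"
      using cl' *(1) \<Lambda>z[of "e (r \<odot>\<^bsub>X\<^esub> x) y" "r \<odot>\<^bsub>F\<^esub> e x y"] \<Lambda>z[of "e x (r \<odot>\<^bsub>Y\<^esub> y)" "r \<odot>\<^bsub>F\<^esub> e x y"]
      by simp_all
  qed
  then have NK: "N \<subseteq> ?K" by (rule mod_span_least[OF kernel_submodule[OF F_module Z \<Lambda>]])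
  have lift: "tensor_lift R X Y Z \<beta> (N +>\<^bsub>F\<^esub> c) = ?\<Lambda>r c" if c: "c \<in> carrier F" for c
  proof -
    \<comment> \<open>The linear extension kills \<open>N\<close>, so it is constant on each coset.
      The image is a singleton, which gives \<open>the_elem\<close> in \<open>tensor_lift\<close>
      its meaning.\<close>
    have "?\<Lambda> ` (N +>\<^bsub>F\<^esub> c) = {?\<Lambda>r c}"
    proof (intro equalityI subsetI)
      fix z assume "z \<in> ?\<Lambda> ` (N +>\<^bsub>F\<^esub> c)"
      then obtain n where n: "n \<in> N" "z = ?\<Lambda> (n \<oplus>\<^bsub>F\<^esub> c)" by (auto simp: a_r_coset_def')
      have nF: "n \<in> carrier F" "?\<Lambda>r n = \<zero>\<^bsub>Z\<^esub>" using n(1) NK by auto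
      have "z = ?\<Lambda>r (n \<oplus>\<^bsub>F\<^esub> c)" using n nF c by simp
      also have "\<dots> = ?\<Lambda>r c" unfolding \<Lambda>D(2)[OF nF(1) c] nF(2) using \<Lambda>D(1)[OF c] by (rule Z.M.l_zero)
      finally show "z \<in> {?\<Lambda>r c}" by simp
    next
      fix z assume "z \<in> {?\<Lambda>r c}"
      moreover have "c \<in> N +>\<^bsub>F\<^esub> c"
        using F.coset_mem_iff[OF N_submodule c c] F.submoduleD(2)[OF N_submodule] c
        by (simp add: F.M.minus_eq F.M.r_neg)
      ultimately show "z \<in> ?\<Lambda> ` (N +>\<^bsub>F\<^esub> c)" using c by auto
    qed
    moreover have "N +>\<^bsub>F\<^esub> c \<in> carrier T" using c unfolding T_carrier by blast
    ultimately show ?thesis by (simp add: tensor_lift_def lin_ext_def)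
  qed
  \<comment> \<open>The lift is extensional by definition; written as a restriction it has the shape
    that \<open>mod_hom_restrictI\<close> proves to be a homomorphism.\<close>
  have ext: "tensor_lift R X Y Z \<beta> = (\<lambda>C\<in>carrier T. tensor_lift R X Y Z \<beta> C)"
    by (rule ext) (simp add: tensor_lift_def)
  show "tensor_lift R X Y Z \<beta> \<in> mod_hom R T Z"
  proof (subst ext, rule mod_hom_restrictI[OF T_module])
    fix C assume "C \<in> carrier T"
    then obtain c where c: "c \<in> carrier F" "C = N +>\<^bsub>F\<^esub> c" unfolding T_carrier by blast
    then show "tensor_lift R X Y Z \<beta> C \<in> carrier Z" using lift[OF c(1)] \<Lambda>D(1)[OF c(1)] by (simp only:)
    show "tensor_lift R X Y Z \<beta> (r \<odot>\<^bsub>T\<^esub> C) = r \<odot>\<^bsub>Z\<^esub> tensor_lift R X Y Z \<beta> C" if r: "r \<in> carrier R" for r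
      unfolding c(2) T_ops(2)[OF r c(1)] lift[OF c(1)] lift[OF F.smult_closed[OF r c(1)]] by (rule \<Lambda>D(3)[OF r c(1)])
    fix D assume "D \<in> carrier T"
    then obtain d where d: "d \<in> carrier F" "D = N +>\<^bsub>F\<^esub> d" unfolding T_carrier by blast
    show "tensor_lift R X Y Z \<beta> (C \<oplus>\<^bsub>T\<^esub> D) = tensor_lift R X Y Z \<beta> C \<oplus>\<^bsub>Z\<^esub> tensor_lift R X Y Z \<beta> D"
      unfolding c(2) d(2) T_ops(1)[OF c(1) d(1)] lift[OF c(1)] lift[OF d(1)] lift[OF F.M.a_closed[OF c(1) d(1)]]
      by (rule \<Lambda>D(2)[OF c(1) d(1)])
  qed
  show "tensor_lift R X Y Z \<beta> (tens x y) = \<beta> x y" if "x \<in> carrier X" "y \<in> carrier Y" for x y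
    unfolding tens_def lift[OF e_closed[OF that]] by (rule \<Lambda>e[OF that])
qed

end

subsection \<open>The evaluation map\<close>

context matlis_module
begin

text \<open>The adjunction between maps \<open>H \<otimes> D(H) \<rightarrow> E\<close> and
  endomorphisms of \<open>D(H)\<close> is applied element by element: \<open>\<psi>\<close>
  corresponds to \<open>x \<otimes> f \<mapsto> \<psi> f x\<close>, and multiplication by
  \<open>r\<close> corresponds to \<open>r\<close> times the evaluation map. Faithfulness of
  \<open>D(H)\<close> matches surjectivity of evaluation, and endomorphisms being multiplications
  match its injectivity.\<close>

lemma dual_eval_iff:
  "homothety R DH \<in> mod_iso R (ring_as_module R) (hom_module R DH DH) \<longleftrightarrow>
    matlis_eval R E H \<in> mod_iso R (tensor_module R H DH) E"
proof -
  interpret T: tensor R H DH by (rule tensor.intro[OF H_module DH_module])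
  let ?T = "tensor_module R H DH" and ?ev = "matlis_eval R E H"
  have DH_mem: "f \<in> carrier DH \<longleftrightarrow> f \<in> mod_hom R H E" for f by (simp add: hom_module_simps)
  note ev_lift = T.tensor_lift[OF E_module, of "\<lambda>x f. f x", folded matlis_eval_def]
  have ev: "?ev \<in> mod_hom R ?T E"
    by (rule ev_lift) (auto simp: DH_mem hom_module_simps(3,4) mod_homD)
  have ev_tens: "?ev (T.tens x f) = f x" if "x \<in> carrier H" "f \<in> carrier DH" for x f
    by (rule ev_lift) (use that in \<open>auto simp: DH_mem hom_module_simps(3,4) mod_homD\<close>)
  note evD = mod_homD[OF ev]
  have sm_ev: "(\<lambda>t\<in>carrier ?T. (\<lambda>e\<in>carrier E. r \<odot>\<^bsub>E\<^esub> e) (?ev t)) \<in> mod_hom R ?T E" if "r \<in> carrier R" for r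
    by (rule mod_hom_comp[OF T.T_module ev smult_hom[OF E_module that]])
  show ?thesis
  proof
    assume iso: "?ev \<in> mod_iso R ?T E"
    then have inj: "inj_on ?ev (carrier ?T)" and surj: "?ev ` carrier ?T = carrier E"
      by (auto simp: mod_iso_def bij_betw_def)
    have "r = \<zero>\<^bsub>R\<^esub>" if r: "r \<in> carrier R" "\<forall>f\<in>carrier DH. r \<odot>\<^bsub>DH\<^esub> f = \<zero>\<^bsub>DH\<^esub>" for r
    proof (rule E_faithful[OF r(1)])
      fix y assume "y \<in> carrier E"
      then obtain t where t: "t \<in> carrier ?T" "y = ?ev t" using surj by blast
      let ?z = "\<lambda>t\<in>carrier ?T. \<zero>\<^bsub>E\<^esub>"
      have z: "?z \<in> mod_hom R ?T E" by (intro mod_hom_restrictI T.T_module) auto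
      \<comment> \<open>If \<open>r\<close> kills \<open>D(H)\<close>, then \<open>r\<close> times
        evaluation is zero on pure tensors and hence everywhere; as evaluation is onto
        \<open>E\<close>, the scalar \<open>r\<close> kills \<open>E\<close>.\<close>
      have "(\<lambda>t\<in>carrier ?T. (\<lambda>e\<in>carrier E. r \<odot>\<^bsub>E\<^esub> e) (?ev t)) t = ?z t"
      proof (rule T.tensor_hom_eq[OF E_module sm_ev[OF r(1)] z _ t(1)])
        fix x f assume xf: "x \<in> carrier H" "f \<in> carrier DH"
        have fx: "f x \<in> carrier E" using xf mod_homD(1) by (auto simp: DH_mem)
        have "r \<odot>\<^bsub>E\<^esub> f x = (r \<odot>\<^bsub>DH\<^esub> f) x" using xf by (simp add: hom_module_simps)
        also have "\<dots> = \<zero>\<^bsub>E\<^esub>" using r(2) xf by (simp add: hom_module_simps(2))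
        finally show "(\<lambda>t\<in>carrier ?T. (\<lambda>e\<in>carrier E. r \<odot>\<^bsub>E\<^esub> e) (?ev t)) (T.tens x f) = ?z (T.tens x f)"
          using T.tens_closed[OF xf] ev_tens[OF xf] fx by simp
      qed
      then show "r \<odot>\<^bsub>E\<^esub> y = \<zero>\<^bsub>E\<^esub>" using t evD(1) by simp
    qed
    moreover have "\<exists>r\<in>carrier R. \<forall>f\<in>carrier DH. \<psi> f = r \<odot>\<^bsub>DH\<^esub> f" if \<psi>: "\<psi> \<in> mod_hom R DH DH" for \<psi>
    proof -
      note \<psi>D = mod_homD[OF \<psi>]
      have \<psi>f: "\<psi> f \<in> mod_hom R H E" if "f \<in> carrier DH" for f using \<psi>D(1)[OF that] by (simp add: DH_mem)
      let ?\<beta> = "\<lambda>x f. \<psi> f x"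
      have \<beta>: "?\<beta> x f \<in> carrier E" "?\<beta> (x \<oplus>\<^bsub>H\<^esub> x') f = ?\<beta> x f \<oplus>\<^bsub>E\<^esub> ?\<beta> x' f"
        "?\<beta> x (f \<oplus>\<^bsub>DH\<^esub> f') = ?\<beta> x f \<oplus>\<^bsub>E\<^esub> ?\<beta> x f'" "r \<in> carrier R \<Longrightarrow> ?\<beta> (r \<odot>\<^bsub>H\<^esub> x) f = r \<odot>\<^bsub>E\<^esub> ?\<beta> x f"
        "r \<in> carrier R \<Longrightarrow> ?\<beta> x (r \<odot>\<^bsub>DH\<^esub> f) = r \<odot>\<^bsub>E\<^esub> ?\<beta> x f"
        if "x \<in> carrier H" "x' \<in> carrier H" "f \<in> carrier DH" "f' \<in> carrier DH" for x x' f f' r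
        using that mod_homD[OF \<psi>f[OF that(3)]] \<psi>D(2,3) by (simp_all add: hom_module_simps(3,4))
      note lift = T.tensor_lift[OF E_module, of ?\<beta>]
      let ?L = "tensor_lift R H DH E ?\<beta>"
      have L: "?L \<in> mod_hom R ?T E" by (rule lift) (use \<beta> in auto)
      have L_tens: "?L (T.tens x f) = \<psi> f x" if "x \<in> carrier H" "f \<in> carrier DH" for x f
        by (rule lift) (use \<beta> that in auto)
      have ker: "?L t = \<zero>\<^bsub>E\<^esub>" if t: "t \<in> carrier ?T" "?ev t = \<zero>\<^bsub>E\<^esub>" for t
      proof -
        have "t = \<zero>\<^bsub>?T\<^esub>"
          using inj t mod_hom_zero_minus(1)[OF T.T_module E_module ev] T.T.M.zero_closed by (metis inj_onD)
        then show ?thesis using mod_hom_zero_minus(1)[OF T.T_module E_module L] by simp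
      qed
      \<comment> \<open>Evaluation has zero kernel, so the lift \<open>?L\<close> of
        \<open>\<psi>\<close> factors through it by an endomorphism of \<open>E\<close>. The scalar
        that describes this endomorphism also describes \<open>\<psi>\<close>.\<close>
      obtain \<theta> where \<theta>: "\<theta> \<in> mod_hom R E E" "\<And>t. t \<in> carrier ?T \<Longrightarrow> \<theta> (?ev t) = ?L t"
        using injective_factor[OF E_injective E_module T.T_module T.T.carrier_is_submodule ev L ker] by blast
      obtain r where r: "r \<in> carrier R" "\<And>y. y \<in> carrier E \<Longrightarrow> \<theta> y = r \<odot>\<^bsub>E\<^esub> y" by (rule endo_E[OF \<theta>(1)]) blast
      have "\<psi> f = r \<odot>\<^bsub>DH\<^esub> f" if f: "f \<in> carrier DH" for f
      proof (rule mod_hom_eqI[OF \<psi>f[OF f]])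
        show "r \<odot>\<^bsub>DH\<^esub> f \<in> mod_hom R H E" using DH.smult_closed[OF r(1) f] by (simp add: DH_mem)
        show "\<psi> f x = (r \<odot>\<^bsub>DH\<^esub> f) x" if x: "x \<in> carrier H" for x
        proof -
          have fx: "f x \<in> carrier E" using f x mod_homD(1) by (auto simp: DH_mem)
          have "\<psi> f x = \<theta> (f x)"
            using \<theta>(2)[OF T.tens_closed[OF x f]] L_tens[OF x f] ev_tens[OF x f] by simp
          then show ?thesis using r(2)[OF fx] x by (simp add: hom_module_simps)
        qed
      qed
      then show ?thesis using r(1) by blast
    qed
    ultimately show "homothety R DH \<in> mod_iso R (ring_as_module R) (hom_module R DH DH)"
      unfolding homothety_iso_iff[OF DH_module] by blast
  next
    assume "homothety R DH \<in> mod_iso R (ring_as_module R) (hom_module R DH DH)"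
    then have faithful: "\<And>r. r \<in> carrier R \<Longrightarrow> (\<And>f. f \<in> carrier DH \<Longrightarrow> r \<odot>\<^bsub>DH\<^esub> f = \<zero>\<^bsub>DH\<^esub>) \<Longrightarrow> r = \<zero>\<^bsub>R\<^esub>"
      and endo: "\<And>\<psi>. \<psi> \<in> mod_hom R DH DH \<Longrightarrow> \<exists>r\<in>carrier R. \<forall>f\<in>carrier DH. \<psi> f = r \<odot>\<^bsub>DH\<^esub> f"
      unfolding homothety_iso_iff[OF DH_module] by blast+
    have im: "submodule (?ev ` carrier ?T) R E"
      by (rule image_submodule[OF T.T_module E_module ev T.T.carrier_is_submodule])
    have "y \<in> ?ev ` carrier ?T" if y: "y \<in> carrier E" for y
    proof (rule ccontr)
      assume ny: "y \<notin> ?ev ` carrier ?T"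
      let ?I = "?ev ` carrier ?T"
      let ?Q = "quot_module E ?I" and ?p = "\<lambda>x\<in>carrier E. ?I +>\<^bsub>E\<^esub> x"
      have Q: "module R ?Q" by (rule quot_module_module[OF E_module im])
      have p: "?p \<in> mod_hom R E ?Q" by (rule quot_proj_hom[OF E_module im])
      have p_zero: "?p x = \<zero>\<^bsub>?Q\<^esub> \<longleftrightarrow> x \<in> ?I" if "x \<in> carrier E" for x
        using E.coset_eq_iff[OF im that E.M.zero_closed] quot_module_simps(3)[OF E_module im]
          E.M.minus_zero_right[OF that] that by simp
      obtain g where g: "g \<in> mod_hom R ?Q E" "g (?p y) \<noteq> \<zero>\<^bsub>E\<^esub>"
        by (rule cogenerator[OF Q mod_homD(1)[OF p y]]) (use p_zero[OF y] ny in auto)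
      \<comment> \<open>A map on the cokernel of evaluation that is nonzero at the class of
        \<open>y\<close> gives an endomorphism of \<open>E\<close>, hence a scalar \<open>r\<close>.
        It kills every value \<open>f x\<close>, so it kills \<open>D(H)\<close> and must be zero,
        which contradicts its action on \<open>y\<close>.\<close>
      have comp: "(\<lambda>x\<in>carrier E. g (?p x)) \<in> mod_hom R E E" by (rule mod_hom_comp[OF E_module p g(1)])
      obtain r where r: "r \<in> carrier R" "\<And>x. x \<in> carrier E \<Longrightarrow> (\<lambda>x\<in>carrier E. g (?p x)) x = r \<odot>\<^bsub>E\<^esub> x"
        by (rule endo_E[OF comp]) blast
      have "r \<odot>\<^bsub>DH\<^esub> f = \<zero>\<^bsub>DH\<^esub>" if f: "f \<in> carrier DH" for f
      proof (rule mod_hom_eqI[of _ R H E])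
        show "r \<odot>\<^bsub>DH\<^esub> f \<in> mod_hom R H E" "\<zero>\<^bsub>DH\<^esub> \<in> mod_hom R H E"
          using DH.smult_closed[OF r(1) f] DH.M.zero_closed by (simp_all add: DH_mem)
        fix x assume x: "x \<in> carrier H"
        have fx: "f x \<in> carrier E" "f x \<in> ?I"
          using f x mod_homD(1) ev_tens[OF x f] T.tens_closed[OF x f] by (auto simp: DH_mem intro: rev_image_eqI)
        have "r \<odot>\<^bsub>E\<^esub> f x = g (?p (f x))" using r(2)[OF fx(1)] fx(1) by simp
        also have "\<dots> = \<zero>\<^bsub>E\<^esub>" using p_zero[OF fx(1)] fx(2) mod_hom_zero_minus(1)[OF Q E_module g(1)] by simp
        finally show "(r \<odot>\<^bsub>DH\<^esub> f) x = \<zero>\<^bsub>DH\<^esub> x" using x by (simp add: hom_module_simps)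
      qed
      then have "r = \<zero>\<^bsub>R\<^esub>" by (rule faithful[OF r(1)])
      then show False using r(2)[OF y] g(2) y by simp
    qed
    then have surj: "?ev ` carrier ?T = carrier E" using evD(1) by blast
    have inj0: "t = \<zero>\<^bsub>?T\<^esub>" if t: "t \<in> carrier ?T" "?ev t = \<zero>\<^bsub>E\<^esub>" for t
    proof (rule ccontr)
      assume "t \<noteq> \<zero>\<^bsub>?T\<^esub>"
      then obtain g where g: "g \<in> mod_hom R ?T E" "g t \<noteq> \<zero>\<^bsub>E\<^esub>" by (rule cogenerator[OF T.T_module t(1)])
      note gD = mod_homD[OF g(1)]
      \<comment> \<open>The endomorphism of \<open>D(H)\<close> adjoint to \<open>g\<close>. It is
        multiplication by some \<open>r\<close>, so \<open>g\<close> is \<open>r\<close> times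
        evaluation and vanishes at \<open>t\<close> after all.\<close>
      let ?\<psi> = "\<lambda>f. \<lambda>x\<in>carrier H. g (T.tens x f)"
      have \<psi>: "?\<psi> f \<in> mod_hom R H E" if "f \<in> carrier DH" for f
        using that by (intro mod_hom_restrictI H_module)
          (simp_all add: gD T.tens_closed T.tens_add_left T.tens_smult_left)
      have "(\<lambda>f\<in>carrier DH. ?\<psi> f) \<in> mod_hom R DH DH"
      proof (rule mod_hom_restrictI[OF DH_module])
        fix f assume f: "f \<in> carrier DH"
        then show "?\<psi> f \<in> carrier DH" using \<psi> by (simp add: DH_mem)
        show "?\<psi> (r \<odot>\<^bsub>DH\<^esub> f) = r \<odot>\<^bsub>DH\<^esub> ?\<psi> f" if r: "r \<in> carrier R" for r
          unfolding hom_module_simps(4)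
        proof (rule mod_hom_eqI[OF \<psi>[OF DH.smult_closed[OF r f]]])
          show "r \<odot>\<^bsub>DH\<^esub> ?\<psi> f \<in> mod_hom R H E"
            using DH.smult_closed[OF r, of "?\<psi> f"] \<psi>[OF f] by (simp add: DH_mem)
          show "?\<psi> (r \<odot>\<^bsub>DH\<^esub> f) x = (r \<odot>\<^bsub>DH\<^esub> ?\<psi> f) x" if "x \<in> carrier H" for x
            using that r f by (simp add: hom_module_simps(4) gD T.tens_closed T.tens_smult_right)
        qed
        fix f' assume f': "f' \<in> carrier DH"
        show "?\<psi> (f \<oplus>\<^bsub>DH\<^esub> f') = ?\<psi> f \<oplus>\<^bsub>DH\<^esub> ?\<psi> f'"
        proof (rule mod_hom_eqI[OF \<psi>[OF DH.M.a_closed[OF f f']]])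
          show "?\<psi> f \<oplus>\<^bsub>DH\<^esub> ?\<psi> f' \<in> mod_hom R H E"
            using DH.M.a_closed[of "?\<psi> f" "?\<psi> f'"] \<psi>[OF f] \<psi>[OF f'] by (simp add: DH_mem)
          show "?\<psi> (f \<oplus>\<^bsub>DH\<^esub> f') x = (?\<psi> f \<oplus>\<^bsub>DH\<^esub> ?\<psi> f') x" if "x \<in> carrier H" for x
            using that f f' by (simp add: hom_module_simps(3) gD T.tens_closed T.tens_add_right)
        qed
      qed
      from endo[OF this] obtain r where r: "r \<in> carrier R"
        "\<forall>f\<in>carrier DH. (\<lambda>f\<in>carrier DH. ?\<psi> f) f = r \<odot>\<^bsub>DH\<^esub> f" by blast
      have r\<psi>: "?\<psi> f = r \<odot>\<^bsub>DH\<^esub> f" if "f \<in> carrier DH" for f using bspec[OF r(2) that] that by simp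
      have "g t = (\<lambda>t\<in>carrier ?T. (\<lambda>e\<in>carrier E. r \<odot>\<^bsub>E\<^esub> e) (?ev t)) t"
      proof (rule T.tensor_hom_eq[OF E_module g(1) sm_ev[OF r(1)] _ t(1)])
        fix x f assume xf: "x \<in> carrier H" "f \<in> carrier DH"
        have fx: "f x \<in> carrier E" using xf mod_homD(1) by (auto simp: DH_mem)
        have "g (T.tens x f) = (r \<odot>\<^bsub>DH\<^esub> f) x" using fun_cong[OF r\<psi>[OF xf(2)], of x] xf by simp
        then show "g (T.tens x f) = (\<lambda>t\<in>carrier ?T. (\<lambda>e\<in>carrier E. r \<odot>\<^bsub>E\<^esub> e) (?ev t)) (T.tens x f)"
          using xf T.tens_closed[OF xf] ev_tens[OF xf] fx by (simp add: hom_module_simps)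
      qed
      also have "\<dots> = \<zero>\<^bsub>E\<^esub>" using t r(1) by simp
      finally show False using g(2) by simp
    qed
    have "inj_on ?ev (carrier ?T)"
    proof (rule inj_onI)
      fix s t assume st: "s \<in> carrier ?T" "t \<in> carrier ?T" "?ev s = ?ev t"
      have "?ev (s \<ominus>\<^bsub>?T\<^esub> t) = \<zero>\<^bsub>E\<^esub>"
        using mod_hom_zero_minus(3)[OF T.T_module E_module ev st(1,2)] st evD(1) by (simp add: E.diff_zero_iff)
      then have "s \<ominus>\<^bsub>?T\<^esub> t = \<zero>\<^bsub>?T\<^esub>" using st by (intro inj0) auto
      then show "s = t" using st T.T.diff_zero_iff by simp
    qed
    then show "?ev \<in> mod_iso R ?T E" using ev surj by (simp add: mod_iso_def bij_betw_def)
  qed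
qed

end

theorem corollary3p6:
  fixes R :: "('a, 'm) ring_scheme" and \<mm> I J :: "'a set" and n t :: nat
    and E :: "('a, 'e) module" and \<iota> :: "'a set \<Rightarrow> 'e"
    and M :: "('a, 'b) module"
    and Q :: "nat \<Rightarrow> ('a, 'q) module" and \<epsilon> :: "'b \<Rightarrow> 'q" and d :: "nat \<Rightarrow> 'q \<Rightarrow> 'q"
    and H :: "('a, 'q set) module"
  assumes "noetherian_local_ring R \<mm>" and "adically_complete R \<mm>" and "krull_dim R = enat n"
    and "injective_hull R (residue_module R \<mm>) E \<iota>"
    and "ideal I R" and "ideal J R"
    and "fin_gen_module R M"
    and "injective_resolution R M Q \<epsilon> d"
    and "ij_depth R I J Q d = enat t"
    and "H = local_cohomology R I J Q d t"
  shows "(homothety R H \<in> mod_iso R (ring_as_module R) (hom_module R H H) \<longleftrightarrow>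
      homothety R (matlis_dual R E H)
        \<in> mod_iso R (ring_as_module R) (hom_module R (matlis_dual R E H) (matlis_dual R E H))) \<and>
    (homothety R (matlis_dual R E H)
        \<in> mod_iso R (ring_as_module R) (hom_module R (matlis_dual R E H) (matlis_dual R E H)) \<longleftrightarrow>
      matlis_eval R E H \<in> mod_iso R (tensor_module R H (matlis_dual R E H)) E)"
proof -
  interpret E: matlis R \<mm> E \<iota> by (rule matlis.intro) (use assms in auto)
  interpret Q: ij_resolution R M Q \<epsilon> d I J
    by (intro ij_resolution.intro fin_gen_resolution.intro ij_resolution_axioms.intro E.R_cring E.R_noeth assms)
  interpret H: matlis_module R \<mm> E \<iota> H
    by (intro matlis_module.intro matlis_module_axioms.intro E.matlis_axioms)
      (simp add: assms(10) Q.coho_module)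
  have "\<exists>a F. ideal a R \<and> h \<in> ann_in H a \<and> finite F \<and> F \<subseteq> carrier H \<and>
      F \<subseteq> ann_in H a \<and> ann_in H a \<subseteq> mod_span R H F" if "h \<in> carrier H" for h
    using Q.coho_ann_fin_gen[OF assms(9)] that unfolding assms(10) by metis
  then show ?thesis using H.homothety_dual_iff H.dual_eval_iff by blast
qed

end
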